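(* Let $N\ge3$, $q>1$, $\lambda,\theta\in\mathbb R$ and consider the problem $$(E)\qquad -\Delta u-\frac{\lambda}{|x|^2}u+|x|^\theta u^q=0\ \text{ in }\mathbb R^N\setminus\{0\},\qquad u>0\ \text{ in }\mathbb R^N\setminus\{0\}.$$ (1) Let Case $(\mathcal M_2)$ hold, i.e. $\lambda\le\lambda_H$ and $\theta>\theta_+$. For every $\gamma\in(0,\infty)$, $(E)$ subject to $\lim_{|x|\to0}u(x)/\Phi_\lambda^+(x)=\gamma$ has a unique solution $u_\gamma$. All solutions $u$ of $(E)$ satisfy $\lim_{|x|\to\infty}u(x)/U_0(x)=1$ and are radially symmetric, being given by $U_0$ and $\{u_\gamma:\ \gamma\in(0,\infty)\}$. In addition, $u_\gamma\le u_{\gamma'}\le U_0$ in $\mathbb R^N\setminus\{0\}$ for every $0<\gamma<\gamma'<\infty$, and $U_0(x)=\lim_{\gamma\to\infty}u_\gamma(x)$ for each $x\in\mathbb R^N\setminus\{0\}$. (2) Let Case $(\mathcal M_1)$ hold, i.e. $\lambda\le\lambda_H$ and $\theta<\theta_-$. For every $\gamma\in(0,\infty)$, $(E)$ subject to $$\lim_{|x|\to\infty}\frac{|x|^{N-2}u(x)}{\Phi_\lambda^+(1/|x|)}=\gamma$$ has a unique solution, say $U_\gamma$. All solutions $u$ of $(E)$ satisfy $\lim_{|x|\to0}u(x)/U_0(x)=1$ and are radially symmetric, being given by $U_0$ and $\{U_\gamma:\ \gamma\in(0,\infty)\}$.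
   Context: Notation: $\lambda_H:=(N-2)^2/4$; for $\lambda\le\lambda_H$, $p_\pm:=\frac{N-2}{2}\pm\sqrt{\lambda_H-\lambda}$ and $\theta_\pm:=p_\pm(q-1)-2$. Also $\Theta:=\frac{\theta+2}{q-1}$, $\ell:=\Theta^2-(N-2)\Theta+\lambda$ (positive in both cases considered) and $U_0(x):=\ell^{1/(q-1)}|x|^{-\Theta}$ for $x\ne0$. For $\lambda<\lambda_H$, $\Phi_\lambda^+(x):=|x|^{-p_+}$ for $x\ne0$; for $\lambda=\lambda_H$, $\Phi_\lambda^+(x):=|x|^{-\frac{N-2}{2}}\log(1/|x|)$ for $0<|x|<1$. As $\Phi_\lambda^+$ is radial, $\Phi_\lambda^+(r)$ denotes its value at $|x|=r$. A solution of $(E)$ is a positive function $u\in C^1(\mathbb R^N\setminus\{0\})$ such that for every $\varphi\in C^1_c(\mathbb R^N\setminus\{0\})$, $$\int\nabla u\cdot\nabla\varphi\,dx-\int\frac{\lambda}{|x|^2}u\,\varphi\,dx+\int|x|^\theta u^q\varphi\,dx=0,$$ the integrals being over $\mathbb R^N$. *)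

theory Defs
  imports "HOL-Analysis.Analysis"
begin

definition lambda_H :: "nat \<Rightarrow> real" where
  "lambda_H N = (real N - 2)\<^sup>2 / 4"

definition p_plus :: "nat \<Rightarrow> real \<Rightarrow> real" where
  "p_plus N lam = (real N - 2) / 2 + sqrt (lambda_H N - lam)"

definition p_minus :: "nat \<Rightarrow> real \<Rightarrow> real" where
  "p_minus N lam = (real N - 2) / 2 - sqrt (lambda_H N - lam)"

definition theta_plus :: "nat \<Rightarrow> real \<Rightarrow> real \<Rightarrow> real" where
  "theta_plus N q lam = p_plus N lam * (q - 1) - 2"

definition theta_minus :: "nat \<Rightarrow> real \<Rightarrow> real \<Rightarrow> real" where
  "theta_minus N q lam = p_minus N lam * (q - 1) - 2"

definition Theta_exp :: "real \<Rightarrow> real \<Rightarrow> real" where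
  "Theta_exp q \<theta> = (\<theta> + 2) / (q - 1)"

definition ell :: "nat \<Rightarrow> real \<Rightarrow> real \<Rightarrow> real \<Rightarrow> real" where
  "ell N q lam \<theta> =
     (Theta_exp q \<theta>)\<^sup>2 - (real N - 2) * Theta_exp q \<theta> + lam"

definition U0 :: "real \<Rightarrow> real \<Rightarrow> real \<Rightarrow> real ^ 'n \<Rightarrow> real" where
  "U0 q lam \<theta> x =
     ell CARD('n) q lam \<theta> powr (1 / (q - 1)) * norm x powr (- Theta_exp q \<theta>)"

text \<open>The radial profile of \<open>\<Phi>\<^sub>\<lambda>\<^sup>+\<close>, as a function of \<open>r = |x|\<close>.  It is meant for \<open>r > 0\<close> if
  \<open>lam < lambda_H N\<close> and for \<open>0 < r < 1\<close> if \<open>lam = lambda_H N\<close>.\<close>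

definition Phi_plus :: "nat \<Rightarrow> real \<Rightarrow> real \<Rightarrow> real" where
  "Phi_plus N lam r =
     (if lam < lambda_H N then r powr (- p_plus N lam)
      else r powr (- ((real N - 2) / 2)) * ln (1 / r))"

definition gradient :: "('a::real_inner \<Rightarrow> real) \<Rightarrow> 'a \<Rightarrow> 'a" where
  "gradient f x = (THE D. GDERIV f x :> D)"

definition C1_on :: "'a::real_inner set \<Rightarrow> ('a \<Rightarrow> real) \<Rightarrow> bool" where
  "C1_on S f \<longleftrightarrow> (\<forall>x\<in>S. \<exists>D. GDERIV f x :> D) \<and> continuous_on S (gradient f)"

text \<open>\<open>C\<^sup>1\<close> functions with compact support inside the open set \<open>S\<close>, extended by zero to the
  whole space.\<close>

definition C1c_on :: "'a::real_inner set \<Rightarrow> ('a \<Rightarrow> real) \<Rightarrow> bool" where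
  "C1c_on S \<phi> \<longleftrightarrow>
     C1_on S \<phi> \<and> compact (closure {x. \<phi> x \<noteq> 0}) \<and> closure {x. \<phi> x \<noteq> 0} \<subseteq> S"

text \<open>Functions on \<open>\<real>\<^sup>N - {0}\<close> are represented by total functions whose value at the origin is
  arbitrary.  In the integrals below the origin plays no role, since the test function vanishes
  near it; there all three integrands are continuous with compact support, hence integrable.\<close>

definition is_solution :: "real \<Rightarrow> real \<Rightarrow> real \<Rightarrow> (real ^ 'n \<Rightarrow> real) \<Rightarrow> bool" where
  "is_solution q lam \<theta> u \<longleftrightarrow>
     (\<forall>x. x \<noteq> 0 \<longrightarrow> u x > 0) \<and> C1_on (- {0}) u \<and>
     (\<forall>\<phi>. C1c_on (- {0}) \<phi> \<longrightarrow>
        (LINT x|lborel. gradient u x \<bullet> gradient \<phi> x)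
        - (LINT x|lborel. lam / (norm x)\<^sup>2 * u x * \<phi> x)
        + (LINT x|lborel. norm x powr \<theta> * u x powr q * \<phi> x) = 0)"

definition agree :: "('a::zero \<Rightarrow> real) \<Rightarrow> ('a \<Rightarrow> real) \<Rightarrow> bool" where
  "agree u v \<longleftrightarrow> (\<forall>x. x \<noteq> 0 \<longrightarrow> u x = v x)"

definition radially_symmetric :: "('a::real_normed_vector \<Rightarrow> real) \<Rightarrow> bool" where
  "radially_symmetric u \<longleftrightarrow>
     (\<forall>x y. x \<noteq> 0 \<longrightarrow> y \<noteq> 0 \<longrightarrow> norm x = norm y \<longrightarrow> u x = u y)"

definition limit_at_zero :: "real \<Rightarrow> (real ^ 'n \<Rightarrow> real) \<Rightarrow> real \<Rightarrow> bool" where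
  "limit_at_zero lam u \<gamma> \<longleftrightarrow>
     ((\<lambda>x. u x / Phi_plus CARD('n) lam (norm x)) \<longlongrightarrow> \<gamma>) (at 0)"

definition limit_at_infinity :: "real \<Rightarrow> (real ^ 'n \<Rightarrow> real) \<Rightarrow> real \<Rightarrow> bool" where
  "limit_at_infinity lam u \<gamma> \<longleftrightarrow>
     ((\<lambda>x. norm x powr (real CARD('n) - 2) * u x / Phi_plus CARD('n) lam (1 / norm x))
        \<longlongrightarrow> \<gamma>) at_infinity"

end

theory Submission
  imports Defs
begin

text \<open>Put \<open>s = \<plusminus> ln |x|\<close> and \<open>w = u/U\<^sub>0\<close>, with the sign for which \<open>U\<^sub>0\<close> is the larger singular solution as
  \<open>s \<rightarrow> -\<infinity>\<close>; both cases then become the same autonomous equation on a cylinder.  Dividing by the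
  Hardy ground state \<open>|x|\<^sup>-\<^sup>(\<^sup>N\<^sup>-\<^sup>2\<^sup>)\<^sup>/\<^sup>2\<close> gives a comparison principle for every \<open>\<lambda> \<le> \<lambda>\<^sub>H\<close>, and comparison with
  blow-up supersolutions on long annuli yields \<open>w \<le> 1\<close>.  The radial equation has an increasing solution
  \<open>W\<close> with \<open>W(-\<infinity>) = 0\<close> and \<open>W(\<infinity>) = 1\<close>, found by monotone iteration between barriers that fix its decay at
  \<open>-\<infinity>\<close>.  Its translates are the solutions \<open>u\<^sub>\<gamma>\<close>.

  An arbitrary solution \<open>w\<close> is one of these.  If \<open>w\<close> is bounded below near \<open>s = -\<infinity>\<close>, comparison with
  translates of \<open>W\<close> forces \<open>w = 1\<close>.  Otherwise Harnack's inequality makes \<open>w\<close> small on whole spheres, and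
  comparison puts \<open>w\<close> below some translate of \<open>W\<close>.  Take the smallest such translate \<open>W\<^sup>*\<close>.  By Harnack's
  inequality for \<open>W\<^sup>* - w\<close>, either \<open>(W\<^sup>* - w)/W\<^sup>*\<close> tends to \<open>0\<close> on a sequence of spheres, and then \<open>w = W\<^sup>*\<close> by
  comparison, or a smaller translate would still do.  In particular no symmetry argument is needed:
  radial symmetry comes with the classification.\<close>

subsection \<open>Gradients and compactly supported functions\<close>

text \<open>Two facts shape the argument. First, comparison runs in one direction only. As
  \<open>|x|^a U = c exp (- \<nu> s)\<close> with \<nu> > 0, and all solutions turn out to lie below
  \<open>U\<close>, every difference of solutions is negligible in the Hardy weight as s tends to
  +infinity. So an inequality on one sphere propagates to all larger s without any condition at that
  end. Nothing of the kind is known at -infinity, and uniqueness has to be imported from spheres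
  that run off to -infinity. Harnack's inequality turns information at one point of such a sphere
  into information on all of it; its constant is the same for all spheres because the potentials are
  of size \<open>1/|x|^2\<close>, which scales correctly. Secondly, the exact decay of
  \<open>W\<close> gives \<open>W (t + h) / W t\<close> the limit
  \<open>exp ((\<nu> - \<mu>) * h)\<close> at -infinity. Constant factors, such as Harnack constants
  or 1 - \<delta>, can therefore be paid for by a translation. Since solutions are only C1 and weak,
  Harnack's inequality, the radial equation and the comparison principle are all derived from the
  weak form itself, with suitably chosen test functions.\<close>

lemma GDERIV_unique:
  assumes "GDERIV f x :> D" "GDERIV f x :> D'"
  shows "D = D'"
proof -
  have "(\<lambda>h. h \<bullet> D) = (\<lambda>h. h \<bullet> D')"
    using assms has_derivative_unique unfolding gderiv_def by blast
  then have "h \<bullet> D = h \<bullet> D'" for h by metis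
  then show ?thesis using vector_eq_ldot by blast
qed

lemma gradient_eq: "GDERIV f x :> D \<Longrightarrow> gradient f x = D"
  unfolding gradient_def by (rule the_equality) (auto intro: GDERIV_unique)

lemma GDERIV_cong_open:
  assumes "GDERIV f x :> D" "open S" "x \<in> S" "\<And>y. y \<in> S \<Longrightarrow> f y = g y"
  shows "GDERIV g x :> D"
  using assms has_derivative_transform_within_open unfolding gderiv_def by blast

lemma GDERIV_continuous: "GDERIV f x :> D \<Longrightarrow> isCont f x"
  unfolding gderiv_def using has_derivative_continuous by blast

lemma C1_onI:
  assumes "\<And>x. x \<in> S \<Longrightarrow> GDERIV f x :> g x" "continuous_on S g"
  shows "C1_on S f"
proof -
  have "continuous_on S (gradient f)"
    using assms continuous_on_cong gradient_eq by metis
  then show ?thesis unfolding C1_on_def using assms(1) by blast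
qed

lemma C1_on_GDERIV: "C1_on S f \<Longrightarrow> x \<in> S \<Longrightarrow> GDERIV f x :> gradient f x"
  unfolding C1_on_def using gradient_eq by metis

lemma C1_on_continuous_gradient: "C1_on S f \<Longrightarrow> continuous_on S (gradient f)"
  unfolding C1_on_def by blast

lemma C1_on_continuous: "C1_on S f \<Longrightarrow> continuous_on S f"
  by (meson C1_on_GDERIV GDERIV_continuous continuous_at_imp_continuous_on)

lemma C1_on_subset: "C1_on S f \<Longrightarrow> T \<subseteq> S \<Longrightarrow> C1_on T f"
  unfolding C1_on_def using continuous_on_subset by blast

lemma C1_on_diff:
  assumes "C1_on S f" "C1_on S g"
  shows "C1_on S (\<lambda>x. f x - g x)"
  by (rule C1_onI[where g = "\<lambda>x. gradient f x - gradient g x"])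
     (auto intro!: GDERIV_diff C1_on_GDERIV continuous_on_diff C1_on_continuous_gradient assms)

lemma C1_on_mult:
  assumes "C1_on S f" "C1_on S g"
  shows "C1_on S (\<lambda>x. f x * g x)"
  by (rule C1_onI[where g = "\<lambda>x. f x *\<^sub>R gradient g x + g x *\<^sub>R gradient f x"])
     (auto intro!: GDERIV_mult C1_on_GDERIV continuous_intros C1_on_continuous_gradient
        C1_on_continuous assms)

lemma gradient_diff:
  assumes "C1_on S f" "C1_on S g" "x \<in> S"
  shows "gradient (\<lambda>x. f x - g x) x = gradient f x - gradient g x"
  by (rule gradient_eq) (auto intro!: GDERIV_diff C1_on_GDERIV[of S] assms)

lemma C1_on_cong:
  assumes "C1_on S f" "open S" "\<And>x. x \<in> S \<Longrightarrow> f x = g x"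
  shows "C1_on S g"
  by (rule C1_onI[where g = "gradient f"])
     (auto intro!: GDERIV_cong_open[OF C1_on_GDERIV[OF assms(1)] assms(2)]
        C1_on_continuous_gradient assms)

lemma gradient_cong:
  assumes "C1_on S f" "open S" "\<And>x. x \<in> S \<Longrightarrow> f x = g x" "x \<in> S"
  shows "gradient g x = gradient f x"
  by (rule gradient_eq) (auto intro!: GDERIV_cong_open[OF C1_on_GDERIV[OF assms(1)] assms(2)] assms)

lemma gradient_zero_off:
  assumes "closed K" "\<And>x. x \<notin> K \<Longrightarrow> f x = 0" "x \<notin> K"
  shows "GDERIV f x :> 0" "gradient f x = 0"
proof -
  show "GDERIV f x :> 0"
    by (rule GDERIV_cong_open[OF GDERIV_const[of 0 x], of "- K"]) (use assms in auto)
  then show "gradient f x = 0" by (rule gradient_eq)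
qed

lemma C1c_onI:
  assumes "C1_on S f" "compact K" "K \<subseteq> S" "\<And>x. x \<notin> K \<Longrightarrow> f x = 0"
  shows "C1c_on S f"
proof -
  have "closure {x. f x \<noteq> 0} \<subseteq> K"
    using assms by (intro closure_minimal) (auto intro: compact_imp_closed)
  moreover from this have "compact (closure {x. f x \<noteq> 0})"
    using assms compact_Int_closed[of K "closure {x. f x \<noteq> 0}"] by (simp add: inf.absorb2)
  ultimately show ?thesis
    unfolding C1c_on_def using assms by blast
qed

lemma C1c_onE:
  assumes "C1c_on S f"
  obtains K where "C1_on S f" "compact K" "K \<subseteq> S" "\<And>x. x \<notin> K \<Longrightarrow> f x = 0"
  using assms closure_subset[of "{x. f x \<noteq> 0}"] unfolding C1c_on_def by blast


section \<open>Compact supports, dilations and Euler's identity\<close>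

lemma continuous_on_zero_extension:
  fixes f :: "'a::t2_space \<Rightarrow> 'b::real_normed_vector"
  assumes "open S" "continuous_on S f" "closed K" "K \<subseteq> S" "\<And>x. x \<notin> K \<Longrightarrow> f x = 0"
  shows "continuous_on UNIV f"
proof -
  have "continuous_on (- K) f"
    using assms(5) by (subst continuous_on_cong[where g = "\<lambda>x. 0"]) auto
  then have "continuous_on (S \<union> (- K)) f"
    using assms by (intro continuous_on_open_Un) auto
  moreover have "S \<union> (- K) = UNIV" using assms by auto
  ultimately show ?thesis by simp
qed

lemma integrable_compact_support:
  fixes f :: "'a::euclidean_space \<Rightarrow> 'b::{banach, second_countable_topology}"
  assumes "continuous_on K f" "compact K" "\<And>x. x \<notin> K \<Longrightarrow> f x = 0"
  shows "integrable lborel f"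
proof -
  have "f = (\<lambda>x. indicator K x *\<^sub>R f x)"
    using assms by (auto simp: fun_eq_iff indicator_def)
  then show ?thesis
    using borel_integrable_compact[OF assms(2,1)] by simp
qed

lemma integral_cbox_eq_lborel:
  fixes f :: "'a::euclidean_space \<Rightarrow> real"
  assumes "continuous_on (cbox a b) f" "\<And>x. x \<notin> cbox a b \<Longrightarrow> f x = 0"
  shows "integral (cbox a b) f = (LINT x|lborel. f x)"
proof -
  have "integrable lborel f"
    by (rule integrable_compact_support[OF assms(1)]) (use assms in auto)
  then have "(LINT x|lborel. f x) = integral UNIV f"
    by (rule integral_lborel[symmetric])
  also have "\<dots> = integral UNIV (\<lambda>x. if x \<in> cbox a b then f x else 0)"
    using assms(2) by (intro integral_cong) auto
  also have "\<dots> = integral (cbox a b) f" by (rule integral_restrict_UNIV)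
  finally show ?thesis ..
qed

lemma lborel_integral_affine:
  fixes f :: "'a::euclidean_space \<Rightarrow> real" and c :: real
  assumes "c > 0" "f \<in> borel_measurable borel"
  shows "(LINT x|lborel. f x) = c ^ DIM('a) * (LINT x|lborel. f (t + c *\<^sub>R x))"
proof -
  have "(LINT x|lborel. f x) = (LINT x|density (distr lborel borel (\<lambda>x. t + c *\<^sub>R x)) (\<lambda>_. \<bar>c\<bar>^DIM('a)). f x)"
    using lborel_affine[of c t] assms by simp
  also have "\<dots> = (LINT x|distr lborel borel (\<lambda>x. t + c *\<^sub>R x). c ^ DIM('a) *\<^sub>R f x)"
    using assms by (subst integral_density) (auto simp: ennreal_power)
  also have "\<dots> = (LINT x|lborel. c ^ DIM('a) *\<^sub>R f (t + c *\<^sub>R x))"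
    using assms by (subst integral_distr) auto
  finally show ?thesis by simp
qed

text \<open>Leibniz rule in the dilation parameter. It serves both Euler's identity and the bump
  means; the derivative is taken within \<open>U\<close> so that the endpoint 0 of
  \<open>{0..R}\<close> is covered.\<close>

lemma dilation_has_derivative:
  fixes v :: "'a::euclidean_space \<Rightarrow> real" and U :: "real set"
  assumes \<eta>: "continuous_on (cbox A B) \<eta>"
    and v: "\<And>x. x \<in> S \<Longrightarrow> GDERIV v x :> g x" and g: "continuous_on S g"
    and S: "\<And>\<rho> y. \<rho> \<in> U \<Longrightarrow> y \<in> cbox A B \<Longrightarrow> x0 + \<rho> *\<^sub>R y \<in> S"
    and U: "convex U" "r \<in> U"
  shows "((\<lambda>\<rho>. integral (cbox A B) (\<lambda>y. \<eta> y * v (x0 + \<rho> *\<^sub>R y))) has_real_derivative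
           integral (cbox A B) (\<lambda>y. \<eta> y * (y \<bullet> g (x0 + r *\<^sub>R y)))) (at r within U)"
proof (rule leibniz_rule_field_derivative[OF _ _ _ U(2,1)])
  have cv: "continuous_on S v"
    using v GDERIV_continuous continuous_at_imp_continuous_on by metis
  fix \<rho> assume \<rho>: "\<rho> \<in> U"
  show "(\<lambda>y. \<eta> y * v (x0 + \<rho> *\<^sub>R y)) integrable_on cbox A B"
    by (intro integrable_continuous continuous_intros \<eta> continuous_on_compose2[OF cv])
       (use S \<rho> in auto)
  fix y assume y: "y \<in> cbox A B"
  have "(v has_derivative (\<lambda>h. h \<bullet> g (x0 + \<rho> *\<^sub>R y))) (at (x0 + \<rho> *\<^sub>R y))"
    using v[OF S[OF \<rho> y]] unfolding gderiv_def .
  then have "((\<lambda>\<rho>. v (x0 + \<rho> *\<^sub>R y)) has_derivative (\<lambda>h. (h *\<^sub>R y) \<bullet> g (x0 + \<rho> *\<^sub>R y))) (at \<rho> within U)"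
    by (rule has_derivative_compose[rotated]) (auto intro!: derivative_eq_intros)
  then have "((\<lambda>\<rho>. v (x0 + \<rho> *\<^sub>R y)) has_real_derivative y \<bullet> g (x0 + \<rho> *\<^sub>R y)) (at \<rho> within U)"
    by (simp add: has_field_derivative_def mult_commute_abs)
  then show "((\<lambda>\<rho>. \<eta> y * v (x0 + \<rho> *\<^sub>R y)) has_real_derivative \<eta> y * (y \<bullet> g (x0 + \<rho> *\<^sub>R y))) (at \<rho> within U)"
    by (rule DERIV_cmult)
next
  have "continuous_on (U \<times> cbox A B) (\<lambda>p. \<eta> (snd p) * (snd p \<bullet> g (x0 + fst p *\<^sub>R snd p)))"
    by (intro continuous_intros continuous_on_compose2[OF \<eta>] continuous_on_compose2[OF g])
       (use S in auto)
  then show "continuous_on (U \<times> cbox A B) (\<lambda>(\<rho>, y). \<eta> y * (y \<bullet> g (x0 + \<rho> *\<^sub>R y)))"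
    by (simp add: split_beta)
qed

text \<open>Differentiate the integral of f(\<rho> y) at \<rho> = 1 in two ways: under the integral
  sign, and after the substitution that turns it into \<rho>^(-n) times the integral of f. This
  takes the place of the divergence theorem.\<close>

lemma euler_identity:
  fixes f :: "'a::euclidean_space \<Rightarrow> real"
  assumes f: "\<And>x. GDERIV f x :> g x" and g: "continuous_on UNIV g"
    and K: "compact K" "\<And>x. x \<notin> K \<Longrightarrow> f x = 0"
  shows "(LINT x|lborel. x \<bullet> g x) = - real DIM('a) * (LINT x|lborel. f x)"
proof -
  have cf: "continuous_on UNIV f"
    using f GDERIV_continuous continuous_at_imp_continuous_on by metis
  have "bounded ((*\<^sub>R) 2 ` K)" using K(1) compact_imp_bounded bounded_scaling by blast
  then obtain a :: 'a where a: "(*\<^sub>R) 2 ` K \<subseteq> cbox (- a) a"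
    using bounded_subset_cbox_symmetric by blast
  \<comment> \<open>One box has to contain the supports of all dilates with \<rho> near 1; it is
    built around \<open>2 K\<close>, which covers \<rho> >= 1/2.\<close>
  have box: "y \<in> cbox (- a) a" if "\<rho> \<ge> 1/2" "\<rho> *\<^sub>R y \<in> K" for \<rho> :: real and y
  proof -
    have "2 *\<^sub>R (\<rho> *\<^sub>R y) \<in> cbox (- a) a" using a that by blast
    then have *: "\<bar>2 * \<rho> * (y \<bullet> i)\<bar> \<le> a \<bullet> i" if "i \<in> Basis" for i
      using that by (auto simp: mem_box abs_le_iff)
    have "\<bar>y \<bullet> i\<bar> \<le> a \<bullet> i" if "i \<in> Basis" for i
    proof -
      have "1 * \<bar>y \<bullet> i\<bar> \<le> (2 * \<rho>) * \<bar>y \<bullet> i\<bar>"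
        using \<open>\<rho> \<ge> 1/2\<close> by (intro mult_right_mono) auto
      then show ?thesis using *[OF that] \<open>\<rho> \<ge> 1/2\<close> by (simp add: abs_mult)
    qed
    then show ?thesis by (fastforce simp: mem_box abs_le_iff)
  qed
  define m where "m = (\<lambda>\<rho>. integral (cbox (- a) a) (\<lambda>y. 1 * f (0 + \<rho> *\<^sub>R y)))"
  let ?I = "LINT x|lborel. f x"
  have m: "m \<rho> = ?I / \<rho> ^ DIM('a)" if "\<rho> \<in> {1/2<..}" for \<rho>
  proof -
    have "m \<rho> = (LINT y|lborel. f (0 + \<rho> *\<^sub>R y))"
    proof -
      have "f (0 + \<rho> *\<^sub>R y) = 0" if "y \<notin> cbox (- a) a" for y
        using K(2) box[of \<rho> y] that \<open>\<rho> \<in> _\<close> by auto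
      then show ?thesis
        unfolding m_def
        by (subst integral_cbox_eq_lborel)
           (auto intro!: continuous_intros continuous_on_compose2[OF cf])
    qed
    moreover have "f \<in> borel_measurable borel"
      using cf by (rule borel_measurable_continuous_onI)
    ultimately show ?thesis
      using lborel_integral_affine[of \<rho> f 0] that by auto
  qed
  have "(m has_real_derivative integral (cbox (- a) a) (\<lambda>y. 1 * (y \<bullet> g (0 + 1 *\<^sub>R y)))) (at 1 within {1/2<..})"
    unfolding m_def
    by (rule dilation_has_derivative[where S = UNIV]) (auto intro: f g)
  then have "(m has_real_derivative integral (cbox (- a) a) (\<lambda>y. y \<bullet> g y)) (at 1)"
    by (subst (asm) at_within_open) auto
  moreover have "((\<lambda>\<rho>. ?I / \<rho> ^ DIM('a)) has_real_derivative - real DIM('a) * ?I) (at 1)"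
    by (auto intro!: derivative_eq_intros)
  then have "(m has_real_derivative - real DIM('a) * ?I) (at 1)"
    by (rule has_field_derivative_transform_within_open[where S = "{1/2<..}"]) (auto simp: m)
  ultimately have "integral (cbox (- a) a) (\<lambda>y. y \<bullet> g y) = - real DIM('a) * ?I"
    by (rule DERIV_unique)
  moreover have "g x = 0" if "x \<notin> cbox (- a) a" for x
  proof -
    have "x \<notin> K" using box[of 1 x] that by auto
    then have "GDERIV f x :> 0"
      using gradient_zero_off(1)[of K f x] K compact_imp_closed by blast
    then show ?thesis using f GDERIV_unique by blast
  qed
  then have "integral (cbox (- a) a) (\<lambda>y. y \<bullet> g y) = (LINT y|lborel. y \<bullet> g y)"
    by (intro integral_cbox_eq_lborel) (auto intro!: continuous_intros continuous_on_subset[OF g])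
  ultimately show ?thesis by simp
qed

subsection \<open>Weak solutions of the Poisson equation and a Harnack inequality\<close>

text \<open>Weak form of -\<Delta> u = \<beta>. Keeping \<beta> as a free continuous function, not
  as an expression in u, makes the notion stable under differences of solutions.\<close>

definition weak_poisson :: "'a::euclidean_space set \<Rightarrow> ('a \<Rightarrow> real) \<Rightarrow> ('a \<Rightarrow> real) \<Rightarrow> bool" where
  "weak_poisson S u \<beta> \<longleftrightarrow> C1_on S u \<and> continuous_on S \<beta> \<and>
     (\<forall>\<phi>. C1c_on S \<phi> \<longrightarrow>
       (LINT x|lborel. gradient u x \<bullet> gradient \<phi> x) = (LINT x|lborel. \<beta> x * \<phi> x))"

lemma weak_poissonD:
  assumes "weak_poisson S u \<beta>"
  shows "C1_on S u" "continuous_on S \<beta>"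
    "C1c_on S \<phi> \<Longrightarrow> (LINT x|lborel. gradient u x \<bullet> gradient \<phi> x) = (LINT x|lborel. \<beta> x * \<phi> x)"
  using assms unfolding weak_poisson_def by auto

text \<open>Off its compact support a test function has gradient 0, so its gradient is continuous on
  the whole space.\<close>

lemma C1c_on_mono:
  assumes "C1c_on S \<phi>" "open S" "S \<subseteq> T"
  shows "C1c_on T \<phi>"
proof -
  obtain K where K: "C1_on S \<phi>" "compact K" "K \<subseteq> S" "\<And>x. x \<notin> K \<Longrightarrow> \<phi> x = 0"
    by (rule C1c_onE[OF assms(1)]) blast
  have cl: "closed K" using K compact_imp_closed by blast
  have grad0: "gradient \<phi> x = 0" if "x \<notin> K" for x
    by (rule gradient_zero_off(2)[OF cl _ that]) (rule K(4))
  have G: "GDERIV \<phi> x :> gradient \<phi> x" for x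
    using C1_on_GDERIV[OF K(1)] gradient_zero_off[OF cl K(4)] K(3) by (cases "x \<in> K") auto
  have "continuous_on UNIV (gradient \<phi>)"
    by (rule continuous_on_zero_extension[OF assms(2) C1_on_continuous_gradient[OF K(1)] cl K(3)])
       (rule grad0)
  then have "C1_on T \<phi>"
    using G by (intro C1_onI[where g = "gradient \<phi>"]) (auto intro: continuous_on_subset)
  then show ?thesis using K assms by (intro C1c_onI[of _ _ K]) auto
qed

lemma weak_poisson_subset:
  assumes "weak_poisson S u \<beta>" "open T" "T \<subseteq> S"
  shows "weak_poisson T u \<beta>"
  using assms C1c_on_mono[of T _ S] C1_on_subset continuous_on_subset
  unfolding weak_poisson_def by metis

lemma weak_poisson_integrable:
  assumes "C1_on S u" "continuous_on S \<beta>" "C1c_on S \<phi>" "open S"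
  shows "integrable lborel (\<lambda>x. gradient u x \<bullet> gradient \<phi> x)"
    "integrable lborel (\<lambda>x. \<beta> x * \<phi> x)"
proof -
  obtain K where K: "C1_on S \<phi>" "compact K" "K \<subseteq> S" "\<And>x. x \<notin> K \<Longrightarrow> \<phi> x = 0"
    by (rule C1c_onE[OF assms(3)]) blast
  have cl: "closed K" using K compact_imp_closed by blast
  have grad0: "gradient \<phi> x = 0" if "x \<notin> K" for x
    by (rule gradient_zero_off(2)[OF cl _ that]) (rule K(4))
  show "integrable lborel (\<lambda>x. gradient u x \<bullet> gradient \<phi> x)"
    by (rule integrable_compact_support[OF _ K(2)])
       (use grad0 in \<open>auto intro!: continuous_intros
          continuous_on_subset[OF C1_on_continuous_gradient K(3)] assms K\<close>)
  show "integrable lborel (\<lambda>x. \<beta> x * \<phi> x)"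
    by (rule integrable_compact_support[OF _ K(2)])
       (use K in \<open>auto intro!: continuous_intros
          continuous_on_subset[OF assms(2) K(3)] continuous_on_subset[OF C1_on_continuous[OF K(1)] K(3)]\<close>)
qed

lemma weak_poisson_diff:
  assumes "weak_poisson S u \<beta>" "weak_poisson S v \<beta>'" "open S"
  shows "weak_poisson S (\<lambda>x. u x - v x) (\<lambda>x. \<beta> x - \<beta>' x)"
  unfolding weak_poisson_def
proof (intro conjI allI impI)
  note u = weak_poissonD[OF assms(1)] and v = weak_poissonD[OF assms(2)]
  show "C1_on S (\<lambda>x. u x - v x)" by (intro C1_on_diff u v)
  show "continuous_on S (\<lambda>x. \<beta> x - \<beta>' x)" by (intro continuous_intros u v)
  fix \<phi> :: "'a \<Rightarrow> real" assume \<phi>: "C1c_on S \<phi>"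
  obtain K where K: "C1_on S \<phi>" "compact K" "K \<subseteq> S" "\<And>x. x \<notin> K \<Longrightarrow> \<phi> x = 0"
    by (rule C1c_onE[OF \<phi>]) blast
  have cl: "closed K" using K compact_imp_closed by blast
  have grad0: "gradient \<phi> x = 0" if "x \<notin> K" for x
    by (rule gradient_zero_off(2)[OF cl _ that]) (rule K(4))
  have "gradient (\<lambda>x. u x - v x) x \<bullet> gradient \<phi> x
      = gradient u x \<bullet> gradient \<phi> x - gradient v x \<bullet> gradient \<phi> x" for x
    using grad0[of x] gradient_diff[OF u(1) v(1), where x = x] K(3)
    by (cases "x \<in> K") (auto simp: inner_diff_left)
  then have "(LINT x|lborel. gradient (\<lambda>x. u x - v x) x \<bullet> gradient \<phi> x)
      = (LINT x|lborel. gradient u x \<bullet> gradient \<phi> x) - (LINT x|lborel. gradient v x \<bullet> gradient \<phi> x)"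
    using weak_poisson_integrable(1)[OF u(1,2) \<phi> assms(3)]
      weak_poisson_integrable(1)[OF v(1,2) \<phi> assms(3)] by simp
  also have "\<dots> = (LINT x|lborel. \<beta> x * \<phi> x) - (LINT x|lborel. \<beta>' x * \<phi> x)"
    using u(3)[OF \<phi>] v(3)[OF \<phi>] by simp
  also have "\<dots> = (LINT x|lborel. (\<beta> x - \<beta>' x) * \<phi> x)"
    using weak_poisson_integrable(2)[OF u(1,2) \<phi> assms(3)]
      weak_poisson_integrable(2)[OF v(1,2) \<phi> assms(3)] by (simp add: left_diff_distrib)
  finally show "(LINT x|lborel. gradient (\<lambda>x. u x - v x) x \<bullet> gradient \<phi> x)
      = (LINT x|lborel. (\<beta> x - \<beta>' x) * \<phi> x)" .
qed

text \<open>Squaring removes the corner of the positive part. Truncations thus remain C1 and are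
  admissible test functions.\<close>

lemma DERIV_pos_part_square: "((\<lambda>s::real. (max 0 s)\<^sup>2) has_real_derivative 2 * max 0 s) (at s)"
proof (cases "s = 0")
  case True
  have "((\<lambda>h::real. ((max 0 h)\<^sup>2 - (max 0 0)\<^sup>2) / (h - 0)) \<longlongrightarrow> 0) (at 0)"
  proof (rule Lim_null_comparison)
    show "\<forall>\<^sub>F h in at 0. norm (((max 0 h)\<^sup>2 - (max 0 0)\<^sup>2) / (h - 0)) \<le> \<bar>h\<bar>" for h :: real
      by (rule always_eventually) (auto simp: max_def power2_eq_square abs_mult)
    show "((\<lambda>h::real. \<bar>h\<bar>) \<longlongrightarrow> 0) (at 0)"
      by (rule tendsto_eq_intros refl)+ simp
  qed
  then show ?thesis using True by (simp add: has_field_derivative_iff)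
next
  case False
  consider "s > 0" | "s < 0" using False by linarith
  then show ?thesis
  proof cases
    case 1
    have "((\<lambda>s::real. s\<^sup>2) has_real_derivative 2 * s) (at s)"
      by (auto intro!: derivative_eq_intros)
    then have "((\<lambda>s::real. (max 0 s)\<^sup>2) has_real_derivative 2 * s) (at s)"
      by (rule has_field_derivative_transform_within_open[where S = "{0<..}"]) (use 1 in auto)
    then show ?thesis using 1 by simp
  next
    case 2
    have "((\<lambda>s::real. 0) has_real_derivative 0) (at s)" by simp
    then have "((\<lambda>s::real. (max 0 s)\<^sup>2) has_real_derivative 0) (at s)"
      by (rule has_field_derivative_transform_within_open[where S = "{..<0}"]) (use 2 in auto)
    then show ?thesis using 2 by simp
  qed
qed

section \<open>Mean values weighted by a paraboloid\<close>

definition bump :: "'a::real_inner \<Rightarrow> real" where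
  "bump y = max 0 (1 - y \<bullet> y)"

lemma bump_bounds: "0 \<le> bump y" "bump y \<le> 1"
  unfolding bump_def by (auto simp: max_def)

lemma continuous_on_bump: "continuous_on S bump"
  unfolding bump_def by (intro continuous_intros)

lemma bump_eq_0: "norm y \<ge> 1 \<Longrightarrow> bump y = 0"
  by (simp add: bump_def dot_square_norm power2_eq_square mult_ge1_I)

lemma bump_rescaled_eq_0: "\<rho> > 0 \<Longrightarrow> dist x z \<ge> \<rho> \<Longrightarrow> bump ((z - x) /\<^sub>R \<rho>) = 0"
proof (rule bump_eq_0)
  assume "\<rho> > 0" "dist x z \<ge> \<rho>"
  moreover from this have "norm ((z - x) /\<^sub>R \<rho>) = dist x z / \<rho>"
    by (simp add: dist_norm norm_minus_commute divide_inverse mult.commute)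
  ultimately show "norm ((z - x) /\<^sub>R \<rho>) \<ge> 1" by simp
qed

lemma bump_gradient: "GDERIV (\<lambda>y. (bump y)\<^sup>2 / 4) y :> - bump y *\<^sub>R y"
proof -
  have "GDERIV (\<lambda>y. 1 - y \<bullet> y) y :> 0 - 2 *\<^sub>R y"
    unfolding gderiv_def by (auto intro!: derivative_eq_intros simp: fun_eq_iff inner_commute)
  then have "GDERIV (\<lambda>y. (max 0 (1 - y \<bullet> y))\<^sup>2) y :> (2 * bump y) *\<^sub>R (0 - 2 *\<^sub>R y)"
    unfolding bump_def by (rule GDERIV_DERIV_compose[OF _ DERIV_pos_part_square])
  then have "GDERIV (\<lambda>y. (max 0 (1 - y \<bullet> y))\<^sup>2 * (1/4)) y
      :> (max 0 (1 - y \<bullet> y))\<^sup>2 *\<^sub>R 0 + (1/4) *\<^sub>R ((2 * bump y) *\<^sub>R (0 - 2 *\<^sub>R y))"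
    by (intro GDERIV_mult GDERIV_const)
  then show ?thesis by (auto simp: bump_def elim!: GDERIV_subst)
qed

text \<open>Integrated over a fixed box so that the Leibniz rule applies; \<open>bump\<close>
  vanishes off the unit ball and hence off the box. The price is that points of the box have norm up
  to \<open>DIM('a)\<close>, whence the radii \<open>R * DIM('a)\<close> below.\<close>

definition bump_mean :: "('a::euclidean_space \<Rightarrow> real) \<Rightarrow> 'a \<Rightarrow> real \<Rightarrow> real" where
  "bump_mean v x \<rho> = integral (cbox (- One) One) (\<lambda>y. bump y * v (x + \<rho> *\<^sub>R y))"

lemma norm_le_DIM:
  assumes "y \<in> cbox (- One) (One :: 'a::euclidean_space)"
  shows "norm y \<le> DIM('a)"
proof -
  have "norm y \<le> (\<Sum>i\<in>Basis. \<bar>y \<bullet> i\<bar>)" by (rule norm_le_l1)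
  also have "\<dots> \<le> (\<Sum>i\<in>(Basis::'a set). 1)"
    using assms by (intro sum_mono) (auto simp: mem_box abs_le_iff)
  finally show ?thesis by simp
qed

lemma bump_eq_0_off_box:
  assumes "y \<notin> cbox (- One) (One :: 'a::euclidean_space)"
  shows "bump y = 0"
proof (rule bump_eq_0)
  obtain i where "i \<in> Basis" "\<bar>y \<bullet> i\<bar> > 1"
    using assms by (force simp: mem_box)
  then show "norm y \<ge> 1" using Basis_le_norm[of i y] by linarith
qed

context
  fixes S :: "'a::euclidean_space set" and v \<beta> :: "'a \<Rightarrow> real" and C :: real
  assumes S: "open S" and w: "weak_poisson S v \<beta>" and C: "C \<ge> 0"
    and v: "\<And>x. x \<in> S \<Longrightarrow> 0 \<le> v x" and \<beta>: "\<And>x. x \<in> S \<Longrightarrow> \<bar>\<beta> x\<bar> \<le> C * v x"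
begin

text \<open>The form over the whole space is the one in which means about different centres and of
  different radii can be compared pointwise.\<close>

lemma bump_mean_lborel:
  assumes \<rho>: "\<rho> > 0" and ball: "cball x (\<rho> * real DIM('a)) \<subseteq> S"
  shows "integrable lborel (\<lambda>z. bump ((z - x) /\<^sub>R \<rho>) * v z)"
    "(LINT z|lborel. bump ((z - x) /\<^sub>R \<rho>) * v z) = \<rho> ^ DIM('a) * bump_mean v x \<rho>"
proof -
  let ?f = "\<lambda>z. bump ((z - x) /\<^sub>R \<rho>) * v z"
  have off: "?f z = 0" if "z \<notin> cball x \<rho>" for z
    using that \<rho> by (subst bump_rescaled_eq_0) auto
  have sub: "cball x \<rho> \<subseteq> S"
    by (rule subset_trans[OF subset_cball ball]) (use \<rho> in \<open>simp add: mult_le_cancel_left1 Suc_leI\<close>)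
  have cv: "continuous_on S v" using C1_on_continuous weak_poissonD(1)[OF w] by blast
  have cf: "continuous_on S ?f"
    by (intro continuous_intros cv continuous_on_compose2[OF continuous_on_bump[of UNIV]]) auto
  show "integrable lborel ?f"
    by (rule integrable_compact_support[where K = "cball x \<rho>"])
       (use off sub in \<open>auto intro: continuous_on_subset[OF cf]\<close>)
  have "continuous_on UNIV ?f"
    by (rule continuous_on_zero_extension[OF S cf _ sub]) (use off in auto)
  then have "?f \<in> borel_measurable borel" by (rule borel_measurable_continuous_onI)
  then have "(LINT z|lborel. ?f z) = \<rho> ^ DIM('a) * (LINT y|lborel. ?f (x + \<rho> *\<^sub>R y))"
    by (rule lborel_integral_affine[OF \<rho>])
  also have "(\<lambda>y. ?f (x + \<rho> *\<^sub>R y)) = (\<lambda>y. bump y * v (x + \<rho> *\<^sub>R y))"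
    using \<rho> by auto
  also have "(LINT y|lborel. bump y * v (x + \<rho> *\<^sub>R y)) = bump_mean v x \<rho>"
    unfolding bump_mean_def
  proof (rule integral_cbox_eq_lborel[symmetric])
    have "x + \<rho> *\<^sub>R y \<in> S" if "y \<in> cbox (- One) One" for y
      using norm_le_DIM[OF that] \<rho> ball by (force simp: dist_norm)
    then show "continuous_on (cbox (- One) One) (\<lambda>y. bump y * v (x + \<rho> *\<^sub>R y))"
      by (intro continuous_intros continuous_on_bump continuous_on_compose2[OF cv]) auto
  qed (use bump_eq_0_off_box in auto)
  finally show "(LINT z|lborel. ?f z) = \<rho> ^ DIM('a) * bump_mean v x \<rho>" .
qed

text \<open>Since \<open>bump y y = - \<nabla>(bump\<^sup>2/4)\<close>, the radial derivative of the mean is the left-hand side of the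
  weak equation, tested with a rescaled \<open>bump\<^sup>2/4\<close>; no Green function is needed.\<close>

lemma bump_mean_derivative:
  assumes R: "R > 0" and ball: "cball x (R * real DIM('a)) \<subseteq> S"
  shows "\<And>\<rho>. \<rho> \<in> {0..R} \<Longrightarrow> \<exists>D. (bump_mean v x has_real_derivative D) (at \<rho> within {0..R})
      \<and> (\<rho> > 0 \<longrightarrow> \<bar>D\<bar> \<le> C / 4 * \<rho> * bump_mean v x \<rho>)"
proof -
  fix \<rho> assume \<rho>: "\<rho> \<in> {0..R}"
  let ?B = "cbox (- One) (One::'a)"
  have inS: "x + \<rho> *\<^sub>R y \<in> S" if "y \<in> ?B" "\<rho> \<in> {0..R}" for y \<rho>
  proof -
    have "\<rho> * norm y \<le> R * real DIM('a)" using norm_le_DIM[OF that(1)] that(2) R by (intro mult_mono) auto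
    then show ?thesis using that(2) ball by (force simp: dist_norm)
  qed
  define D where "D = integral ?B (\<lambda>y. bump y * (y \<bullet> gradient v (x + \<rho> *\<^sub>R y)))"
  have deriv: "(bump_mean v x has_real_derivative D) (at \<rho> within {0..R})"
    unfolding D_def bump_mean_def[abs_def]
    by (rule dilation_has_derivative[where S = S])
       (use inS \<rho> w in \<open>auto intro: continuous_on_bump C1_on_GDERIV C1_on_continuous_gradient
          weak_poissonD(1)\<close>)
  have cv: "continuous_on S v" using C1_on_continuous weak_poissonD(1)[OF w] by blast
  have cg: "continuous_on S (gradient v)"
    using C1_on_continuous_gradient weak_poissonD(1)[OF w] by blast
  \<comment> \<open>Restricted to positive \<rho> because the test function is rescaled by
    1/\<rho>.\<close>
  have "\<bar>D\<bar> \<le> C / 4 * \<rho> * bump_mean v x \<rho>" if pos: "\<rho> > 0"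
  proof -
    define \<phi> where "\<phi> = (\<lambda>z. (bump ((z - x) /\<^sub>R \<rho>))\<^sup>2 / 4)"
    define g where "g = (\<lambda>z. - (bump ((z - x) /\<^sub>R \<rho>) / \<rho>\<^sup>2) *\<^sub>R (z - x))"
    have G: "GDERIV \<phi> z :> g z" for z
    proof -
      have 1: "((\<lambda>z. (z - x) /\<^sub>R \<rho>) has_derivative (\<lambda>h. h /\<^sub>R \<rho>)) (at z)"
        by (auto intro!: derivative_eq_intros)
      have 2: "((\<lambda>y. (bump y)\<^sup>2 / 4) has_derivative
         (\<lambda>h. h \<bullet> (- bump ((z - x) /\<^sub>R \<rho>) *\<^sub>R ((z - x) /\<^sub>R \<rho>)))) (at ((z - x) /\<^sub>R \<rho>))"
        using bump_gradient unfolding gderiv_def .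
      show ?thesis
        using has_derivative_compose[OF 1 2] unfolding gderiv_def \<phi>_def g_def
        by (rule has_derivative_eq_rhs) (use pos in \<open>auto simp: fun_eq_iff power2_eq_square divide_inverse mult_ac\<close>)
    qed
    have cG: "continuous_on UNIV g"
      unfolding g_def by (intro continuous_intros continuous_on_compose2[OF continuous_on_bump[of UNIV]])
        (use pos in auto)
    have off: "z \<notin> cball x \<rho> \<Longrightarrow> bump ((z - x) /\<^sub>R \<rho>) = 0" for z
      using pos by (intro bump_rescaled_eq_0) auto
    have sub: "cball x \<rho> \<subseteq> S"
    proof
      fix z assume "z \<in> cball x \<rho>"
      then have "dist x z \<le> \<rho> * 1" by simp
      also have "\<dots> \<le> R * real DIM('a)" using \<rho> R DIM_positive[where 'a='a]
        by (intro mult_mono) (auto simp: Suc_leI)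
      finally show "z \<in> S" using ball by auto
    qed
    have "C1_on S \<phi>" by (rule C1_onI[OF G continuous_on_subset[OF cG]]) auto
    then have \<phi>: "C1c_on S \<phi>"
      by (rule C1c_onI[OF _ _ sub]) (auto simp: \<phi>_def off)
    have gr: "gradient \<phi> = g" using gradient_eq[OF G] by auto
    let ?f1 = "\<lambda>z. gradient v z \<bullet> g z" and ?f2 = "\<lambda>z. \<beta> z * \<phi> z"
    have "continuous_on UNIV ?f1"
    proof (rule continuous_on_zero_extension[OF S _ _ sub])
      show "continuous_on S ?f1" by (intro continuous_intros cg continuous_on_subset[OF cG]) auto
      show "?f1 z = 0" if "z \<notin> cball x \<rho>" for z using off[OF that] by (simp add: g_def)
    qed simp
    then have m1: "?f1 \<in> borel_measurable borel" by (rule borel_measurable_continuous_onI)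
    have "continuous_on UNIV ?f2"
    proof (rule continuous_on_zero_extension[OF S _ _ sub])
      show "continuous_on S ?f2"
        by (intro continuous_intros weak_poissonD(2)[OF w] C1_on_continuous \<open>C1_on S \<phi>\<close>)
      show "?f2 z = 0" if "z \<notin> cball x \<rho>" for z using off[OF that] by (simp add: \<phi>_def)
    qed simp
    then have m2: "?f2 \<in> borel_measurable borel" by (rule borel_measurable_continuous_onI)
    have eq: "(LINT z|lborel. ?f1 z) = (LINT z|lborel. ?f2 z)"
      using weak_poissonD(3)[OF w \<phi>] unfolding gr .
    have "(LINT z|lborel. ?f1 z) = \<rho> ^ DIM('a) * (LINT y|lborel. ?f1 (x + \<rho> *\<^sub>R y))"
      by (rule lborel_integral_affine[OF pos m1])
    also have "(\<lambda>y. ?f1 (x + \<rho> *\<^sub>R y)) = (\<lambda>y. - (1 / \<rho>) * (bump y * (y \<bullet> gradient v (x + \<rho> *\<^sub>R y))))"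
      using pos by (auto simp: g_def fun_eq_iff power2_eq_square inner_commute)
    also have "(LINT y|lborel. \<dots> y) = - (1 / \<rho>) * D"
      unfolding D_def
      by (subst integral_cbox_eq_lborel)
         (use inS \<rho> bump_eq_0_off_box in \<open>auto intro!: continuous_intros continuous_on_bump continuous_on_compose2[OF cg]\<close>)
    finally have e1: "(LINT z|lborel. ?f1 z) = \<rho> ^ DIM('a) * (- (1 / \<rho>) * D)" .
    have "(LINT z|lborel. ?f2 z) = \<rho> ^ DIM('a) * (LINT y|lborel. ?f2 (x + \<rho> *\<^sub>R y))"
      by (rule lborel_integral_affine[OF pos m2])
    also have "(\<lambda>y. ?f2 (x + \<rho> *\<^sub>R y)) = (\<lambda>y. \<beta> (x + \<rho> *\<^sub>R y) * ((bump y)\<^sup>2 / 4))"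
      using pos by (auto simp: \<phi>_def)
    also have "(LINT y|lborel. \<dots> y) = integral ?B (\<lambda>y. \<beta> (x + \<rho> *\<^sub>R y) * ((bump y)\<^sup>2 / 4))"
      by (rule integral_cbox_eq_lborel[symmetric])
         (use inS \<rho> bump_eq_0_off_box in \<open>auto intro!: continuous_intros continuous_on_bump
           continuous_on_compose2[OF weak_poissonD(2)[OF w]]\<close>)
    finally have e2: "(LINT z|lborel. ?f2 z) = \<rho> ^ DIM('a) * integral ?B (\<lambda>y. \<beta> (x + \<rho> *\<^sub>R y) * ((bump y)\<^sup>2 / 4))" .
    have "- (1 / \<rho>) * D = integral ?B (\<lambda>y. \<beta> (x + \<rho> *\<^sub>R y) * ((bump y)\<^sup>2 / 4))"
    proof -
      have "\<rho> ^ DIM('a) * (- (1 / \<rho>) * D)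
          = \<rho> ^ DIM('a) * integral ?B (\<lambda>y. \<beta> (x + \<rho> *\<^sub>R y) * ((bump y)\<^sup>2 / 4))"
        by (rule trans[OF e1[symmetric] trans[OF eq e2]])
      then show ?thesis by (rule mult_left_cancel[THEN iffD1, rotated]) (use pos in simp)
    qed
    then have D: "D = - \<rho> * integral ?B (\<lambda>y. \<beta> (x + \<rho> *\<^sub>R y) * ((bump y)\<^sup>2 / 4))"
      using pos by (simp add: field_simps)
    \<comment> \<open>Since \<open>bump\<close> is at most 1, its square is at most
      \<open>bump\<close>, and the right-hand side is bounded by the mean itself; this closes the
      differential inequality.\<close>
    have "norm (integral ?B (\<lambda>y. \<beta> (x + \<rho> *\<^sub>R y) * ((bump y)\<^sup>2 / 4)))
        \<le> integral ?B (\<lambda>y. C / 4 * (bump y * v (x + \<rho> *\<^sub>R y)))"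
    proof (rule integral_norm_bound_integral)
      fix y assume y: "y \<in> ?B"
      have "\<bar>\<beta> (x + \<rho> *\<^sub>R y)\<bar> * ((bump y)\<^sup>2 / 4) \<le> (C * v (x + \<rho> *\<^sub>R y)) * (bump y / 4)"
        using \<beta>[OF inS[OF y \<rho>]] v[OF inS[OF y \<rho>]] C bump_bounds[of y]
        by (intro mult_mono) (auto simp: power2_eq_square mult_left_le)
      then show "norm (\<beta> (x + \<rho> *\<^sub>R y) * ((bump y)\<^sup>2 / 4)) \<le> C / 4 * (bump y * v (x + \<rho> *\<^sub>R y))"
        by (simp add: abs_mult mult_ac)
    qed (use inS \<rho> in \<open>auto intro!: integrable_continuous continuous_intros continuous_on_bump
           continuous_on_compose2[OF weak_poissonD(2)[OF w]] continuous_on_compose2[OF cv]\<close>)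
    also have "\<dots> = C / 4 * bump_mean v x \<rho>" unfolding bump_mean_def by simp
    finally show ?thesis
      unfolding D using pos by (simp add: abs_mult mult.left_commute)
  qed
  then show "\<exists>D. (bump_mean v x has_real_derivative D) (at \<rho> within {0..R})
      \<and> (\<rho> > 0 \<longrightarrow> \<bar>D\<bar> \<le> C / 4 * \<rho> * bump_mean v x \<rho>)"
    using deriv by blast
qed

text \<open>Gronwall's argument for |m'| <= (C/4) \<rho> m, with integrating factors exp of
  -C\<rho>^2/8 and +C\<rho>^2/8. At \<rho> = 0 the mean is a fixed multiple of v(x), so values and
  means are comparable.\<close>

lemma bump_mean_comparable:
  assumes R: "R > 0" and ball: "cball x (R * real DIM('a)) \<subseteq> S"
  shows "bump_mean v x R \<le> exp (C * R\<^sup>2 / 8) * bump_mean v x 0"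
    "bump_mean v x 0 \<le> exp (C * R\<^sup>2 / 8) * bump_mean v x R"
proof -
  let ?m = "bump_mean v x"
  note der = bump_mean_derivative[OF R ball]
  have cm: "continuous_on {0..R} ?m"
    unfolding continuous_on_eq_continuous_within
    using der DERIV_continuous by blast
  have D: "\<exists>D. (?m has_real_derivative D) (at \<rho>) \<and> \<bar>D\<bar> \<le> C / 4 * \<rho> * ?m \<rho>" if "0 < \<rho>" "\<rho> < R" for \<rho>
    using der[of \<rho>] that at_within_Icc_at[of 0 \<rho> R] by auto
  have "?m R * exp (- (C * R\<^sup>2 / 8)) \<le> ?m 0 * exp (- (C * 0\<^sup>2 / 8))"
  proof (rule DERIV_nonpos_imp_decreasing_open[where f = "\<lambda>\<rho>. ?m \<rho> * exp (- (C * \<rho>\<^sup>2 / 8))"])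
    fix \<rho> assume "0 < \<rho>" "\<rho> < R"
    then obtain D where D: "(?m has_real_derivative D) (at \<rho>)" "\<bar>D\<bar> \<le> C / 4 * \<rho> * ?m \<rho>" using D by blast
    have "((\<lambda>\<rho>. ?m \<rho> * exp (- (C * \<rho>\<^sup>2 / 8))) has_real_derivative
        (D - C / 4 * \<rho> * ?m \<rho>) * exp (- (C * \<rho>\<^sup>2 / 8))) (at \<rho>)"
      using D(1) by (auto intro!: derivative_eq_intros simp: field_simps)
    then show "\<exists>y. ((\<lambda>\<rho>. ?m \<rho> * exp (- (C * \<rho>\<^sup>2 / 8))) has_real_derivative y) (at \<rho>) \<and> y \<le> 0"
      using D(2) by (intro exI conjI) (auto intro!: mult_nonpos_nonneg)
  qed (use R in \<open>auto intro!: continuous_intros cm\<close>)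
  then show "?m R \<le> exp (C * R\<^sup>2 / 8) * ?m 0" by (simp add: exp_minus field_simps)
  have "?m 0 * exp (C * 0\<^sup>2 / 8) \<le> ?m R * exp (C * R\<^sup>2 / 8)"
  proof (rule DERIV_nonneg_imp_increasing_open[where f = "\<lambda>\<rho>. ?m \<rho> * exp (C * \<rho>\<^sup>2 / 8)"])
    fix \<rho> assume "0 < \<rho>" "\<rho> < R"
    then obtain D where D: "(?m has_real_derivative D) (at \<rho>)" "\<bar>D\<bar> \<le> C / 4 * \<rho> * ?m \<rho>" using D by blast
    have "((\<lambda>\<rho>. ?m \<rho> * exp (C * \<rho>\<^sup>2 / 8)) has_real_derivative
        (D + C / 4 * \<rho> * ?m \<rho>) * exp (C * \<rho>\<^sup>2 / 8)) (at \<rho>)"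
      using D(1) by (auto intro!: derivative_eq_intros simp: field_simps)
    then show "\<exists>y. ((\<lambda>\<rho>. ?m \<rho> * exp (C * \<rho>\<^sup>2 / 8)) has_real_derivative y) (at \<rho>) \<and> y \<ge> 0"
      using D(2) by (intro exI conjI) (auto intro!: mult_nonneg_nonneg)
  qed (use R in \<open>auto intro!: continuous_intros cm\<close>)
  then show "?m 0 \<le> exp (C * R\<^sup>2 / 8) * ?m R" by (simp add: mult.commute)
qed

text \<open>v(x) is comparable to its mean of radius R/2, that mean is dominated by the mean of
  radius R about x', and the latter is comparable to v(x'). Points of the smaller ball have distance
  at most 3R/4 from x', where the larger bump is at least 1 - 9/16 = 7/16; the factor 2^n is the
  ratio of the volume scalings.\<close>

lemma harnack_nearby:
  assumes R: "R > 0" and ball: "cball x (R * real DIM('a)) \<subseteq> S" "cball x' (R * real DIM('a)) \<subseteq> S"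
    and near: "dist x x' \<le> R / 4"
  shows "v x \<le> exp (C * R\<^sup>2 / 4) * 2 ^ DIM('a) * (16 / 7) * v x'"
proof -
  let ?B = "cbox (- One) (One::'a)"
  define c where "c = integral ?B bump"
  have mean0: "bump_mean v y 0 = c * v y" for y unfolding bump_mean_def c_def by simp
  have xS: "x' \<in> S" using ball(2) R by force
  have c: "c > 0"
  proof -
    have "c \<ge> 0" unfolding c_def
      by (rule integral_nonneg) (auto intro: integrable_continuous continuous_on_bump bump_bounds)
    moreover have "c \<noteq> 0"
    proof
      assume "c = 0"
      moreover have "(bump has_integral c) ?B"
        unfolding c_def by (rule integrable_integral integrable_continuous continuous_on_bump)+
      ultimately have "bump (0::'a) = 0"
        by (intro has_integral_0_cbox_imp_0[of "- One" "One::'a" bump 0])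
           (auto intro: continuous_on_bump bump_bounds simp: mem_box box_ne_empty)
      then show False by (simp add: bump_def)
    qed
    ultimately show ?thesis by simp
  qed
  have R2: "R / 2 > 0" using R by simp
  have ball2: "cball x (R / 2 * real DIM('a)) \<subseteq> S"
    by (rule subset_trans[OF subset_cball ball(1)]) (use R in simp)
  let ?f = "\<lambda>x \<rho> z. bump ((z - x) /\<^sub>R \<rho>) * v z"
  have "(LINT z|lborel. ?f x (R / 2) z) \<le> (LINT z|lborel. (16/7) * ?f x' R z)"
  proof (rule integral_mono)
    show "integrable lborel (?f x (R / 2))" by (rule bump_mean_lborel[OF R2 ball2])
    show "integrable lborel (\<lambda>z. (16/7) * ?f x' R z)"
      using bump_mean_lborel(1)[OF R ball(2)] by (rule integrable_mult_right)
    fix z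
    show "?f x (R / 2) z \<le> (16/7) * ?f x' R z"
    proof (cases "dist x z \<le> R / 2")
      case True
      then have "dist x z * 1 \<le> R * real DIM('a)" using R DIM_positive[where 'a='a]
        by (intro mult_mono) (auto simp: Suc_leI)
      then have "v z \<ge> 0" using ball(1) v by auto
      have "norm (z - x') \<le> 3 / 4 * R"
        using True near dist_triangle[of z x' x] by (simp add: dist_norm norm_minus_commute)
      then have "norm (z - x') / R \<le> 3 / 4" using R by (simp add: field_simps)
      moreover have "norm ((z - x') /\<^sub>R R) = norm (z - x') / R"
        using R by (simp add: divide_inverse mult.commute)
      ultimately have "norm ((z - x') /\<^sub>R R) \<le> 3 / 4" by simp
      then have "(norm ((z - x') /\<^sub>R R))\<^sup>2 \<le> (3 / 4)\<^sup>2" by (intro power_mono) auto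
      then have "bump ((z - x') /\<^sub>R R) \<ge> 7 / 16"
        unfolding bump_def dot_square_norm by (simp add: power2_eq_square)
      then have "bump ((z - x) /\<^sub>R (R / 2)) \<le> 16 / 7 * bump ((z - x') /\<^sub>R R)"
        using bump_bounds[of "((z - x) /\<^sub>R (R / 2))"] by linarith
      then have "bump ((z - x) /\<^sub>R (R / 2)) * v z \<le> 16 / 7 * bump ((z - x') /\<^sub>R R) * v z"
        using \<open>v z \<ge> 0\<close> by (rule mult_right_mono)
      then show ?thesis by simp
    next
      case False
      then have z: "bump ((z - x) /\<^sub>R (R / 2)) = 0"
        using R by (intro bump_rescaled_eq_0) auto
      show ?thesis
      proof (cases "dist x' z \<le> R")
        case True
        then have "dist x' z * 1 \<le> R * real DIM('a)" using R DIM_positive[where 'a='a]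
          by (intro mult_mono) (auto simp: Suc_leI)
        then have "v z \<ge> 0" using ball(2) v by auto
        then show ?thesis unfolding z using bump_bounds by (auto intro!: mult_nonneg_nonneg)
      next
        case False
        then have "bump ((z - x') /\<^sub>R R) = 0"
          using R by (intro bump_rescaled_eq_0) auto
        then show ?thesis unfolding z by simp
      qed
    qed
  qed
  then have "(R / 2) ^ DIM('a) * bump_mean v x (R / 2) \<le> (16/7) * (R ^ DIM('a) * bump_mean v x' R)"
    using bump_mean_lborel(2)[OF R2 ball2] bump_mean_lborel(2)[OF R ball(2)] by simp
  then have A: "bump_mean v x (R / 2) \<le> 2 ^ DIM('a) * (16/7) * bump_mean v x' R"
    using R by (simp add: power_divide field_simps)
  have "c * v x \<le> exp (C * (R / 2)\<^sup>2 / 8) * bump_mean v x (R / 2)"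
    using bump_mean_comparable(2)[OF R2 ball2] mean0 by simp
  also have "\<dots> \<le> exp (C * (R / 2)\<^sup>2 / 8) * (2 ^ DIM('a) * (16/7) * bump_mean v x' R)"
    using A by simp
  also have "\<dots> \<le> exp (C * (R / 2)\<^sup>2 / 8) * (2 ^ DIM('a) * (16/7) * (exp (C * R\<^sup>2 / 8) * (c * v x')))"
    using bump_mean_comparable(1)[OF R ball(2)] mean0 by simp
  also have "\<dots> = exp (C * (R / 2)\<^sup>2 / 8 + C * R\<^sup>2 / 8) * (2 ^ DIM('a) * (16/7) * (c * v x'))"
    by (simp add: exp_add)
  also have "\<dots> \<le> exp (C * R\<^sup>2 / 4) * (2 ^ DIM('a) * (16/7) * (c * v x'))"
    using C c v[OF xS] by (intro mult_right_mono) (auto simp: power2_eq_square)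
  finally have "c * v x \<le> c * (exp (C * R\<^sup>2 / 4) * 2 ^ DIM('a) * (16 / 7) * v x')"
    by (simp add: mult_ac)
  then show ?thesis using c by simp
qed

end

section \<open>Harnack's inequality on spheres\<close>

text \<open>With \<open>R = r / (2 DIM)\<close> the balls that occur stay in |z| >= r/2, hence in
  the region |z| > r/3, where the potential is at most 9K/r^2. The product of this with R^2 does not
  contain r, so the constant is the same on all spheres.\<close>

lemma harnack_sphere_step:
  fixes v \<beta> :: "'a::euclidean_space \<Rightarrow> real"
  assumes w: "weak_poisson (- {0}) v \<beta>" and K: "K \<ge> 0"
    and v: "\<And>x. x \<noteq> 0 \<Longrightarrow> 0 \<le> v x" and \<beta>: "\<And>x. x \<noteq> 0 \<Longrightarrow> \<bar>\<beta> x\<bar> \<le> K / (norm x)\<^sup>2 * v x"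
    and x: "norm x = r" "norm y = r" "r > 0" and near: "dist x y \<le> r / (8 * real DIM('a))"
  shows "v x \<le> exp K * 2 ^ DIM('a) * (16 / 7) * v y"
proof -
  define S where "S = {z::'a. r / 3 < norm z}"
  define R where "R = r / (2 * real DIM('a))"
  have dim: "real DIM('a) \<ge> 1" using DIM_positive[where 'a='a] by (simp add: Suc_leI)
  have S: "open S" unfolding S_def by (intro open_Collect_less continuous_intros)
  have S0: "S \<subseteq> - {0}" using x unfolding S_def by auto
  have ball: "cball z (R * real DIM('a)) \<subseteq> S" if "norm z = r" for z
  proof
    fix p assume "p \<in> cball z (R * real DIM('a))"
    then have "norm (z - p) \<le> r / 2" using dim by (simp add: R_def dist_norm)
    then have "norm p \<ge> r / 2" using that norm_triangle_ineq2[of z p] by linarith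
    then show "p \<in> S" using x unfolding S_def by simp
  qed
  have *: "v x \<le> exp (9 * K / r\<^sup>2 * R\<^sup>2 / 4) * 2 ^ DIM('a) * (16 / 7) * v y"
  proof (rule harnack_nearby[OF S weak_poisson_subset[OF w S S0]])
    fix z assume z: "z \<in> S"
    then have "z \<noteq> 0" using S0 by auto
    then show "0 \<le> v z" by (rule v)
    have "(r / 3)\<^sup>2 \<le> (norm z)\<^sup>2" using z x unfolding S_def by (intro power_mono) auto
    then have "K / (norm z)\<^sup>2 \<le> K / (r / 3)\<^sup>2" using K x \<open>z \<noteq> 0\<close> by (intro divide_left_mono mult_pos_pos) auto
    then have "K / (norm z)\<^sup>2 \<le> 9 * K / r\<^sup>2" by (simp add: power_divide mult.commute)
    then have "K / (norm z)\<^sup>2 * v z \<le> 9 * K / r\<^sup>2 * v z"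
      using \<open>0 \<le> v z\<close> by (rule mult_right_mono)
    then show "\<bar>\<beta> z\<bar> \<le> 9 * K / r\<^sup>2 * v z" using \<beta>[OF \<open>z \<noteq> 0\<close>] by linarith
  qed (use x near ball K dim in \<open>auto simp: R_def\<close>)
  have "9 * K / r\<^sup>2 * R\<^sup>2 / 4 = K * (9 / (16 * (real DIM('a))\<^sup>2))"
    using x by (simp add: R_def power2_eq_square field_simps)
  also have "\<dots> \<le> K * 1"
  proof (intro mult_left_mono K)
    have "1 \<le> (real DIM('a))\<^sup>2" using dim by (rule one_le_power)
    then show "9 / (16 * (real DIM('a))\<^sup>2) \<le> 1" by (subst divide_le_eq_1_pos) linarith+
  qed
  finally have "exp (9 * K / r\<^sup>2 * R\<^sup>2 / 4) \<le> exp K" by simp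
  then have "exp (9 * K / r\<^sup>2 * R\<^sup>2 / 4) * (2 ^ DIM('a) * (16 / 7) * v y)
      \<le> exp K * (2 ^ DIM('a) * (16 / 7) * v y)"
    using v[of y] x norm_eq_zero[of y] by (intro mult_right_mono mult_nonneg_nonneg) auto
  then show ?thesis using * unfolding mult.assoc by (rule order_trans[rotated])
qed

text \<open>A great circle through x and y: e is the normalized component of y orthogonal to x. If y
  is parallel to x that component vanishes, and dimension at least 2 supplies another orthogonal
  direction.\<close>

lemma sphere_arc:
  fixes x y :: "'a::euclidean_space"
  assumes "norm x = r" "norm y = r" "r > 0" "DIM('a) \<ge> 2"
  obtains e t where "norm e = r" "x \<bullet> e = 0" "0 \<le> t" "t \<le> pi" "y = cos t *\<^sub>R x + sin t *\<^sub>R e"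
proof -
  define k where "k = (y \<bullet> x) / r\<^sup>2"
  define p where "p = y - k *\<^sub>R x"
  have xx: "x \<bullet> x = r\<^sup>2" and yy: "y \<bullet> y = r\<^sup>2" using assms by (auto simp: dot_square_norm)
  have px: "x \<bullet> p = 0" using assms by (simp add: p_def k_def inner_diff_right xx inner_commute)
  have "\<exists>e. norm e = r \<and> x \<bullet> e = 0 \<and> p = (norm p / r) *\<^sub>R e"
  proof (cases "p = 0")
    case True
    obtain e where e: "e \<noteq> 0" "orthogonal x e" using orthogonal_to_vector_exists[OF assms(4)] by blast
    define e' where "e' = (r / norm e) *\<^sub>R e"
    have "norm e' = r" "x \<bullet> e' = 0"
      using e assms by (auto simp: orthogonal_def e'_def)
    then show ?thesis using True by auto
  next
    case False
    then show ?thesis using assms px by (intro exI[of _ "(r / norm p) *\<^sub>R p"]) auto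
  qed
  then obtain e where e: "norm e = r" "x \<bullet> e = 0" "p = (norm p / r) *\<^sub>R e" by blast
  have ee: "e \<bullet> e = r\<^sup>2" using e by (simp add: dot_square_norm)
  have y: "y = k *\<^sub>R x + (norm p / r) *\<^sub>R e" using e(3) unfolding p_def by simp
  have "y \<bullet> y = k\<^sup>2 * r\<^sup>2 + (norm p / r)\<^sup>2 * r\<^sup>2"
    by (subst (1 2) y) (simp add: inner_add_left inner_add_right xx ee e(2) inner_commute[of e x] power2_eq_square)
  then have "(k\<^sup>2 + (norm p / r)\<^sup>2) * r\<^sup>2 = 1 * r\<^sup>2" using yy by (simp add: distrib_right)
  then have "k\<^sup>2 + (norm p / r)\<^sup>2 = 1" using assms by simp
  moreover have "norm p / r \<ge> 0" using assms by simp
  ultimately obtain t where "0 \<le> t" "t \<le> pi" "k = cos t" "norm p / r = sin t"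
    using sincos_total_pi by blast
  then show ?thesis using that e y by auto
qed

text \<open>Chain the local inequality along a great circle. The order of quantifiers is the point:
  \<open>H\<close> is fixed before the function, its right-hand side and the sphere.\<close>

theorem harnack_sphere:
  fixes K :: real
  assumes dim: "DIM('a::euclidean_space) \<ge> 2" and K: "K \<ge> 0"
  obtains H where "H > 0" and
    "\<And>(v :: 'a \<Rightarrow> real) \<beta> x y. weak_poisson (- {0}) v \<beta> \<Longrightarrow> (\<And>x. x \<noteq> 0 \<Longrightarrow> 0 \<le> v x) \<Longrightarrow>
      (\<And>x. x \<noteq> 0 \<Longrightarrow> \<bar>\<beta> x\<bar> \<le> K / (norm x)\<^sup>2 * v x) \<Longrightarrow> x \<noteq> 0 \<Longrightarrow> norm x = norm y \<Longrightarrow> v x \<le> H * v y"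
proof -
  define H1 :: real where "H1 = exp K * 2 ^ DIM('a) * (16 / 7)"
  \<comment> \<open>The arc has angle at most pi < 4, so n steps have length at most 4r/n = r/(8
    DIM), the range of the local inequality.\<close>
  define n where "n = 32 * DIM('a)"
  show ?thesis
  proof (rule that[of "H1 ^ n"])
    show H1: "H1 ^ n > 0" by (simp add: H1_def)
    fix v :: "'a \<Rightarrow> real" and \<beta> and x y :: 'a
    assume w: "weak_poisson (- {0}) v \<beta>" and v: "\<And>x. x \<noteq> 0 \<Longrightarrow> 0 \<le> v x"
      and \<beta>: "\<And>x. x \<noteq> 0 \<Longrightarrow> \<bar>\<beta> x\<bar> \<le> K / (norm x)\<^sup>2 * v x" and x0: "x \<noteq> 0" and xy: "norm x = norm y"
    define r where "r = norm x"
    have r: "norm x = r" "norm y = r" "r > 0" using x0 xy by (auto simp: r_def)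
    obtain e t where e: "norm e = r" "x \<bullet> e = 0" "0 \<le> t" "t \<le> pi" "y = cos t *\<^sub>R x + sin t *\<^sub>R e"
      using sphere_arc[OF r dim] by blast
    define \<gamma> where "\<gamma> = (\<lambda>s. cos s *\<^sub>R x + sin s *\<^sub>R e)"
    have xx: "x \<bullet> x = r\<^sup>2" and ee: "e \<bullet> e = r\<^sup>2" using r e by (auto simp: dot_square_norm)
    have comb: "(norm (a *\<^sub>R x + b *\<^sub>R e))\<^sup>2 = (a\<^sup>2 + b\<^sup>2) * r\<^sup>2" for a b :: real
      unfolding power2_norm_eq_inner
      by (simp add: inner_add_left inner_add_right xx ee e(2) inner_commute[of e x] power2_eq_square algebra_simps)
    have norm_\<gamma>: "norm (\<gamma> s) = r" for s
    proof -
      have "(norm (\<gamma> s))\<^sup>2 = r\<^sup>2" unfolding \<gamma>_def comb by simp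
      then show ?thesis using r(3) by (simp add: power2_eq_iff_nonneg)
    qed
    have dist_\<gamma>: "dist (\<gamma> s) (\<gamma> s') \<le> r * \<bar>s - s'\<bar>" for s s'
    proof -
      have "\<gamma> s - \<gamma> s' = (cos s - cos s') *\<^sub>R x + (sin s - sin s') *\<^sub>R e"
        by (simp add: \<gamma>_def algebra_simps)
      then have "(dist (\<gamma> s) (\<gamma> s'))\<^sup>2 = ((cos s - cos s')\<^sup>2 + (sin s - sin s')\<^sup>2) * r\<^sup>2"
        by (simp add: dist_norm comb)
      also have "(cos s - cos s')\<^sup>2 + (sin s - sin s')\<^sup>2 = 2 - 2 * cos (s - s')"
        by (simp add: power2_diff cos_diff cos_squared_eq algebra_simps)
      also have "\<dots> = 4 * (sin ((s - s') / 2))\<^sup>2"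
      proof -
        have "cos (s - s') = cos (2 * ((s - s') / 2))" by (rule arg_cong) simp
        also have "\<dots> = 1 - 2 * (sin ((s - s') / 2))\<^sup>2" by (rule cos_double_sin)
        finally show ?thesis by simp
      qed
      also have "\<dots> \<le> 4 * ((s - s') / 2)\<^sup>2"
        using abs_sin_x_le_abs_x[of "(s - s') / 2"] by (intro mult_left_mono) (simp_all only: abs_le_square_iff)
      also have "\<dots> = (s - s')\<^sup>2" by (simp add: power2_eq_square)
      finally have "(dist (\<gamma> s) (\<gamma> s'))\<^sup>2 \<le> (r * \<bar>s - s'\<bar>)\<^sup>2"
        using r by (simp add: power_mult_distrib mult.commute)
      then show ?thesis using r by (auto intro: power2_le_imp_le)
    qed
    have step: "v (\<gamma> s) \<le> H1 * v (\<gamma> (s + t / n))" for s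
      unfolding H1_def
    proof (rule harnack_sphere_step[OF w K v \<beta> norm_\<gamma> norm_\<gamma> r(3)])
      have n: "real n > 0" using dim by (simp add: n_def)
      have "dist (\<gamma> s) (\<gamma> (s + t / n)) \<le> r * (t / n)" using dist_\<gamma>[of s "s + t / n"] e n by simp
      also have "\<dots> \<le> r * (4 / n)" using e pi_less_4 r n by (intro mult_left_mono divide_right_mono) auto
      also have "\<dots> = r / (8 * real DIM('a))" by (simp add: n_def)
      finally show "dist (\<gamma> s) (\<gamma> (s + t / n)) \<le> r / (8 * real DIM('a))" .
    qed
    have "v (\<gamma> 0) \<le> H1 ^ k * v (\<gamma> (k * (t / n)))" for k :: nat
    proof (induction k)
      case (Suc k)
      have "H1 ^ k * v (\<gamma> (k * (t / n))) \<le> H1 ^ k * (H1 * v (\<gamma> (k * (t / n) + t / n)))"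
        using step[of "k * (t / n)"] by (intro mult_left_mono) (auto simp: H1_def)
      then show ?case using Suc by (simp add: algebra_simps add_divide_distrib)
    qed simp
    from this[of n] show "v x \<le> H1 ^ n * v y"
      using dim e(5) by (simp add: \<gamma>_def n_def)
  qed
qed

subsection \<open>Radial functions and the comparison principle\<close>

lemma radial_GDERIV:
  fixes x :: "'a::real_inner"
  assumes "x \<noteq> 0" "(Y has_real_derivative Y1) (at (\<epsilon> * ln (norm x)))"
  shows "GDERIV (\<lambda>x. norm x powr b * Y (\<epsilon> * ln (norm x))) x :>
    (norm x powr (b - 2) * (b * Y (\<epsilon> * ln (norm x)) + \<epsilon> * Y1)) *\<^sub>R x"
proof -
  let ?r = "norm x"
  have r: "?r > 0" using assms by simp
  have 1: "((\<lambda>r. \<epsilon> * ln r) has_real_derivative \<epsilon> / ?r) (at ?r)"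
    using r by (auto intro!: derivative_eq_intros)
  have "((\<lambda>r. r powr b * Y (\<epsilon> * ln r)) has_real_derivative
     ?r powr (b - 1) * (b * Y (\<epsilon> * ln ?r) + \<epsilon> * Y1)) (at ?r)"
    using r
    by (auto intro!: derivative_eq_intros DERIV_chain2[OF assms(2) 1] simp: powr_diff field_simps)
  from GDERIV_DERIV_compose[OF GDERIV_norm[OF assms(1)] this]
  show ?thesis
    by (rule GDERIV_subst)
       (use r in \<open>simp add: sgn_div_norm powr_diff power2_eq_square divide_inverse mult_ac\<close>)
qed

text \<open>The gradient is x times a radial factor of the same shape, with exponent b - 2; the
  lemma can be applied again to that factor.\<close>

lemma radial_C1_on:
  fixes S :: "'a::real_inner set"
  assumes S: "0 \<notin> S" and I: "\<And>x. x \<in> S \<Longrightarrow> \<epsilon> * ln (norm x) \<in> I"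
    and Y: "\<And>t. t \<in> I \<Longrightarrow> (Y has_real_derivative Y' t) (at t)" and Y': "continuous_on I Y'"
  shows "C1_on S (\<lambda>x. norm x powr b * Y (\<epsilon> * ln (norm x)))"
    and "x \<in> S \<Longrightarrow> gradient (\<lambda>x. norm x powr b * Y (\<epsilon> * ln (norm x))) x =
      (norm x powr (b - 2) * (b * Y (\<epsilon> * ln (norm x)) + \<epsilon> * Y' (\<epsilon> * ln (norm x)))) *\<^sub>R x"
proof -
  have G: "GDERIV (\<lambda>x. norm x powr b * Y (\<epsilon> * ln (norm x))) x :>
    (norm x powr (b - 2) * (b * Y (\<epsilon> * ln (norm x)) + \<epsilon> * Y' (\<epsilon> * ln (norm x)))) *\<^sub>R x"
    if "x \<in> S" for x
    using that S I Y by (intro radial_GDERIV) auto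
  have cY: "continuous_on I Y"
    using Y DERIV_isCont continuous_at_imp_continuous_on by blast
  show "C1_on S (\<lambda>x. norm x powr b * Y (\<epsilon> * ln (norm x)))"
    by (rule C1_onI[OF G])
       (use S I in \<open>auto intro!: continuous_intros continuous_on_compose2[OF cY] continuous_on_compose2[OF Y']\<close>)
  show "x \<in> S \<Longrightarrow> gradient (\<lambda>x. norm x powr b * Y (\<epsilon> * ln (norm x))) x =
      (norm x powr (b - 2) * (b * Y (\<epsilon> * ln (norm x)) + \<epsilon> * Y' (\<epsilon> * ln (norm x)))) *\<^sub>R x"
    using G gradient_eq by blast
qed

text \<open>With \<open>t = \<epsilon> ln |x|\<close> and \<open>a = (N-2)/2\<close> one has \<open>\<Delta>(|x|\<^sup>-\<^sup>a Z(t)) = |x|\<^sup>-\<^sup>a\<^sup>-\<^sup>2 (Z'' - a\<^sup>2 Z)\<close>; the weak form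
  is Euler's identity for \<open>k \<phi>\<close>, where \<open>\<nabla>(|x|\<^sup>-\<^sup>a Z(t)) = k x\<close>.\<close>

lemma radial_weak_poisson:
  fixes S :: "'a::euclidean_space set"
  assumes S: "open S" "0 \<notin> S" and I: "\<And>x. x \<in> S \<Longrightarrow> \<epsilon> * ln (norm x) \<in> I"
    and \<epsilon>: "\<epsilon> * \<epsilon> = 1" and a: "a = (real DIM('a) - 2) / 2"
    and Z: "\<And>t. t \<in> I \<Longrightarrow> (Z has_real_derivative Z1 t) (at t)"
    and Z1: "\<And>t. t \<in> I \<Longrightarrow> (Z1 has_real_derivative Z2 t) (at t)" and Z2: "continuous_on I Z2"
  shows "weak_poisson S (\<lambda>x. norm x powr (- a) * Z (\<epsilon> * ln (norm x)))
     (\<lambda>x. norm x powr (- a - 2) * (a\<^sup>2 * Z (\<epsilon> * ln (norm x)) - Z2 (\<epsilon> * ln (norm x))))"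
  unfolding weak_poisson_def
proof (intro conjI allI impI)
  let ?t = "\<lambda>x::'a. \<epsilon> * ln (norm x)"
  have cZ: "continuous_on I Z" "continuous_on I Z1"
    using Z Z1 DERIV_isCont continuous_at_imp_continuous_on by blast+
  show C: "C1_on S (\<lambda>x. norm x powr (- a) * Z (?t x))"
    by (rule radial_C1_on(1)[OF S(2), where I = I and Y = Z and Y' = Z1]) (use I Z cZ in auto)
  show c2: "continuous_on S (\<lambda>x. norm x powr (- a - 2) * (a\<^sup>2 * Z (?t x) - Z2 (?t x)))"
    using S I by (auto intro!: continuous_intros continuous_on_compose2[OF cZ(1)] continuous_on_compose2[OF Z2])
  fix \<phi> :: "'a \<Rightarrow> real" assume \<phi>: "C1c_on S \<phi>"
  obtain K where K: "C1_on S \<phi>" "compact K" "K \<subseteq> S" "\<And>x. x \<notin> K \<Longrightarrow> \<phi> x = 0"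
    by (rule C1c_onE[OF \<phi>]) blast
  have cl: "closed K" using K compact_imp_closed by blast
  have grad0: "gradient \<phi> x = 0" if "x \<notin> K" for x
    by (rule gradient_zero_off(2)[OF cl _ that]) (rule K(4))
  define P where "P = (\<lambda>t. - a * Z t + \<epsilon> * Z1 t)"
  define P1 where "P1 = (\<lambda>t. - a * Z1 t + \<epsilon> * Z2 t)"
  define k where "k = (\<lambda>x::'a. norm x powr (- a - 2) * P (?t x))"
  have P: "(P has_real_derivative P1 t) (at t)" if "t \<in> I" for t
    unfolding P_def P1_def using Z[OF that] Z1[OF that] by (auto intro!: derivative_eq_intros)
  have P1: "continuous_on I P1" unfolding P1_def by (intro continuous_intros cZ Z2)
  have k1: "C1_on S k" unfolding k_def
    by (rule radial_C1_on(1)[OF S(2), where I = I and Y = P and Y' = P1]) (use I P P1 in auto)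
  have gu: "gradient (\<lambda>x. norm x powr (- a) * Z (?t x)) x = k x *\<^sub>R x" if "x \<in> S" for x
    using radial_C1_on(2)[OF S(2) _ _ cZ(2) that, of \<epsilon> Z "- a"] I Z by (simp add: k_def P_def)
  have xk: "x \<bullet> gradient k x = norm x powr (- a - 2) * ((- a - 2) * P (?t x) + \<epsilon> * P1 (?t x))"
    if "x \<in> S" for x
  proof -
    have "x \<noteq> 0" using that S by auto
    then have "norm x powr (- a - 2 - 2) * (x \<bullet> x) = norm x powr (- a - 2)"
      by (subst powr_diff[of _ "- a - 2" 2]) (simp add: dot_square_norm)
    then show ?thesis unfolding k_def
      using radial_C1_on(2)[OF S(2) _ _ P1 that, of \<epsilon> P "- a - 2"] I P by (simp add: mult_ac)
  qed
  define F where "F = (\<lambda>x. k x * \<phi> x)"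
  have F: "C1_on S F" unfolding F_def by (intro C1_on_mult k1 K)
  have F0: "F x = 0" if "x \<notin> K" for x using K(4)[OF that] by (simp add: F_def)
  have F0': "GDERIV F x :> 0" "gradient F x = 0" if "x \<notin> K" for x
    using gradient_zero_off[OF cl _ that, of F] F0 by auto
  have GF: "GDERIV F x :> gradient F x" for x
    using C1_on_GDERIV[OF F] F0' K(3) by (cases "x \<in> K") auto
  have cF: "continuous_on UNIV (gradient F)"
    by (rule continuous_on_zero_extension[OF S(1) C1_on_continuous_gradient[OF F] cl K(3)]) (rule F0')
  have "(LINT x|lborel. x \<bullet> gradient F x) = - real DIM('a) * (LINT x|lborel. F x)"
    by (rule euler_identity[OF GF cF K(2)]) (rule F0)
  moreover
  have eq: "gradient (\<lambda>x. norm x powr (- a) * Z (?t x)) x \<bullet> gradient \<phi> x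
     = (x \<bullet> gradient F x + real DIM('a) * F x)
       + norm x powr (- a - 2) * (a\<^sup>2 * Z (?t x) - Z2 (?t x)) * \<phi> x" for x
  proof (cases "x \<in> K")
    case True
    then have x: "x \<in> S" using K by auto
    have "gradient F x = k x *\<^sub>R gradient \<phi> x + \<phi> x *\<^sub>R gradient k x"
      unfolding F_def by (intro gradient_eq GDERIV_mult C1_on_GDERIV[OF k1 x] C1_on_GDERIV[OF K(1) x])
    then have "x \<bullet> gradient F x = k x * (x \<bullet> gradient \<phi> x)
      + \<phi> x * (norm x powr (- a - 2) * ((- a - 2) * P (?t x) + \<epsilon> * P1 (?t x)))"
      using xk[OF x] by (simp add: inner_add_right)
    moreover have "real DIM('a) = 2 * a + 2" using a by simp
    moreover have "\<phi> x * (norm x powr (- a - 2) * ((- a - 2) * P (?t x) + \<epsilon> * P1 (?t x))) + (2 * a + 2) * F x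
       = - (norm x powr (- a - 2) * (a\<^sup>2 * Z (?t x) - Z2 (?t x))) * \<phi> x"
    proof -
      \<comment> \<open>As DIM = 2a + 2, the terms with \<open>Z1\<close> cancel; this is what the
        exponent -a is chosen for.\<close>
      have E: "(- a - 2) * P (?t x) + \<epsilon> * P1 (?t x) + (2 * a + 2) * P (?t x)
         = - (a\<^sup>2 * Z (?t x)) + (\<epsilon> * \<epsilon>) * Z2 (?t x)"
        by (simp add: P_def P1_def power2_eq_square algebra_simps)
      have "\<phi> x * (norm x powr (- a - 2) * ((- a - 2) * P (?t x) + \<epsilon> * P1 (?t x))) + (2 * a + 2) * F x
        = norm x powr (- a - 2) * \<phi> x * ((- a - 2) * P (?t x) + \<epsilon> * P1 (?t x) + (2 * a + 2) * P (?t x))"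
        by (simp add: F_def k_def algebra_simps)
      also have "\<dots> = norm x powr (- a - 2) * \<phi> x * (- (a\<^sup>2 * Z (?t x)) + Z2 (?t x))"
        unfolding E \<epsilon> by simp
      finally show ?thesis by (simp add: algebra_simps)
    qed
    ultimately show ?thesis unfolding gu[OF x] by simp
  next
    case False
    then show ?thesis using grad0 F0 F0' K by simp
  qed
  have i1: "integrable lborel (\<lambda>x. x \<bullet> gradient F x)"
    by (rule integrable_compact_support[OF _ K(2)])
       (use F0' in \<open>auto intro!: continuous_intros continuous_on_subset[OF cF]\<close>)
  have i2: "integrable lborel F"
    by (rule integrable_compact_support[OF continuous_on_subset[OF C1_on_continuous[OF F] K(3)] K(2)]) (rule F0)
  have i3: "integrable lborel (\<lambda>x. norm x powr (- a - 2) * (a\<^sup>2 * Z (?t x) - Z2 (?t x)) * \<phi> x)"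
    by (rule weak_poisson_integrable(2)[OF C c2 \<phi> S(1)])
  ultimately show "(LINT x|lborel. gradient (\<lambda>x. norm x powr (- a) * Z (?t x)) x \<bullet> gradient \<phi> x) =
      (LINT x|lborel. norm x powr (- a - 2) * (a\<^sup>2 * Z (?t x) - Z2 (?t x)) * \<phi> x)"
    unfolding eq using i1 i2 i3 by simp
qed

section \<open>The comparison principle\<close>

lemma nonneg_integral_zero:
  fixes F :: "'a::euclidean_space \<Rightarrow> real"
  assumes F: "continuous_on UNIV F" "\<And>x. 0 \<le> F x" "compact K" "\<And>x. x \<notin> K \<Longrightarrow> F x = 0"
    and int: "(LINT x|lborel. F x) \<le> 0"
  shows "F x = 0"
proof -
  \<comment> \<open>The unit ball is added to give the box nonempty interior, and x so that the
    conclusion reaches x.\<close>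
  have "bounded (K \<union> cball 0 1 \<union> {x})" using F(3) compact_imp_bounded by auto
  then obtain b :: 'a where b: "K \<union> cball 0 1 \<union> {x} \<subseteq> cbox (- b) b"
    using bounded_subset_cbox_symmetric by blast
  have "b \<bullet> i \<ge> 1" if "i \<in> Basis" for i
  proof -
    have "i \<in> cbox (- b) b" using b that by auto
    then show ?thesis using that by (force simp: mem_box inner_same_Basis)
  qed
  then have "(- b) \<bullet> i < b \<bullet> i" if "i \<in> Basis" for i using that by force
  then have ne: "box (- b) b \<noteq> {}" by (simp add: box_ne_empty)
  have I: "integral (cbox (- b) b) F = (LINT x|lborel. F x)"
    by (rule integral_cbox_eq_lborel) (use F b in \<open>auto intro: continuous_on_subset\<close>)
  moreover have "integral (cbox (- b) b) F \<ge> 0"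
    using F by (intro integral_nonneg integrable_continuous) (auto intro: continuous_on_subset)
  ultimately have "integral (cbox (- b) b) F = 0" using int by simp
  moreover have "F integrable_on cbox (- b) b"
    using F by (intro integrable_continuous) (auto intro: continuous_on_subset)
  ultimately have "(F has_integral 0) (cbox (- b) b)" by (metis integrable_integral)
  then show ?thesis
    by (rule has_integral_0_cbox_imp_0[rotated 2]) (use F ne b in \<open>auto intro: continuous_on_subset\<close>)
qed

text \<open>Dividing by the Hardy ground state \<open>h = |x|\<^sup>-\<^sup>a\<close> turns \<open>- \<Delta> - a\<^sup>2/|x|\<^sup>2\<close> into the nonnegative form
  \<open>h\<^sup>2 |\<nabla>d|\<^sup>2\<close> with \<open>d = D/h\<close>.\<close>

theorem hardy_comparison:
  fixes S :: "'a::euclidean_space set"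
  assumes S: "open S" "0 \<notin> S" and a: "a = (real DIM('a) - 2) / 2"
    and D: "weak_poisson S D \<beta>"
    and strict: "\<And>x. x \<in> S \<Longrightarrow> D x > 0 \<Longrightarrow> \<beta> x < a\<^sup>2 / (norm x)\<^sup>2 * D x"
    and bd: "\<And>e. e > 0 \<Longrightarrow> \<exists>K. compact K \<and> K \<subseteq> S \<and> (\<forall>x\<in>S - K. norm x powr a * D x \<le> e)"
  shows "x \<in> S \<Longrightarrow> D x \<le> 0"
proof (rule ccontr)
  assume x: "x \<in> S" and "\<not> D x \<le> 0"
  then have Dx: "D x > 0" by simp
  define d where "d = (\<lambda>x. norm x powr a * D x)"
  define h where "h = (\<lambda>x::'a. norm x powr (- a))"
  have pos: "norm y > 0" if "y \<in> S" for y using that S by auto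
  have dx: "d x > 0" using Dx pos[OF x] by (simp add: d_def)
  \<comment> \<open>Truncating d at a positive level, not at 0, makes the truncation vanish off the
    compact set from \<open>bd\<close>.\<close>
  define e where "e = d x / 2"
  have e: "e > 0" "e < d x" using dx by (auto simp: e_def)
  obtain K where K: "compact K" "K \<subseteq> S" "\<And>x. x \<in> S - K \<Longrightarrow> d x \<le> e"
    using bd[OF e(1)] unfolding d_def by blast
  have cl: "closed K" using K compact_imp_closed by blast
  note DD = weak_poissonD[OF D]
  have hw: "weak_poisson S h (\<lambda>x. norm x powr (- a - 2) * a\<^sup>2)"
    unfolding h_def
    using radial_weak_poisson[OF S _ _ a, of 1 UNIV "\<lambda>_. 1" "\<lambda>_. 0" "\<lambda>_. 0"] by simp
  note hD = weak_poissonD[OF hw]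
  have C1a: "C1_on S (\<lambda>x. norm x powr a)"
    using radial_C1_on(1)[OF S(2), of 1 UNIV "\<lambda>_. 1" "\<lambda>_. 0" a] by simp
  have C1d: "C1_on S d" unfolding d_def by (intro C1_on_mult C1a DD)
  have Dh: "D y = h y * d y" if "y \<in> S" for y
    using pos[OF that] by (simp add: d_def h_def powr_minus)
  define \<psi> where "\<psi> = (\<lambda>y. if y \<in> S then (max 0 (d y - e))\<^sup>2 else 0)"
  have \<psi>0: "\<psi> y = 0" if "y \<notin> K" for y using K(3)[of y] that by (auto simp: \<psi>_def)
  have G\<psi>: "GDERIV \<psi> y :> (2 * max 0 (d y - e)) *\<^sub>R gradient d y" if y: "y \<in> S" for y
  proof -
    have "GDERIV (\<lambda>y. d y - e) y :> gradient d y - 0"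
      by (intro GDERIV_diff GDERIV_const C1_on_GDERIV[OF C1d y])
    then have "GDERIV (\<lambda>y. (max 0 (d y - e))\<^sup>2) y :> (2 * max 0 (d y - e)) *\<^sub>R gradient d y"
      by (intro GDERIV_DERIV_compose[where g = "\<lambda>s. (max 0 s)\<^sup>2" and f = "\<lambda>y. d y - e"] DERIV_pos_part_square) auto
    then show ?thesis by (rule GDERIV_cong_open[OF _ S(1) y]) (simp add: \<psi>_def)
  qed
  have C1\<psi>: "C1_on S \<psi>"
    by (rule C1_onI[OF G\<psi>])
       (auto intro!: continuous_intros C1_on_continuous[OF C1d] C1_on_continuous_gradient[OF C1d])
  \<comment> \<open>The equation of D is tested with \<phi> = h\<psi> and that of h with \<omega> =
    d\<phi>. In the difference of the two the mixed terms cancel and \<open>h^2\<close> times the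
    product of the gradients of d and \<psi> remains, which is nonnegative as \<psi> is a
    nondecreasing function of d.\<close>
  define \<phi> where "\<phi> = (\<lambda>y. h y * \<psi> y)"
  define \<omega> where "\<omega> = (\<lambda>y. d y * \<phi> y)"
  have C1p: "C1_on S \<phi>" unfolding \<phi>_def by (intro C1_on_mult hD C1\<psi>)
  have C1\<omega>: "C1_on S \<omega>" unfolding \<omega>_def by (intro C1_on_mult C1d C1p)
  have \<phi>0: "\<phi> y = 0" and \<omega>0: "\<omega> y = 0" if "y \<notin> K" for y
    using \<psi>0[OF that] by (auto simp: \<phi>_def \<omega>_def)
  have \<phi>: "C1c_on S \<phi>" by (rule C1c_onI[OF C1p K(1,2)]) (rule \<phi>0)
  have \<omega>: "C1c_on S \<omega>" by (rule C1c_onI[OF C1\<omega> K(1,2)]) (rule \<omega>0)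
  have g0: "gradient \<phi> y = 0" "gradient \<omega> y = 0" "gradient \<psi> y = 0" if "y \<notin> K" for y
    by (rule gradient_zero_off(2)[OF cl _ that], rule \<phi>0 \<omega>0 \<psi>0, assumption)+
  have ge: "gradient D y \<bullet> gradient \<phi> y - gradient h y \<bullet> gradient \<omega> y \<ge> 0" for y
  proof (cases "y \<in> K")
    case True
    then have y: "y \<in> S" using K by auto
    have 1: "gradient D y = h y *\<^sub>R gradient d y + d y *\<^sub>R gradient h y"
      by (rule gradient_eq, rule GDERIV_cong_open[OF _ S(1) y],
          rule GDERIV_mult[OF C1_on_GDERIV[OF hD(1) y] C1_on_GDERIV[OF C1d y]])
         (simp add: Dh)
    have 2: "gradient \<omega> y = d y *\<^sub>R gradient \<phi> y + \<phi> y *\<^sub>R gradient d y"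
      unfolding \<omega>_def by (intro gradient_eq GDERIV_mult C1_on_GDERIV[OF C1d y] C1_on_GDERIV[OF C1p y])
    have 3: "gradient \<phi> y = h y *\<^sub>R gradient \<psi> y + \<psi> y *\<^sub>R gradient h y"
      unfolding \<phi>_def by (intro gradient_eq GDERIV_mult C1_on_GDERIV[OF hD(1) y] C1_on_GDERIV[OF C1\<psi> y])
    have 4: "gradient \<psi> y = (2 * max 0 (d y - e)) *\<^sub>R gradient d y"
      by (rule gradient_eq[OF G\<psi>[OF y]])
    have "gradient D y \<bullet> gradient \<phi> y - gradient h y \<bullet> gradient \<omega> y
       = h y * (gradient d y \<bullet> gradient \<phi> y) - \<phi> y * (gradient h y \<bullet> gradient d y)"
      unfolding 1 2 by (simp add: inner_add_left inner_add_right)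
    also have "\<dots> = (h y)\<^sup>2 * (gradient d y \<bullet> gradient \<psi> y)"
      unfolding 3 by (simp add: inner_add_right \<phi>_def power2_eq_square inner_commute algebra_simps)
    also have "\<dots> \<ge> 0" unfolding 4 by simp
    finally show ?thesis .
  qed (simp add: g0)
  note iD = weak_poisson_integrable[OF DD(1,2) \<phi> S(1)]
  note ih = weak_poisson_integrable[OF hD(1,2) \<omega> S(1)]
  \<comment> \<open>The two equations give F a nonpositive integral, while \<open>strict\<close>
    makes F positive wherever d > e and F = 0 elsewhere. So F vanishes identically, contrary to d(x)
    > e.\<close>
  define F where "F = (\<lambda>y. norm y powr (- a - 2) * a\<^sup>2 * \<omega> y - \<beta> y * \<phi> y)"
  have "(LINT y|lborel. gradient h y \<bullet> gradient \<omega> y) \<le> (LINT y|lborel. gradient D y \<bullet> gradient \<phi> y)"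
    by (rule integral_mono[OF ih(1) iD(1)]) (use ge in \<open>simp add: le_diff_eq\<close>)
  then have "(LINT y|lborel. \<beta> y * \<phi> y) - (LINT y|lborel. norm y powr (- a - 2) * a\<^sup>2 * \<omega> y) \<ge> 0"
    using DD(3)[OF \<phi>] hD(3)[OF \<omega>] by simp
  then have int: "(LINT y|lborel. F y) \<le> 0"
    unfolding F_def using iD(2) ih(2) by simp
  have F: "F y = (a\<^sup>2 / (norm y)\<^sup>2 * D y - \<beta> y) * \<phi> y" if "y \<in> S" for y
  proof -
    have "norm y powr (- a - 2) * d y = D y / (norm y)\<^sup>2"
      using pos[OF that] unfolding Dh[OF that] h_def by (simp add: powr_diff)
    moreover have "norm y powr (- a - 2) * a\<^sup>2 * \<omega> y = a\<^sup>2 * (norm y powr (- a - 2) * d y) * \<phi> y"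
      by (simp add: \<omega>_def)
    ultimately have "norm y powr (- a - 2) * a\<^sup>2 * \<omega> y = a\<^sup>2 * (D y / (norm y)\<^sup>2) * \<phi> y"
      by simp
    then show ?thesis by (simp add: F_def left_diff_distrib)
  qed
  have \<phi>pos: "\<phi> y > 0" if "y \<in> S" "d y > e" for y
    using that pos[of y] by (auto simp: \<phi>_def \<psi>_def h_def)
  have Dpos: "D y > 0" if "y \<in> S" "d y > e" for y
  proof (rule zero_less_mult_pos[of "norm y powr a"])
    show "0 < norm y powr a * D y" using that(2) e(1) by (simp add: d_def)
  qed (use pos[OF that(1)] in simp)
  have Fpos: "F y > 0" if "y \<in> S" "d y > e" for y
    unfolding F[OF that(1)] using strict[OF that(1) Dpos[OF that]] \<phi>pos[OF that] by simp
  have Fnn: "F y \<ge> 0" for y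
  proof (cases "y \<in> S \<and> d y > e")
    case False
    then have "\<psi> y = 0" by (auto simp: \<psi>_def)
    then show ?thesis by (simp add: F_def \<omega>_def \<phi>_def)
  qed (use Fpos in force)
  have cF: "continuous_on UNIV F"
  proof (rule continuous_on_zero_extension[OF S(1) _ cl K(2)])
    show "continuous_on S F" unfolding F_def
      by (intro continuous_intros C1_on_continuous C1\<omega> C1p DD) (use S in auto)
    show "F y = 0" if "y \<notin> K" for y using \<phi>0[OF that] \<omega>0[OF that] by (simp add: F_def)
  qed
  have "F x = 0"
    by (rule nonneg_integral_zero[OF cF Fnn K(1) _ int]) (use \<phi>0 \<omega>0 in \<open>simp add: F_def\<close>)
  then show False using Fpos[OF x e(2)] by simp
qed

lemma weak_poisson_cong:
  assumes w: "weak_poisson S u \<beta>" and S: "open S"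
    and eq: "\<And>x. x \<in> S \<Longrightarrow> u x = u' x" "\<And>x. x \<in> S \<Longrightarrow> \<beta> x = \<beta>' x"
  shows "weak_poisson S u' \<beta>'"
  unfolding weak_poisson_def
proof (intro conjI allI impI)
  note D = weak_poissonD[OF w]
  show "C1_on S u'" by (rule C1_on_cong[OF D(1) S eq(1)])
  show "continuous_on S \<beta>'" using D(2) eq(2) by (subst continuous_on_cong[where g = \<beta>]) auto
  fix \<phi> :: "'a \<Rightarrow> real" assume \<phi>: "C1c_on S \<phi>"
  obtain K where K: "C1_on S \<phi>" "compact K" "K \<subseteq> S" "\<And>x. x \<notin> K \<Longrightarrow> \<phi> x = 0"
    by (rule C1c_onE[OF \<phi>]) blast
  have grad0: "gradient \<phi> x = 0" if "x \<notin> K" for x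
    by (rule gradient_zero_off(2)[OF compact_imp_closed[OF K(2)] _ that]) (rule K(4))
  have "gradient u' x \<bullet> gradient \<phi> x = gradient u x \<bullet> gradient \<phi> x" for x
  proof (cases "x \<in> K")
    case True
    then show ?thesis using gradient_cong[OF D(1) S eq(1), of x] K(3) by auto
  qed (simp add: grad0)
  then have 1: "(\<lambda>x. gradient u' x \<bullet> gradient \<phi> x) = (\<lambda>x. gradient u x \<bullet> gradient \<phi> x)" by (rule ext)
  have "\<beta>' x * \<phi> x = \<beta> x * \<phi> x" for x
    using K(3,4) eq(2)[of x] by (cases "x \<in> K") auto
  then have 2: "(\<lambda>x. \<beta>' x * \<phi> x) = (\<lambda>x. \<beta> x * \<phi> x)" by (rule ext)
  show "(LINT x|lborel. gradient u' x \<bullet> gradient \<phi> x) = (LINT x|lborel. \<beta>' x * \<phi> x)"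
    unfolding 1 2 by (rule D(3)[OF \<phi>])
qed

section \<open>Inequalities for real powers\<close>

lemma powr_ge_tangent:
  fixes y q :: real
  assumes "y > 0" "q > 1"
  shows "1 + q * (y - 1) \<le> y powr q"
proof -
  have *: "((\<lambda>t. t powr q - (1 + q * (t - 1))) has_real_derivative q * (t powr (q - 1) - 1)) (at t)"
    if "t > 0" for t
    using that by (auto intro!: derivative_eq_intros simp: powr_diff field_simps)
  let ?f = "\<lambda>t. t powr q - (1 + q * (t - 1))"
  have "?f 1 \<le> ?f y"
  proof (cases "y \<ge> 1")
    case True
    show ?thesis
    proof (rule DERIV_nonneg_imp_nondecreasing[OF True])
      fix t assume t: "1 \<le> t" "t \<le> y"
      then have "1 \<le> t powr (q - 1)" using assms by (intro ge_one_powr_ge_zero) auto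
      with t show "\<exists>d. (?f has_real_derivative d) (at t) \<and> 0 \<le> d"
        using assms by (intro exI[of _ "q * (t powr (q - 1) - 1)"] conjI *) auto
    qed
  next
    case False
    then have y: "y \<le> 1" by simp
    show ?thesis
    proof (rule DERIV_nonpos_imp_nonincreasing[OF y])
      fix t assume t: "y \<le> t" "t \<le> 1"
      then have "t powr (q - 1) \<le> 1 powr (q - 1)" using assms by (intro powr_mono2) auto
      then show "\<exists>d. (?f has_real_derivative d) (at t) \<and> d \<le> 0"
        using assms t by (intro exI[of _ "q * (t powr (q - 1) - 1)"] conjI *) (auto intro: mult_nonneg_nonpos)
    qed
  qed
  then show ?thesis by simp
qed

text \<open>Two lower bounds for (1+b)^q - (1+b) are averaged: superadditivity gives b^q - b,
  Bernoulli gives (q-1) b. The weights (q-1)/q and 1/q are those for which the linear terms cancel.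
  The result shows how fast a supersolution of the form 1 + b may blow up.\<close>

lemma powr_growth:
  fixes b q :: real
  assumes "b > 0" "q > 1"
  shows "(q - 1) / q * b powr q \<le> (1 + b) powr q - (1 + b)"
proof -
  have 1: "1 + q * b \<le> (1 + b) powr q" using powr_ge_tangent[of "1 + b" q] assms by simp
  have p: "y * y powr (q - 1) = y powr q" if "y > 0" for y :: real
    using that powr_add[of y 1 "q - 1"] by simp
  have "b powr (q - 1) \<le> (1 + b) powr (q - 1)" using assms by (intro powr_mono2) auto
  then have "b * b powr (q - 1) \<le> b * (1 + b) powr (q - 1)" using assms by (intro mult_left_mono) auto
  moreover have "1 \<le> (1 + b) powr (q - 1)" using assms by (intro ge_one_powr_ge_zero) auto
  moreover have "(1 + b) powr q = (1 + b) powr (q - 1) + b * (1 + b) powr (q - 1)"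
    using p[of "1 + b"] assms by (simp add: algebra_simps)
  ultimately have 2: "1 + b powr q \<le> (1 + b) powr q" using p[of b] assms by simp
  let ?P = "(1 + b) powr q"
  define \<alpha> where "\<alpha> = (q - 1) / q"
  have \<alpha>: "0 \<le> \<alpha>" "0 \<le> 1 - \<alpha>" "(1 - \<alpha>) * ((q - 1) * b) = \<alpha> * b"
    using assms by (auto simp: \<alpha>_def field_simps)
  have "\<alpha> * b powr q = \<alpha> * (b powr q - b) + (1 - \<alpha>) * ((q - 1) * b)"
    unfolding \<alpha>(3) by (simp add: algebra_simps)
  also have "\<dots> \<le> \<alpha> * (?P - (1 + b)) + (1 - \<alpha>) * (?P - (1 + b))"
    using 1 2 \<alpha> by (intro add_mono mult_left_mono) (auto simp: algebra_simps)
  also have "\<dots> = ?P - (1 + b)" by (simp add: algebra_simps)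
  finally show ?thesis unfolding \<alpha>_def .
qed

subsection \<open>The equation in Emden-Fowler coordinates\<close>

text \<open>\<open>\<epsilon> = 1\<close> is Case \<open>M\<^sub>2\<close> and \<open>\<epsilon> = -1\<close> is Case \<open>M\<^sub>1\<close>.  In the variables \<open>s = \<epsilon> ln |x|\<close> and \<open>w = u/U\<close>, where \<open>U\<close>
  is the explicit solution, both cases lead to the same equation: for radial \<open>w\<close> it reads
  \<open>w'' - 2 \<nu> w' + \<ell> (w - w\<^sup>q) = 0\<close>.\<close>

locale emden =
  fixes X :: "'a::euclidean_space itself" and q lam \<theta> \<epsilon> a \<mu> \<nu> ell :: real
  assumes q: "q > 1" and \<epsilon>: "\<epsilon> = 1 \<or> \<epsilon> = -1"
    and dim: "DIM('a) \<ge> 2" and a: "a = (real DIM('a) - 2) / 2"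
    and \<mu>: "\<mu> \<ge> 0" "\<mu>\<^sup>2 = a\<^sup>2 - lam" and \<nu>: "\<nu> > \<mu>"
    and \<theta>: "\<theta> + 2 = (q - 1) * (a + \<epsilon> * \<nu>)" and ell: "ell = \<nu>\<^sup>2 - \<mu>\<^sup>2"
begin

definition c where "c = ell powr (1 / (q - 1))"
definition U :: "'a \<Rightarrow> real" where "U x = c * norm x powr (- (a + \<epsilon> * \<nu>))"
definition s :: "'a \<Rightarrow> real" where "s x = \<epsilon> * ln (norm x)"
definition shell :: "real set \<Rightarrow> 'a set" where "shell I = {x. x \<noteq> 0 \<and> s x \<in> I}"

definition sol :: "('a \<Rightarrow> real) \<Rightarrow> bool" where
  "sol u \<longleftrightarrow> (\<forall>x. x \<noteq> 0 \<longrightarrow> 0 < u x) \<and>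
     weak_poisson (- {0}) u (\<lambda>x. lam / (norm x)\<^sup>2 * u x - norm x powr \<theta> * u x powr q)"

lemma \<epsilon>\<epsilon>: "\<epsilon> * \<epsilon> = 1" using \<epsilon> by auto
lemma \<nu>pos: "\<nu> > 0" using \<mu> \<nu> by simp
lemma ellpos: "ell > 0"
proof -
  have "\<mu>\<^sup>2 < \<nu>\<^sup>2" using \<mu>(1) \<nu> by (intro power_strict_mono) auto
  then show ?thesis using ell by simp
qed
lemma cpos: "c > 0" unfolding c_def using ellpos by simp
lemma c_powr: "c powr (q - 1) = ell" unfolding c_def using q ellpos by (simp add: powr_powr)
lemma U_pos: "x \<noteq> 0 \<Longrightarrow> U x > 0" unfolding U_def using cpos by simp

lemma U_eq: "x \<noteq> 0 \<Longrightarrow> U x = norm x powr (- a) * (c * exp (- \<nu> * s x))"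
  unfolding U_def s_def by (simp add: powr_def exp_add[symmetric] algebra_simps)

lemma norm_powr_U: "x \<noteq> 0 \<Longrightarrow> norm x powr a * U x = c * exp (- \<nu> * s x)"
  by (simp add: U_eq powr_minus)

text \<open>The exponent of \<open>U\<close> and the constant \<open>c\<close> are chosen for this
  identity: in terms of w = u/U the nonlinear term carries the same factor \<open>U/|x|^2\<close> as
  the linear one, so the equation for w becomes autonomous in s.\<close>

lemma U_power:
  assumes "x \<noteq> 0" "w \<ge> 0"
  shows "norm x powr \<theta> * (U x * w) powr q = ell / (norm x)\<^sup>2 * U x * w powr q"
proof -
  have "c powr q = c * ell" using c_powr cpos powr_add[of c 1 "q - 1"] by simp
  moreover have e: "\<theta> + - (a + \<epsilon> * \<nu>) * q = - 2 + - (a + \<epsilon> * \<nu>)" using \<theta> by (simp add: algebra_simps)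
  have "norm x powr \<theta> * (norm x powr (- (a + \<epsilon> * \<nu>))) powr q = norm x powr (- 2 + - (a + \<epsilon> * \<nu>))"
    unfolding powr_powr powr_add[symmetric] e ..
  then have "norm x powr \<theta> * (norm x powr (- (a + \<epsilon> * \<nu>))) powr q = norm x powr (- (a + \<epsilon> * \<nu>)) / (norm x)\<^sup>2"
    unfolding powr_add using assms by (simp add: powr_minus divide_inverse)
  ultimately show ?thesis
    using assms cpos by (simp add: U_def powr_mult mult_ac)
qed

lemma norm_s: "x \<noteq> 0 \<Longrightarrow> norm x = exp (\<epsilon> * s x)"
  unfolding s_def using \<epsilon>\<epsilon> by (simp add: mult.assoc[symmetric])

lemma ex_s: "\<exists>x. x \<noteq> 0 \<and> s x = t"
proof -
  obtain e :: 'a where "norm e = 1" using vector_choose_size[of 1] by auto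
  then show ?thesis using \<epsilon>\<epsilon>
    by (intro exI[of _ "exp (\<epsilon> * t) *\<^sub>R e"]) (auto simp: s_def mult.assoc[symmetric])
qed

lemma continuous_s: "continuous_on (- {0}) s"
  unfolding s_def by (intro continuous_intros) auto

lemma open_shell: "open I \<Longrightarrow> open (shell I)"
proof -
  assume "open I"
  then have "open (- {0} \<inter> s -` I)"
    by (intro continuous_open_preimage continuous_s open_Compl closed_singleton)
  moreover have "- {0} \<inter> s -` I = shell I" unfolding shell_def by auto
  ultimately show ?thesis by simp
qed

lemma compact_shell: "compact (shell {l..r})"
proof -
  have "shell {l..r} = {x. exp (if \<epsilon> = 1 then l else - r) \<le> norm x} \<inter> cball 0 (exp (if \<epsilon> = 1 then r else - l))"
    (is "?A = ?B")
  proof (intro set_eqI iffI)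
    fix x assume "x \<in> ?A"
    then show "x \<in> ?B" using \<epsilon> norm_s[of x] by (auto simp: shell_def)
  next
    fix x assume x: "x \<in> ?B"
    then have "norm x > 0" using exp_gt_zero less_le_trans by blast
    then show "x \<in> ?A" using x \<epsilon> norm_s[of x] by (auto simp: shell_def)
  qed
  moreover have "closed {x::'a. exp (if \<epsilon> = 1 then l else - r) \<le> norm x}"
    by (intro closed_Collect_le continuous_intros)
  ultimately show ?thesis using closed_Int_compact compact_cball by metis
qed

lemma solD:
  assumes "sol u"
  shows "x \<noteq> 0 \<Longrightarrow> 0 < u x"
    and "weak_poisson (- {0}) u (\<lambda>x. lam / (norm x)\<^sup>2 * u x - norm x powr \<theta> * u x powr q)"
    and "continuous_on (- {0}) u"
  using assms C1_on_continuous weak_poissonD(1) unfolding sol_def by blast+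

definition ratio :: "('a \<Rightarrow> real) \<Rightarrow> 'a \<Rightarrow> real" where "ratio u x = u x / U x"

lemma ratio_eq: "x \<noteq> 0 \<Longrightarrow> u x = U x * ratio u x"
  unfolding ratio_def using U_pos[of x] by simp

lemma sol_rhs:
  assumes "sol u" "x \<noteq> 0"
  shows "lam / (norm x)\<^sup>2 * u x - norm x powr \<theta> * u x powr q
    = U x / (norm x)\<^sup>2 * (lam * ratio u x - ell * ratio u x powr q)"
proof -
  have "ratio u x \<ge> 0" unfolding ratio_def using solD(1)[OF assms] U_pos[OF assms(2)] by simp
  from U_power[OF assms(2) this] ratio_eq[OF assms(2), of u]
  have "norm x powr \<theta> * u x powr q = U x / (norm x)\<^sup>2 * (ell * ratio u x powr q)" by simp
  moreover have "lam / (norm x)\<^sup>2 * u x = U x / (norm x)\<^sup>2 * (lam * ratio u x)"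
    by (subst ratio_eq[OF assms(2), of u]) simp
  ultimately show ?thesis by (simp only: right_diff_distrib)
qed

definition profile :: "real set \<Rightarrow> (real \<Rightarrow> real) \<Rightarrow> (real \<Rightarrow> real) \<Rightarrow> (real \<Rightarrow> real) \<Rightarrow> bool" where
  "profile I W W1 W2 \<longleftrightarrow> open I \<and> continuous_on I W2 \<and>
     (\<forall>t\<in>I. 0 < W t \<and> (W has_real_derivative W1 t) (at t) \<and> (W1 has_real_derivative W2 t) (at t))"

text \<open>\<open>U W(s)\<close> equals \<open>|x|^(-a) Z(s)\<close> with
  \<open>Z = c exp (- \<nu> t) W\<close>, so the radial formula applies to Z; the exponential factor
  turns Z'' into W'' - 2\<nu> W' + \<nu>^2 W.\<close>

lemma profile_weak_poisson:
  assumes "profile I W W1 W2"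
  shows "weak_poisson (shell I) (\<lambda>x. U x * W (s x))
    (\<lambda>x. U x / (norm x)\<^sup>2 * (a\<^sup>2 * W (s x) - (W2 (s x) - 2 * \<nu> * W1 (s x) + \<nu>\<^sup>2 * W (s x))))"
proof -
  have I: "open I" "continuous_on I W2"
    and W: "\<And>t. t \<in> I \<Longrightarrow> (W has_real_derivative W1 t) (at t)"
    and W1: "\<And>t. t \<in> I \<Longrightarrow> (W1 has_real_derivative W2 t) (at t)"
    using assms unfolding profile_def by auto
  have cW: "continuous_on I W" "continuous_on I W1"
    using W W1 DERIV_isCont continuous_at_imp_continuous_on by blast+
  define Z where "Z = (\<lambda>t. c * exp (- \<nu> * t) * W t)"
  define Z1 where "Z1 = (\<lambda>t. c * exp (- \<nu> * t) * (W1 t - \<nu> * W t))"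
  define Z2 where "Z2 = (\<lambda>t. c * exp (- \<nu> * t) * (W2 t - 2 * \<nu> * W1 t + \<nu>\<^sup>2 * W t))"
  have "weak_poisson (shell I) (\<lambda>x. norm x powr (- a) * Z (\<epsilon> * ln (norm x)))
     (\<lambda>x. norm x powr (- a - 2) * (a\<^sup>2 * Z (\<epsilon> * ln (norm x)) - Z2 (\<epsilon> * ln (norm x))))"
  proof (rule radial_weak_poisson[OF open_shell[OF I(1)] _ _ \<epsilon>\<epsilon> a, where I = I and ?Z1.0 = Z1])
    fix t assume t: "t \<in> I"
    show "(Z has_real_derivative Z1 t) (at t)"
      unfolding Z_def Z1_def by (auto intro!: derivative_eq_intros W[OF t] simp: algebra_simps)
    show "(Z1 has_real_derivative Z2 t) (at t)"
      unfolding Z1_def Z2_def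
      by (auto intro!: derivative_eq_intros W[OF t] W1[OF t] simp: algebra_simps power2_eq_square)
  next
    show "continuous_on I Z2" unfolding Z2_def by (intro continuous_intros cW I)
  qed (auto simp: shell_def s_def)
  then show ?thesis
  proof (rule weak_poisson_cong[OF _ open_shell[OF I(1)]])
    fix x assume "x \<in> shell I"
    then have x: "x \<noteq> 0" by (simp add: shell_def)
    have sx: "\<epsilon> * ln (norm x) = s x" by (simp add: s_def)
    show "norm x powr (- a) * Z (\<epsilon> * ln (norm x)) = U x * W (s x)"
      unfolding sx Z_def U_eq[OF x] by simp
    have "norm x powr (- a - 2) = norm x powr (- a) / (norm x)\<^sup>2" using x by (simp add: powr_diff)
    then show "norm x powr (- a - 2) * (a\<^sup>2 * Z (\<epsilon> * ln (norm x)) - Z2 (\<epsilon> * ln (norm x)))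
      = U x / (norm x)\<^sup>2 * (a\<^sup>2 * W (s x) - (W2 (s x) - 2 * \<nu> * W1 (s x) + \<nu>\<^sup>2 * W (s x)))"
      unfolding sx Z_def Z2_def U_eq[OF x] by (simp add: algebra_simps diff_divide_distrib add_divide_distrib)
  qed
qed

section \<open>Comparison of solutions with radial sub- and supersolutions\<close>

text \<open>Where u exceeds U W, strict monotonicity of w^q yields the strict inequality required by
  \<open>hardy_comparison\<close>; the linear terms contribute only \<mu>^2 (w - W), which has the
  good sign.\<close>

lemma comparison_above:
  assumes u: "sol u" and W: "profile I W W1 W2"
    and super: "\<And>t. t \<in> I \<Longrightarrow> W2 t - 2 * \<nu> * W1 t + ell * (W t - W t powr q) \<le> 0"
    and bd: "\<And>e. e > 0 \<Longrightarrow> \<exists>K. compact K \<and> K \<subseteq> shell I \<and>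
      (\<forall>x\<in>shell I - K. norm x powr a * (u x - U x * W (s x)) \<le> e)"
    and x: "x \<in> shell I"
  shows "u x \<le> U x * W (s x)"
proof -
  have op: "open (shell I)" using W open_shell unfolding profile_def by blast
  have sub: "shell I \<subseteq> - {0}" by (auto simp: shell_def)
  have "u x - U x * W (s x) \<le> 0"
  proof (rule hardy_comparison[OF op _ a weak_poisson_diff[OF
        weak_poisson_subset[OF solD(2)[OF u] op sub] profile_weak_poisson[OF W] op] _ bd x])
    show "0 \<notin> shell I" by (simp add: shell_def)
    fix x assume x: "x \<in> shell I" and pos: "u x - U x * W (s x) > 0"
    have x0: "x \<noteq> 0" and t: "s x \<in> I" using x by (auto simp: shell_def)
    let ?w = "ratio u x" and ?W = "W (s x)" and ?k = "U x / (norm x)\<^sup>2"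
    have k: "?k > 0" using U_pos[OF x0] x0 by simp
    have W0: "0 < ?W" using W t unfolding profile_def by blast
    have w: "?W < ?w" using pos U_pos[OF x0] ratio_eq[OF x0, of u] by (simp add: mult_less_cancel_left_pos)
    have "?W powr q < ?w powr q" using w W0 q by (intro powr_less_mono2) auto
    then have 1: "ell * ?W powr q < ell * ?w powr q" using ellpos by simp
    \<comment> \<open>Here \<lambda> <= \<lambda>_H enters, through \<mu>^2 = a^2 - \<lambda> >=
      0.\<close>
    have 2: "\<mu>\<^sup>2 * ?W \<le> \<mu>\<^sup>2 * ?w" using w by (intro mult_left_mono) auto
    have 3: "ell * ?W = \<nu>\<^sup>2 * ?W - \<mu>\<^sup>2 * ?W" and 4: "\<mu>\<^sup>2 * ?w = a\<^sup>2 * ?w - lam * ?w"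
      unfolding \<mu>(2) ell by (simp_all add: algebra_simps)
    have "lam * ?w - ell * ?w powr q - (a\<^sup>2 * ?W - (W2 (s x) - 2 * \<nu> * W1 (s x) + \<nu>\<^sup>2 * ?W))
       < a\<^sup>2 * (?w - ?W)"
      using super[OF t] 1 2 3 4 by (simp add: right_diff_distrib)
    then have "?k * (lam * ?w - ell * ?w powr q) - ?k * (a\<^sup>2 * ?W - (W2 (s x) - 2 * \<nu> * W1 (s x) + \<nu>\<^sup>2 * ?W))
       < ?k * (a\<^sup>2 * (?w - ?W))"
      unfolding right_diff_distrib[symmetric] using k by (simp only: mult_less_cancel_left_pos)
    moreover have "?k * (a\<^sup>2 * (?w - ?W)) = a\<^sup>2 / (norm x)\<^sup>2 * (u x - U x * ?W)"
      by (simp only: ratio_eq[OF x0, of u] right_diff_distrib[symmetric]) simp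
    ultimately show "lam / (norm x)\<^sup>2 * u x - norm x powr \<theta> * u x powr q
        - ?k * (a\<^sup>2 * ?W - (W2 (s x) - 2 * \<nu> * W1 (s x) + \<nu>\<^sup>2 * ?W)) < a\<^sup>2 / (norm x)\<^sup>2 * (u x - U x * ?W)"
      unfolding sol_rhs[OF u x0] by (simp only:)
  qed
  then show ?thesis by simp
qed

lemma comparison_below:
  assumes u: "sol u" and W: "profile I W W1 W2"
    and sub: "\<And>t. t \<in> I \<Longrightarrow> W2 t - 2 * \<nu> * W1 t + ell * (W t - W t powr q) \<ge> 0"
    and bd: "\<And>e. e > 0 \<Longrightarrow> \<exists>K. compact K \<and> K \<subseteq> shell I \<and>
      (\<forall>x\<in>shell I - K. norm x powr a * (U x * W (s x) - u x) \<le> e)"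
    and x: "x \<in> shell I"
  shows "U x * W (s x) \<le> u x"
proof -
  have op: "open (shell I)" using W open_shell unfolding profile_def by blast
  have sub0: "shell I \<subseteq> - {0}" by (auto simp: shell_def)
  have "U x * W (s x) - u x \<le> 0"
  proof (rule hardy_comparison[OF op _ a weak_poisson_diff[OF
        profile_weak_poisson[OF W] weak_poisson_subset[OF solD(2)[OF u] op sub0] op] _ bd x])
    show "0 \<notin> shell I" by (simp add: shell_def)
    fix x assume x: "x \<in> shell I" and pos: "U x * W (s x) - u x > 0"
    have x0: "x \<noteq> 0" and t: "s x \<in> I" using x by (auto simp: shell_def)
    let ?w = "ratio u x" and ?W = "W (s x)" and ?k = "U x / (norm x)\<^sup>2"
    have k: "?k > 0" using U_pos[OF x0] x0 by simp
    have w0: "0 < ?w" using solD(1)[OF u x0] U_pos[OF x0] by (simp add: ratio_def)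
    have w: "?w < ?W" using pos U_pos[OF x0] ratio_eq[OF x0, of u] by (simp add: mult_less_cancel_left_pos)
    have "?w powr q < ?W powr q" using w w0 q by (intro powr_less_mono2) auto
    then have 1: "ell * ?w powr q < ell * ?W powr q" using ellpos by simp
    have 2: "\<mu>\<^sup>2 * ?w \<le> \<mu>\<^sup>2 * ?W" using w by (intro mult_left_mono) auto
    have 3: "ell * ?W = \<nu>\<^sup>2 * ?W - \<mu>\<^sup>2 * ?W" and 4: "\<mu>\<^sup>2 * ?w = a\<^sup>2 * ?w - lam * ?w"
      unfolding \<mu>(2) ell by (simp_all add: algebra_simps)
    have "(a\<^sup>2 * ?W - (W2 (s x) - 2 * \<nu> * W1 (s x) + \<nu>\<^sup>2 * ?W)) - (lam * ?w - ell * ?w powr q)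
       < a\<^sup>2 * (?W - ?w)"
      using sub[OF t] 1 2 3 4 by (simp add: right_diff_distrib)
    then have "?k * (a\<^sup>2 * ?W - (W2 (s x) - 2 * \<nu> * W1 (s x) + \<nu>\<^sup>2 * ?W)) - ?k * (lam * ?w - ell * ?w powr q)
       < ?k * (a\<^sup>2 * (?W - ?w))"
      unfolding right_diff_distrib[symmetric] using k by (simp only: mult_less_cancel_left_pos)
    moreover have "?k * (a\<^sup>2 * (?W - ?w)) = a\<^sup>2 / (norm x)\<^sup>2 * (U x * ?W - u x)"
      by (simp only: ratio_eq[OF x0, of u] right_diff_distrib[symmetric]) simp
    ultimately show "?k * (a\<^sup>2 * ?W - (W2 (s x) - 2 * \<nu> * W1 (s x) + \<nu>\<^sup>2 * ?W))
       - (lam / (norm x)\<^sup>2 * u x - norm x powr \<theta> * u x powr q) < a\<^sup>2 / (norm x)\<^sup>2 * (U x * ?W - u x)"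
      unfolding sol_rhs[OF u x0] by (simp only:)
  qed
  then show ?thesis by simp
qed

lemma profile_sol:
  assumes W: "profile UNIV W W1 W2"
    and ode: "\<And>t. W2 t - 2 * \<nu> * W1 t + ell * (W t - W t powr q) = 0"
  shows "sol (\<lambda>x. U x * W (s x))"
  unfolding sol_def
proof (intro conjI allI impI)
  have Wpos: "W t > 0" for t using W unfolding profile_def by blast
  show "0 < U x * W (s x)" if "x \<noteq> 0" for x using U_pos[OF that] Wpos by simp
  have sh: "shell UNIV = - {0}" by (auto simp: shell_def)
  have op: "open (- {0::'a})" by (intro open_Compl closed_singleton)
  show "weak_poisson (- {0}) (\<lambda>x. U x * W (s x))
     (\<lambda>x. lam / (norm x)\<^sup>2 * (U x * W (s x)) - norm x powr \<theta> * (U x * W (s x)) powr q)"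
  proof (rule weak_poisson_cong[OF profile_weak_poisson[OF W, unfolded sh] op refl])
    fix x :: 'a assume "x \<in> - {0}"
    then have x: "x \<noteq> 0" by simp
    have "a\<^sup>2 * W (s x) - (W2 (s x) - 2 * \<nu> * W1 (s x) + \<nu>\<^sup>2 * W (s x))
        = lam * W (s x) - ell * W (s x) powr q"
      using ode[of "s x"] arg_cong[OF \<mu>(2), of "\<lambda>z. z * W (s x)"] unfolding ell
      by (simp add: algebra_simps)
    then show "U x / (norm x)\<^sup>2 * (a\<^sup>2 * W (s x) - (W2 (s x) - 2 * \<nu> * W1 (s x) + \<nu>\<^sup>2 * W (s x)))
      = lam / (norm x)\<^sup>2 * (U x * W (s x)) - norm x powr \<theta> * (U x * W (s x)) powr q"
      unfolding U_power[OF x less_imp_le[OF Wpos]] by (simp add: right_diff_distrib mult_ac)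
  qed
qed

lemma U_sol: "sol U"
  using profile_sol[of "\<lambda>_. 1" "\<lambda>_. 0" "\<lambda>_. 0"] by (simp add: profile_def)

text \<open>A supersolution on \<open>(t\<^sub>0 - R, t\<^sub>0 + R)\<close> that blows up at both ends and tends to \<open>1\<close> as \<open>R \<rightarrow> \<infinity>\<close>.\<close>

lemma blow_up_bound:
  assumes u: "sol u" and x0: "x0 \<noteq> 0" and R: "R \<ge> 1"
  shows "u x0 \<le> U x0 * (1 + (((2 + 4 * (2 / (q - 1) + 1) + 4 * \<nu>) * (2 / (q - 1)))
     / (R * ell * ((q - 1) / q))) powr (1 / (q - 1)))"
proof -
  \<comment> \<open>The blow-up exponent satisfies kq = k + 2, so that the power q of \<rho>^(-k)
    matches the \<rho>^(-k-2) of the second derivative. \<open>C / R\<close> collects the bounds 2k,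
    4k(k+1) and 4\<nu>k for the three derivative terms, and \<open>K\<close> solves K C/R = ell
    ((q-1)/q) K^q; it tends to 0 as R grows.\<close>
  define k where "k = 2 / (q - 1)"
  define C where "C = (2 + 4 * (k + 1) + 4 * \<nu>) * k"
  define K where "K = (C / (R * ell * ((q - 1) / q))) powr (1 / (q - 1))"
  define t0 where "t0 = s x0"
  define \<rho> where "\<rho> = (\<lambda>t. 1 - ((t - t0) / R)\<^sup>2)"
  define \<kappa> where "\<kappa> = 1 / R\<^sup>2"
  have \<kappa>: "0 < \<kappa>" "\<kappa> * R = 1 / R" "\<kappa> \<le> 1 / R" "1 / R > 0"
    using R by (auto simp: \<kappa>_def power2_eq_square field_simps)
  define I where "I = {t0 - R <..< t0 + R}"
  define W where "W = (\<lambda>t. 1 + K * \<rho> t powr (- k))"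
  define W1 where "W1 = (\<lambda>t. K * (2 * k * \<kappa> * (t - t0) * \<rho> t powr (- k - 1)))"
  define W2 where "W2 = (\<lambda>t. K * (2 * k * \<kappa> * \<rho> t powr (- k - 1)
      + 4 * k * (k + 1) * (\<kappa> * (t - t0))\<^sup>2 * \<rho> t powr (- k - 2)))"
  have k: "k > 0" "k * q = k + 2" using q by (auto simp: k_def field_simps)
  have Cpos: "C > 0" unfolding C_def using k \<nu>pos by (intro mult_pos_pos add_pos_pos) auto
  then have Kpos: "K > 0" unfolding K_def using ellpos R q by simp
  have Kq: "K powr (q - 1) = C / (R * ell * ((q - 1) / q))"
    unfolding K_def using q Cpos ellpos R by (simp add: powr_powr)
  have \<rho>: "0 < \<rho> t" "\<rho> t \<le> 1" "\<bar>t - t0\<bar> < R" if "t \<in> I" for t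
  proof -
    show *: "\<bar>t - t0\<bar> < R" using that by (auto simp: I_def)
    then have "\<bar>(t - t0) / R\<bar> < 1" using R by (simp add: abs_divide)
    then show "0 < \<rho> t" unfolding \<rho>_def by (simp add: abs_square_less_1)
    show "\<rho> t \<le> 1" unfolding \<rho>_def by simp
  qed
  have d\<rho>: "(\<rho> has_real_derivative - (2 * \<kappa> * (t - t0))) (at t)" for t
    unfolding \<rho>_def \<kappa>_def using R by (auto intro!: derivative_eq_intros simp: power2_eq_square field_simps)
  have dp: "((\<lambda>t. \<rho> t powr b) has_real_derivative (b * \<rho> t powr (b - 1) * - (2 * \<kappa> * (t - t0)))) (at t)"
    if "t \<in> I" for b t
    by (rule DERIV_chain2[where f = "\<lambda>z. z powr b" and g = \<rho>, OF has_real_derivative_powr[OF \<rho>(1)[OF that]] d\<rho>])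
  have prof: "profile I W W1 W2"
    unfolding profile_def
  proof (intro conjI ballI)
    show "open I" by (simp add: I_def)
    have "continuous_on I \<rho>" unfolding \<rho>_def by (intro continuous_intros) (use R in auto)
    then show "continuous_on I W2" unfolding W2_def
      using \<rho>(1) by (intro continuous_intros) force+
    fix t assume t: "t \<in> I"
    show "0 < W t" unfolding W_def using Kpos by (simp add: add_pos_nonneg)
    show "(W has_real_derivative W1 t) (at t)"
      unfolding W_def W1_def
      by (rule DERIV_cong[OF DERIV_add[OF DERIV_const DERIV_cmult[OF dp[OF t]]]])
         (simp add: algebra_simps)
    have lin: "((\<lambda>t. 2 * k * \<kappa> * (t - t0)) has_real_derivative 2 * k * \<kappa>) (at t)"
      by (auto intro!: derivative_eq_intros)
    show "(W1 has_real_derivative W2 t) (at t)"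
      unfolding W1_def W2_def
      by (rule DERIV_cong[OF DERIV_cmult[OF DERIV_mult[OF lin dp[OF t]]]])
         (simp add: power2_eq_square algebra_simps)
  qed
  have super: "W2 t - 2 * \<nu> * W1 t + ell * (W t - W t powr q) \<le> 0" if t: "t \<in> I" for t
  proof -
    let ?p = "\<rho> t powr (- k - 2)" and ?\<tau> = "t - t0"
    have p1: "\<rho> t powr (- k - 1) \<le> ?p" using \<rho>[OF t] by (intro powr_mono') auto
    have a1: "2 * k * \<kappa> * \<rho> t powr (- k - 1) \<le> 2 * k * (1 / R) * ?p"
      using p1 k \<kappa> by (intro mult_mono) auto
    have \<tau>: "\<kappa> * \<bar>?\<tau>\<bar> \<le> 1 / R"
      using \<rho>(3)[OF t] \<kappa> mult_left_mono[of "\<bar>?\<tau>\<bar>" R \<kappa>] by simp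
    have "(\<kappa> * ?\<tau>)\<^sup>2 = (\<kappa> * \<bar>?\<tau>\<bar>)\<^sup>2" by (simp add: power_mult_distrib)
    also have "\<dots> \<le> (1 / R)\<^sup>2" using \<tau> \<kappa> by (intro power_mono) auto
    also have "\<dots> = \<kappa>" by (simp add: \<kappa>_def power_divide)
    finally have "(\<kappa> * ?\<tau>)\<^sup>2 \<le> 1 / R" using \<kappa> by linarith
    then have a2: "4 * k * (k + 1) * (\<kappa> * ?\<tau>)\<^sup>2 * ?p \<le> 4 * k * (k + 1) * (1 / R) * ?p"
      using k by (intro mult_right_mono mult_left_mono) auto
    have a3: "- (2 * \<nu> * (2 * k * \<kappa> * ?\<tau> * \<rho> t powr (- k - 1))) \<le> 2 * \<nu> * (2 * k * (1 / R) * ?p)"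
    proof -
      have "- (\<kappa> * ?\<tau>) \<le> \<bar>\<kappa> * ?\<tau>\<bar>" by simp
      then have "- (\<kappa> * ?\<tau>) \<le> 1 / R" using \<tau> \<kappa>(1) by (simp add: abs_mult)
      then have "2 * k * - (\<kappa> * ?\<tau>) \<le> 2 * k * (1 / R)" using k by (intro mult_left_mono) auto
      then have "2 * k * - (\<kappa> * ?\<tau>) * \<rho> t powr (- k - 1) \<le> 2 * k * (1 / R) * \<rho> t powr (- k - 1)"
        by (rule mult_right_mono) simp
      also have "\<dots> \<le> 2 * k * (1 / R) * ?p" using p1 k \<kappa> by (intro mult_left_mono) auto
      finally have "2 * \<nu> * (2 * k * - (\<kappa> * ?\<tau>) * \<rho> t powr (- k - 1)) \<le> 2 * \<nu> * (2 * k * (1 / R) * ?p)"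
        using \<nu>pos by (intro mult_left_mono) auto
      then show ?thesis by (simp add: mult_ac)
    qed
    have "W2 t - 2 * \<nu> * W1 t = K * (2 * k * \<kappa> * \<rho> t powr (- k - 1)
        + 4 * k * (k + 1) * (\<kappa> * ?\<tau>)\<^sup>2 * ?p + - (2 * \<nu> * (2 * k * \<kappa> * ?\<tau> * \<rho> t powr (- k - 1))))"
      unfolding W1_def W2_def by (simp add: algebra_simps)
    also have "\<dots> \<le> K * (2 * k * (1 / R) * ?p + 4 * k * (k + 1) * (1 / R) * ?p + 2 * \<nu> * (2 * k * (1 / R) * ?p))"
      by (rule mult_left_mono[OF add_mono[OF add_mono[OF a1 a2] a3]]) (use Kpos in simp)
    also have "\<dots> = K * (C * (1 / R)) * ?p"
      unfolding C_def by (simp add: algebra_simps add_divide_distrib)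
    also have "\<dots> = ell * ((q - 1) / q * (K * \<rho> t powr (- k)) powr q)"
    proof -
      have "C * (1 / R) = ell * ((q - 1) / q) * K powr (q - 1)"
        unfolding Kq using ellpos q R by (simp add: field_simps)
      moreover have "K * K powr (q - 1) = K powr q" using Kpos powr_add[of K 1 "q - 1"] by simp
      moreover have "(\<rho> t powr (- k)) powr q = ?p" using k(2) by (simp add: powr_powr)
      ultimately show ?thesis using Kpos by (simp add: powr_mult mult_ac)
    qed
    also have "\<dots> \<le> ell * ((1 + K * \<rho> t powr (- k)) powr q - (1 + K * \<rho> t powr (- k)))"
      using powr_growth[of "K * \<rho> t powr (- k)" q] q ellpos Kpos \<rho>(1)[OF t]
      by (intro mult_left_mono) auto
    finally show ?thesis unfolding W_def by (simp add: algebra_simps)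
  qed
  have "u x0 \<le> U x0 * W (s x0)"
  proof (rule comparison_above[OF u prof super])
    show "x0 \<in> shell I" using x0 R by (simp add: shell_def I_def t0_def)
    fix e :: real assume "e > 0"
    let ?A = "shell {t0 - R..t0 + R}"
    have "continuous_on ?A (ratio u)"
      unfolding ratio_def U_def
      by (intro continuous_intros continuous_on_subset[OF solD(3)[OF u]])
         (use cpos in \<open>auto simp: shell_def\<close>)
    then have "bounded (ratio u ` ?A)"
      using compact_shell compact_continuous_image compact_imp_bounded by blast
    then obtain M where M: "M > 0" "\<And>x. x \<in> ?A \<Longrightarrow> \<bar>ratio u x\<bar> \<le> M"
      unfolding bounded_pos by auto
    \<comment> \<open>Where \<rho> < m, the singular term K \<rho>^(-k) exceeds the bound M of the
      ratio u/U. The compact set needed is the shell on which \<rho> >= m; the maximum with 0 in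
      \<open>r\<close> covers m >= 1.\<close>
    define m where "m = (K / M) powr (1 / k)"
    have m: "m > 0" using Kpos M by (simp add: m_def)
    define r where "r = R * sqrt (max 0 (1 - m))"
    have r: "0 \<le> r" "r < R" using m R by (auto simp: r_def max_def)
    have "norm x powr a * (u x - U x * W (s x)) \<le> e" if x: "x \<in> shell I - shell {t0 - r..t0 + r}" for x
    proof -
      have xI: "s x \<in> I" "x \<noteq> 0" "x \<in> ?A" and "\<bar>s x - t0\<bar> > r" using x by (auto simp: shell_def I_def)
      then have "(r / R)\<^sup>2 < ((s x - t0) / R)\<^sup>2"
        using r R by (intro power2_strict_mono) (auto simp: abs_divide divide_strict_right_mono)
      moreover have "(r / R)\<^sup>2 = max 0 (1 - m)" using R by (simp add: r_def)
      ultimately have "\<rho> (s x) < m" unfolding \<rho>_def by linarith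
      then have "m powr (- k) \<le> \<rho> (s x) powr (- k)"
        using \<rho>(1)[OF xI(1)] k by (intro powr_mono2') auto
      moreover have "m powr (- k) = M / K" using M Kpos k by (simp add: m_def powr_powr powr_minus)
      ultimately have "M \<le> K * \<rho> (s x) powr (- k)" using Kpos by (simp add: field_simps)
      then have "ratio u x \<le> W (s x)" using M(2)[OF xI(3)] unfolding W_def by linarith
      then have "u x \<le> U x * W (s x)"
        by (subst ratio_eq[OF xI(2)]) (use U_pos[OF xI(2)] in simp)
      then have "norm x powr a * (u x - U x * W (s x)) \<le> 0" by (simp add: mult_nonneg_nonpos)
      then show ?thesis using \<open>e > 0\<close> by linarith
    qed
    moreover have "shell {t0 - r..t0 + r} \<subseteq> shell I" using r by (auto simp: shell_def I_def)
    ultimately show "\<exists>K. compact K \<and> K \<subseteq> shell I \<and> (\<forall>x\<in>shell I - K. norm x powr a * (u x - U x * W (s x)) \<le> e)"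
      using compact_shell by blast
  qed
  also have "W (s x0) = 1 + K" by (simp add: W_def \<rho>_def t0_def)
  finally show ?thesis unfolding K_def C_def k_def .
qed

text \<open>The solution lives on the whole cylinder, so the half-length R of the annulus in
  \<open>blow_up_bound\<close> is free and may tend to infinity.\<close>

lemma sol_le_U:
  assumes u: "sol u" and x: "x \<noteq> 0"
  shows "u x \<le> U x"
proof -
  let ?C = "((2 + 4 * (2 / (q - 1) + 1) + 4 * \<nu>) * (2 / (q - 1)))"
  let ?f = "\<lambda>R. U x * (1 + (?C / (R * ell * ((q - 1) / q))) powr (1 / (q - 1)))"
  have "((\<lambda>R. inverse R * (?C / (ell * ((q - 1) / q)))) \<longlongrightarrow> 0 * (?C / (ell * ((q - 1) / q)))) at_top"
    by (intro tendsto_mult tendsto_inverse_0_at_top filterlim_ident tendsto_const)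
  then have "((\<lambda>R. ?C / (R * ell * ((q - 1) / q))) \<longlongrightarrow> 0) at_top"
    by (simp add: field_simps)
  moreover have "eventually (\<lambda>R. 0 \<le> ?C / (R * ell * ((q - 1) / q))) at_top"
    using eventually_ge_at_top[of "0::real"] by eventually_elim (use ellpos q \<nu>pos in auto)
  ultimately have "((\<lambda>R. (?C / (R * ell * ((q - 1) / q))) powr (1 / (q - 1))) \<longlongrightarrow> 0) at_top"
    using q by (intro tendsto_zero_powrI[where b = "1 / (q - 1)"] tendsto_const) auto
  then have "(?f \<longlongrightarrow> U x * (1 + 0)) at_top"
    by (intro tendsto_intros)
  moreover have "eventually (\<lambda>R. u x \<le> ?f R) at_top"
    using eventually_ge_at_top[of 1] by eventually_elim (rule blow_up_bound[OF u x])
  ultimately show ?thesis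
    using tendsto_lowerbound[of ?f "U x" at_top "u x"] by simp
qed

end

subsection \<open>The heteroclinic profile\<close>

lemma integrable_exp_half_line:
  fixes m :: real
  assumes "m > 0"
  shows "integrable lborel (\<lambda>y. indicator {0..} y * exp (- (m * y)))"
    "(LINT y|lborel. indicator {0..} y * exp (- (m * y))) = 1 / m"
proof -
  have hi: "((\<lambda>x. exp (- m * x)) has_integral (exp (- m * 0) / m)) {0..}"
    by (rule has_integral_exp_minus_to_infinity[OF assms])
  then have "(\<lambda>x. exp (- m * x)) absolutely_integrable_on {0..}"
    by (intro nonnegative_absolutely_integrable_1) (auto simp: has_integral_integrable)
  then have "integrable lebesgue (\<lambda>x. indicator {0..} x *\<^sub>R exp (- m * x))"
    unfolding set_integrable_def .
  then show int: "integrable lborel (\<lambda>y. indicator {0..} y * exp (- (m * y)))"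
    by (subst (asm) integrable_completion) (auto simp: mult.commute)
  have "set_integrable lborel {0..} (\<lambda>x. exp (- m * x))"
    using int unfolding set_integrable_def by simp
  then have "(LINT x:{0..}|lborel. exp (- m * x)) = integral {0..} (\<lambda>x. exp (- m * x))"
    by (rule set_borel_integral_eq_integral)
  also have "\<dots> = 1 / m" using integral_unique[OF hi] by simp
  finally show "(LINT y|lborel. indicator {0..} y * exp (- (m * y))) = 1 / m"
    unfolding set_lebesgue_integral_def by simp
qed

section \<open>One-sided exponential convolution\<close>

text \<open>For bounded continuous h this is the bounded solution of y' + m y = h on the
  line.\<close>

definition econv :: "real \<Rightarrow> (real \<Rightarrow> real) \<Rightarrow> real \<Rightarrow> real" where
  "econv m h t = (LINT y|lborel. indicator {0..} y * (exp (- (m * y)) * h (t - y)))"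

lemma econv_integrable:
  fixes m B :: real and h :: "real \<Rightarrow> real"
  assumes m: "m > 0" and h: "h \<in> borel_measurable borel" "\<And>t. \<bar>h t\<bar> \<le> B"
  shows "integrable lborel (\<lambda>y. indicator {0..} y * (exp (- (m * y)) * h (t - y)))"
proof (rule Bochner_Integration.integrable_bound)
  show "integrable lborel (\<lambda>y. B * (indicator {0..} y * exp (- (m * y))))"
    using integrable_exp_half_line(1)[OF m] by (rule integrable_mult_right)
  show "(\<lambda>y. indicator {0..} y * (exp (- (m * y)) * h (t - y))) \<in> borel_measurable lborel"
    using h(1) by measurable
  show "AE y in lborel. norm (indicator {0..} y * (exp (- (m * y)) * h (t - y)))
     \<le> norm (B * (indicator {0..} y * exp (- (m * y))))"
  proof (rule AE_I2)
    fix y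
    have "\<bar>h (t - y)\<bar> \<le> \<bar>B\<bar>" using h(2)[of "t - y"] by linarith
    then show "norm (indicator {0..} y * (exp (- (m * y)) * h (t - y)))
     \<le> norm (B * (indicator {0..} y * exp (- (m * y))))"
      by (auto simp: indicator_def abs_mult mult.commute)
  qed
qed

text \<open>Two base points t and t' are allowed, so that monotonicity in the function and
  monotonicity in the argument are both instances.\<close>

lemma econv_mono:
  assumes m: "m > 0" and h: "h \<in> borel_measurable borel" "\<And>t. \<bar>h t\<bar> \<le> B"
    and k: "k \<in> borel_measurable borel" "\<And>t. \<bar>k t\<bar> \<le> B"
    and le: "\<And>y. y \<ge> 0 \<Longrightarrow> h (t - y) \<le> k (t' - y)"
  shows "econv m h t \<le> econv m k t'"
  unfolding econv_def
  by (rule integral_mono[OF econv_integrable[OF m h] econv_integrable[OF m k]])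
     (use le in \<open>auto simp: indicator_def\<close>)

lemma econv_const: "m > 0 \<Longrightarrow> econv m (\<lambda>t. b) t = b / m"
  unfolding econv_def using integrable_exp_half_line(2)[of m]
  by (simp add: mult.assoc[symmetric])

lemma econv_bounds:
  assumes m: "m > 0" and h: "h \<in> borel_measurable borel" "\<And>t. 0 \<le> h t" "\<And>t. h t \<le> B"
  shows "0 \<le> econv m h t" "econv m h t \<le> B / m"
proof -
  have B: "\<bar>h t\<bar> \<le> B" "0 \<le> B" for t using h(2,3)[of t] by auto
  have "econv m (\<lambda>t. 0) t \<le> econv m h t"
    by (rule econv_mono[where B = B]) (use m h B in auto)
  then show "0 \<le> econv m h t" using econv_const[OF m, of 0] by simp
  have "econv m h t \<le> econv m (\<lambda>t. B) t"
    by (rule econv_mono[where B = B]) (use m h B in auto)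
  then show "econv m h t \<le> B / m" using econv_const[OF m, of B] by simp
qed

lemma econv_limit:
  assumes m: "m > 0" and h: "\<And>n. h n \<in> borel_measurable borel" "\<And>n t. \<bar>h n t\<bar> \<le> B"
    and k: "k \<in> borel_measurable borel" and lim: "\<And>y. (\<lambda>n. h n (t n - y)) \<longlonglongrightarrow> k (t' - y)"
  shows "(\<lambda>n. econv m (h n) (t n)) \<longlonglongrightarrow> econv m k t'"
  unfolding econv_def
proof (rule integral_dominated_convergence[where w = "\<lambda>y. B * (indicator {0..} y * exp (- (m * y)))"])
  show "integrable lborel (\<lambda>y. B * (indicator {0..} y * exp (- (m * y))))"
    using integrable_exp_half_line(1)[OF m] by (rule integrable_mult_right)
  show "(\<lambda>y. indicator {0..} y * (exp (- (m * y)) * k (t' - y))) \<in> borel_measurable lborel"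
    using k by measurable
  show "(\<lambda>y. indicator {0..} y * (exp (- (m * y)) * h n (t n - y))) \<in> borel_measurable lborel" for n
    using h(1)[of n] by measurable
  show "AE y in lborel. (\<lambda>n. indicator {0..} y * (exp (- (m * y)) * h n (t n - y)))
      \<longlonglongrightarrow> indicator {0..} y * (exp (- (m * y)) * k (t' - y))"
    by (intro AE_I2 tendsto_mult tendsto_const lim)
  show "AE y in lborel. norm (indicator {0..} y * (exp (- (m * y)) * h n (t n - y)))
     \<le> B * (indicator {0..} y * exp (- (m * y)))" for n
    using h(2)[of n] by (intro AE_I2) (auto simp: indicator_def abs_mult mult.commute)
qed

text \<open>The substitution \<tau> = t - y shows that \<open>exp (m * t) * econv m h t\<close> is a
  primitive of \<open>exp (m * \<tau>) * h \<tau>\<close> taken from -infinity. Splitting off the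
  part up to t0 leaves an integral over a compact interval, to which the fundamental theorem
  applies.\<close>

lemma econv_split:
  assumes m: "m > 0" and h: "h \<in> borel_measurable borel" "\<And>t. \<bar>h t\<bar> \<le> B" and t: "t0 \<le> t"
  shows "(\<lambda>\<tau>. exp (m * \<tau>) * h \<tau>) integrable_on {t0..t}"
    "econv m h t = exp (- (m * t)) * (exp (m * t0) * econv m h t0 + integral {t0..t} (\<lambda>\<tau>. exp (m * \<tau>) * h \<tau>))"
proof -
  define J where "J = (\<lambda>\<tau>. exp (m * \<tau>) * h \<tau>)"
  have e: "exp (- (m * (t - y))) = exp (- (m * t)) * exp (m * y)" for t y
    by (simp add: exp_add[symmetric] algebra_simps)
  have eq: "indicator {0..} (t + -1 * y) * (exp (- (m * (t + -1 * y))) * h (t - (t + -1 * y)))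
      = exp (- (m * t)) * (indicator {..t} y * J y)" for t y :: real
    using e[of t y] by (simp add: indicator_def J_def)
  have conv: "econv m h t = exp (- (m * t)) * (LINT \<tau>|lborel. indicator {..t} \<tau> * J \<tau>)" for t
  proof -
    have "econv m h t = \<bar>-1\<bar> *\<^sub>R (LINT y|lborel. indicator {0..} (t + -1 * y) * (exp (- (m * (t + -1 * y))) * h (t - (t + -1 * y))))"
      unfolding econv_def by (rule lborel_integral_real_affine) simp
    also have "\<dots> = \<bar>-1\<bar> *\<^sub>R (LINT y|lborel. exp (- (m * t)) * (indicator {..t} y * J y))"
      unfolding eq ..
    finally show ?thesis by simp
  qed
  have e1: "exp (m * t) * (exp (- (m * t)) * z) = z" "exp (- (m * t)) * (exp (m * t) * z) = z" for t z
    by (simp_all add: exp_minus)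
  have int: "integrable lborel (\<lambda>\<tau>. indicator {..t} \<tau> * J \<tau>)" for t
  proof -
    have "integrable lborel (\<lambda>y. indicator {0..} (t + -1 * y) * (exp (- (m * (t + -1 * y))) * h (t - (t + -1 * y))))"
      by (rule lborel_integrable_real_affine[OF econv_integrable[OF m h]]) simp
    then have "integrable lborel (\<lambda>y. exp (m * t) * (exp (- (m * t)) * (indicator {..t} y * J y)))"
      unfolding eq by (rule integrable_mult_right)
    then show ?thesis unfolding e1 .
  qed
  have J: "J \<in> borel_measurable borel" unfolding J_def using h(1) by measurable
  have seti: "set_integrable lborel {t0..t} J"
    unfolding set_integrable_def
    by (rule Bochner_Integration.integrable_bound[OF int[of t]])
       (use J in \<open>auto simp: indicator_def\<close>)
  then show "(\<lambda>\<tau>. exp (m * \<tau>) * h \<tau>) integrable_on {t0..t}"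
    using set_borel_integral_eq_integral(1) unfolding J_def by blast
  have "(LINT \<tau>|lborel. indicator {..t} \<tau> * J \<tau>)
     = (LINT \<tau>|lborel. indicator {..t0} \<tau> * J \<tau> + indicator {t0..t} \<tau> *\<^sub>R J \<tau>)"
  proof (rule integral_cong_AE)
    show "AE \<tau> in lborel. indicator {..t} \<tau> * J \<tau> = indicator {..t0} \<tau> * J \<tau> + indicator {t0..t} \<tau> *\<^sub>R J \<tau>"
      using AE_lborel_singleton[of t0] by eventually_elim (use t in \<open>auto simp: indicator_def\<close>)
  qed (use J in measurable)
  also have "\<dots> = (LINT \<tau>|lborel. indicator {..t0} \<tau> * J \<tau>) + (LINT \<tau>:{t0..t}|lborel. J \<tau>)"
    using int[of t0] seti unfolding set_integrable_def set_lebesgue_integral_def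
    by (rule Bochner_Integration.integral_add)
  also have "(LINT \<tau>:{t0..t}|lborel. J \<tau>) = integral {t0..t} J"
    by (rule set_borel_integral_eq_integral[OF seti])
  finally show "econv m h t = exp (- (m * t)) * (exp (m * t0) * econv m h t0 + integral {t0..t} (\<lambda>\<tau>. exp (m * \<tau>) * h \<tau>))"
    unfolding conv e1 unfolding J_def by simp
qed

lemma econv_continuous:
  assumes m: "m > 0" and h: "h \<in> borel_measurable borel" "\<And>t. \<bar>h t\<bar> \<le> B"
  shows "isCont (econv m h) t"
proof -
  let ?J = "\<lambda>\<tau>. exp (m * \<tau>) * h \<tau>"
  have "continuous_on {t - 1..t + 1} (\<lambda>u. integral {t - 1..u} ?J)"
    by (rule indefinite_integral_continuous_1) (rule econv_split(1)[OF m h], simp)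
  then have "continuous_on {t - 1..t + 1}
     (\<lambda>u. exp (- (m * u)) * (exp (m * (t - 1)) * econv m h (t - 1) + integral {t - 1..u} ?J))"
    by (intro continuous_intros)
  then have "continuous_on {t - 1..t + 1} (econv m h)"
    by (rule continuous_on_eq) (rule econv_split(2)[OF m h, symmetric], simp)
  then show ?thesis
    by (rule continuous_on_interior) simp
qed

lemma econv_DERIV:
  assumes m: "m > 0" and h: "continuous_on UNIV h" "\<And>t. \<bar>h t\<bar> \<le> B"
  shows "(econv m h has_real_derivative h t - m * econv m h t) (at t)"
proof -
  let ?J = "\<lambda>\<tau>. exp (m * \<tau>) * h \<tau>"
  let ?F = "\<lambda>u. exp (- (m * u)) * (exp (m * (t - 1)) * econv m h (t - 1) + integral {t - 1..u} ?J)"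
  have hm: "h \<in> borel_measurable borel" using h(1) by (rule borel_measurable_continuous_onI)
  have eq: "econv m h u = ?F u" if "t - 1 \<le> u" for u
    by (rule econv_split(2)[OF m hm h(2) that])
  have "((\<lambda>u. integral {t - 1..u} ?J) has_real_derivative ?J t) (at t within {t - 1..t + 1})"
    by (rule integral_has_real_derivative) (auto intro!: continuous_intros continuous_on_subset[OF h(1)])
  then have "((\<lambda>u. integral {t - 1..u} ?J) has_real_derivative ?J t) (at t)"
    by (subst (asm) at_within_interior) auto
  then have "(?F has_real_derivative exp (- (m * t)) * ?J t - m * ?F t) (at t)"
    by (auto intro!: derivative_eq_intros simp: algebra_simps)
  also have "exp (- (m * t)) * ?J t - m * ?F t = h t - m * econv m h t"
    by (subst eq[of t]) (simp_all add: exp_minus)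
  finally show ?thesis
    by (rule has_field_derivative_transform_within_open[where S = "{t - 1<..}"]) (auto intro: eq[symmetric])
qed

text \<open>The operator \<open>D'' - (p - m) D' - p m D\<close> factors as \<open>(d/dt + m)(d/dt - p)\<close>, so the maximum principle reduces to
  two first-order monotonicity statements.\<close>

lemma half_line_max_principle:
  fixes D :: "real \<Rightarrow> real"
  assumes m: "m > 0" and p: "p > 0"
    and D: "\<And>t. t < b \<Longrightarrow> (D has_real_derivative D1 t) (at t)"
    and D1: "\<And>t. t < b \<Longrightarrow> (D1 has_real_derivative D2 t) (at t)"
    and ge: "\<And>t. t < b \<Longrightarrow> D2 t - (p - m) * D1 t - p * m * D t \<ge> 0"
    and bd: "\<And>t. t < b \<Longrightarrow> \<bar>D t\<bar> \<le> B" "\<And>t. t < b \<Longrightarrow> \<bar>D1 t\<bar> \<le> B"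
    and b: "continuous_on {..b} D" "D b \<le> 0" and t: "t \<le> b"
  shows "D t \<le> 0"
proof -
  define E where "E = (\<lambda>t. D1 t - p * D t)"
  have dE: "((\<lambda>t. exp (m * t) * E t) has_real_derivative exp (m * t) * (D2 t - (p - m) * D1 t - p * m * D t)) (at t)"
    if "t < b" for t
    unfolding E_def using D[OF that] D1[OF that]
    by (auto intro!: derivative_eq_intros simp: algebra_simps)
  have E: "E t \<ge> 0" if t: "t < b" for t
  proof -
    have mono: "exp (m * r) * E r \<le> exp (m * t) * E t" if "r \<le> t" for r
    proof (rule DERIV_nonneg_imp_nondecreasing[OF that])
      fix z assume "r \<le> z" "z \<le> t"
      then have "z < b" using t by simp
      then show "\<exists>y. ((\<lambda>t. exp (m * t) * E t) has_real_derivative y) (at z) \<and> 0 \<le> y"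
        using dE[of z] ge[of z] by (intro exI conjI) (assumption | simp)+
    qed
    \<comment> \<open>D and D1 are bounded and m > 0, so exp(m r) E(r) tends to 0 as r goes to
      -infinity; being nondecreasing, it is nonnegative.\<close>
    have low: "- (1 + p) * B * exp (m * r) \<le> exp (m * t) * E t" if "r \<le> t" for r
    proof -
      have "r < b" using that t by simp
      have "\<bar>p * D r\<bar> \<le> p * B" using bd(1)[OF \<open>r < b\<close>] p by (simp add: abs_mult)
      then have "- ((1 + p) * B) \<le> E r"
        unfolding E_def using bd(2)[OF \<open>r < b\<close>] by (simp add: algebra_simps abs_le_iff)
      then have "exp (m * r) * - ((1 + p) * B) \<le> exp (m * r) * E r" by (intro mult_left_mono) auto
      also have "\<dots> \<le> exp (m * t) * E t" by (rule mono[OF that])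
      finally show ?thesis by (simp add: algebra_simps)
    qed
    have "((\<lambda>r. exp (m * r)) \<longlongrightarrow> 0) at_bot"
      by (rule filterlim_compose[OF exp_at_bot])
         (use m in \<open>simp add: filterlim_tendsto_pos_mult_at_bot[OF tendsto_const _ filterlim_ident]\<close>)
    then have "((\<lambda>r. - (1 + p) * B * exp (m * r)) \<longlongrightarrow> - (1 + p) * B * 0) at_bot"
      by (intro tendsto_intros)
    moreover have "eventually (\<lambda>r. - (1 + p) * B * exp (m * r) \<le> exp (m * t) * E t) at_bot"
      using eventually_le_at_bot[of t] by eventually_elim (rule low)
    ultimately have "- (1 + p) * B * 0 \<le> exp (m * t) * E t"
      by (intro tendsto_upperbound[where F = at_bot]) auto
    then show ?thesis by (simp add: zero_le_mult_iff)
  qed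
  have "exp (- (p * t)) * D t \<le> exp (- (p * b)) * D b"
  proof (rule DERIV_nonneg_imp_increasing_open[OF t])
    fix z assume "t < z" "z < b"
    have "((\<lambda>t. exp (- (p * t)) * D t) has_real_derivative exp (- (p * z)) * E z) (at z)"
      unfolding E_def using D[OF \<open>z < b\<close>] by (auto intro!: derivative_eq_intros simp: algebra_simps)
    then show "\<exists>y. ((\<lambda>t. exp (- (p * t)) * D t) has_real_derivative y) (at z) \<and> 0 \<le> y"
      using E[OF \<open>z < b\<close>] by (intro exI[of _ "exp (- (p * z)) * E z"] conjI) simp_all
  next
    show "continuous_on {t..b} (\<lambda>t. exp (- (p * t)) * D t)"
      by (intro continuous_intros continuous_on_subset[OF b(1)]) auto
  qed
  also have "\<dots> \<le> 0" using b(2) by (simp add: mult_nonneg_nonpos)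
  finally show ?thesis by (simp add: mult_le_0_iff)
qed

text \<open>The tangent inequality at 1, scaled by w. The value v = 0 is treated apart, since that
  inequality needs a positive argument.\<close>

lemma powr_diff_le:
  fixes v w q :: real
  assumes "0 \<le> v" "v \<le> w" "0 < w" "q > 1"
  shows "w powr q - v powr q \<le> q * w powr (q - 1) * (w - v)"
proof -
  have wq: "w powr q = w powr (q - 1) * w" using assms powr_add[of w "q - 1" 1] by simp
  show ?thesis
  proof (cases "v = 0")
    case True
    have "1 * w powr q \<le> q * w powr q" using assms by (intro mult_right_mono) auto
    then show ?thesis using True assms wq by (simp add: mult.assoc)
  next
    case False
    then have "1 + q * (v / w - 1) \<le> (v / w) powr q" using assms by (intro powr_ge_tangent) auto
    then have "w powr q * (1 + q * (v / w - 1)) \<le> w powr q * (v / w) powr q" by (intro mult_left_mono) auto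
    also have "w powr q * (v / w) powr q = v powr q" using assms by (simp add: powr_divide)
    also have "w powr q * (1 + q * (v / w - 1)) = w powr q - q * w powr (q - 1) * (w - v)"
      unfolding wq using assms by (simp add: field_simps)
    finally show ?thesis by simp
  qed
qed

section \<open>Monotone iteration for the radial equation\<close>

locale emden_ode =
  fixes q \<mu> \<nu> ell :: real
  assumes q: "q > 1" and \<mu>: "\<mu> \<ge> 0" and \<nu>: "\<nu> > \<mu>" and ell: "ell = \<nu>\<^sup>2 - \<mu>\<^sup>2"
begin

lemma ellpos: "ell > 0"
proof -
  have "\<mu>\<^sup>2 < \<nu>\<^sup>2" using \<mu> \<nu> by (intro power_strict_mono) auto
  then show ?thesis using ell by simp
qed

text \<open>p and -m are the roots of x^2 - 2\<nu>x - ell q, the characteristic polynomial of the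
  radial equation after the shift by \<open>ell * q * w\<close>.\<close>

definition \<sigma> where "\<sigma> = sqrt (\<nu>\<^sup>2 + ell * q)"
definition p where "p = \<sigma> + \<nu>"
definition m where "m = \<sigma> - \<nu>"

lemma \<sigma>_gt: "\<sigma> > \<nu>" "\<nu> > 0"
  unfolding \<sigma>_def using \<mu> \<nu> ellpos q by (auto intro!: real_less_rsqrt)

lemma pm: "p > 0" "m > 0" "\<sigma> > 0" "p * m = ell * q" "p - m = 2 * \<nu>" "p + m = 2 * \<sigma>"
proof -
  show "p > 0" "m > 0" "\<sigma> > 0" "p - m = 2 * \<nu>" "p + m = 2 * \<sigma>"
    using \<sigma>_gt by (auto simp: p_def m_def)
  have "\<sigma>\<^sup>2 = \<nu>\<^sup>2 + ell * q" unfolding \<sigma>_def using ellpos q by simp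
  then show "p * m = ell * q" by (simp add: p_def m_def power2_eq_square algebra_simps)
qed

text \<open>On [0,1] the slope of w^q is at most q; adding \<open>ell * q * w\<close> therefore
  makes the nonlinearity nondecreasing there, as monotone iteration requires.\<close>

definition g :: "real \<Rightarrow> real" where "g w = ell * q * w + ell * (w - w powr q)"

lemma g_mono:
  assumes "0 \<le> v" "v \<le> w" "w \<le> 1"
  shows "g v \<le> g w"
proof (cases "w = 0")
  case False
  then have "w powr q - v powr q \<le> q * w powr (q - 1) * (w - v)" using assms q by (intro powr_diff_le) auto
  also have "\<dots> \<le> q * 1 * (w - v)"
    using assms q by (intro mult_right_mono mult_left_mono) (auto intro: powr_le_one_le simp: powr_le1)
  finally have "ell * (w powr q - v powr q) \<le> ell * (q * (w - v))" using ellpos by simp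
  moreover have "0 \<le> ell * (w - v)" using ellpos assms by simp
  ultimately show ?thesis unfolding g_def by (simp add: algebra_simps)
qed (use assms in simp)

lemma g_bounds:
  assumes "0 \<le> w" "w \<le> 1"
  shows "0 \<le> g w" "g w \<le> ell * q"
  using g_mono[of 0 w] g_mono[of w 1] assms q by (simp_all add: g_def)

lemma continuous_g: "continuous_on {0..} g"
  unfolding g_def using q by (intro continuous_intros continuous_on_powr') auto

lemma measurable_g[measurable]: "g \<in> borel_measurable borel"
  unfolding g_def by measurable

text \<open>Only measurability is asked, because the limit of the iteration is first known as a
  monotone function; continuity follows once it is a fixed point of \<open>T\<close>.\<close>

definition adm :: "(real \<Rightarrow> real) \<Rightarrow> bool" where
  "adm w \<longleftrightarrow> w \<in> borel_measurable borel \<and> (\<forall>t. 0 \<le> w t \<and> w t \<le> 1)"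

text \<open>The Green operator: T w is the bounded solution v of v'' - 2\<nu>v' - ell q v = -g(w)
  for continuous w. The first term integrates over the past with rate m, the reflected one over the
  future with rate p, and 2\<sigma> = p + m is the Wronskian factor. Fixed points solve the radial
  equation.\<close>

definition T :: "(real \<Rightarrow> real) \<Rightarrow> real \<Rightarrow> real" where
  "T w t = (econv m (\<lambda>\<tau>. g (w \<tau>)) t + econv p (\<lambda>\<tau>. g (w (- \<tau>))) (- t)) / (2 * \<sigma>)"

lemma adm_g:
  assumes "adm w"
  shows "(\<lambda>\<tau>. g (w \<tau>)) \<in> borel_measurable borel" "(\<lambda>\<tau>. g (w (- \<tau>))) \<in> borel_measurable borel"
    "\<And>t. \<bar>g (w t)\<bar> \<le> ell * q" "0 \<le> g (w t)" "g (w t) \<le> ell * q"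
proof -
  have [measurable]: "w \<in> borel_measurable borel" using assms unfolding adm_def by auto
  show "(\<lambda>\<tau>. g (w \<tau>)) \<in> borel_measurable borel" "(\<lambda>\<tau>. g (w (- \<tau>))) \<in> borel_measurable borel"
    by measurable
  show 1: "0 \<le> g (w t)" "g (w t) \<le> ell * q" for t using assms g_bounds unfolding adm_def by auto
  show "\<And>t. \<bar>g (w t)\<bar> \<le> ell * q" using 1 by (auto simp: abs_le_iff intro: order_trans[OF _ 1(1)])
qed

lemma T_mono:
  assumes v: "adm v" and w: "adm w" and le: "\<And>t. v t \<le> w t"
  shows "T v t \<le> T w t"
proof -
  have "g (v \<tau>) \<le> g (w \<tau>)" for \<tau> using v w le by (intro g_mono) (auto simp: adm_def)
  then have "econv m (\<lambda>\<tau>. g (v \<tau>)) t \<le> econv m (\<lambda>\<tau>. g (w \<tau>)) t"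
    "econv p (\<lambda>\<tau>. g (v (- \<tau>))) (- t) \<le> econv p (\<lambda>\<tau>. g (w (- \<tau>))) (- t)"
    by (intro econv_mono[where B = "ell * q"] pm adm_g v w; simp)+
  then show ?thesis unfolding T_def using pm(3) by (intro divide_right_mono add_mono) auto
qed

lemma T_mono_arg:
  assumes w: "adm w" and mono: "mono w"
  shows "mono (T w)"
proof (rule monoI)
  fix t t' :: real assume le: "t \<le> t'"
  have gm: "g (w \<tau>) \<le> g (w \<tau>')" if "\<tau> \<le> \<tau>'" for \<tau> \<tau>'
    using w monoD[OF mono that] by (intro g_mono) (auto simp: adm_def)
  have "econv m (\<lambda>\<tau>. g (w \<tau>)) t \<le> econv m (\<lambda>\<tau>. g (w \<tau>)) t'"
    "econv p (\<lambda>\<tau>. g (w (- \<tau>))) (- t) \<le> econv p (\<lambda>\<tau>. g (w (- \<tau>))) (- t')"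
    by (rule econv_mono[where B = "ell * q"]; (intro pm adm_g w)?; use le in \<open>auto intro: gm\<close>)+
  then show "T w t \<le> T w t'" unfolding T_def using pm(3) by (intro divide_right_mono add_mono) auto
qed

lemma T_bounds:
  assumes w: "adm w"
  shows "0 \<le> T w t" "T w t \<le> 1"
proof -
  let ?A = "econv m (\<lambda>\<tau>. g (w \<tau>)) t" and ?B = "econv p (\<lambda>\<tau>. g (w (- \<tau>))) (- t)"
  have b: "0 \<le> ?A" "?A \<le> ell * q / m" "0 \<le> ?B" "?B \<le> ell * q / p"
    using econv_bounds[OF pm(2) adm_g(1)[OF w], of "ell * q"]
      econv_bounds[OF pm(1) adm_g(2)[OF w], of "ell * q"] adm_g(4,5)[OF w] by auto
  then show "0 \<le> T w t" unfolding T_def using pm(3) by simp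
  have "ell * q / m + ell * q / p = 2 * \<sigma>"
    unfolding pm(4)[symmetric] pm(6)[symmetric] using pm(1,2) by simp
  then have "?A + ?B \<le> 2 * \<sigma>" using b by linarith
  then show "T w t \<le> 1" unfolding T_def using pm(3) by simp
qed

lemma T_continuous:
  assumes w: "adm w"
  shows "continuous_on UNIV (T w)"
proof -
  have "isCont (econv m (\<lambda>\<tau>. g (w \<tau>))) t" for t
    by (intro econv_continuous[where B = "ell * q"] pm adm_g w)
  then have c1: "continuous_on UNIV (econv m (\<lambda>\<tau>. g (w \<tau>)))"
    by (simp add: continuous_on_eq_continuous_at)
  have "isCont (econv p (\<lambda>\<tau>. g (w (- \<tau>)))) t" for t
    by (intro econv_continuous[where B = "ell * q"] pm adm_g w)
  then have c2: "continuous_on UNIV (econv p (\<lambda>\<tau>. g (w (- \<tau>))))"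
    by (simp add: continuous_on_eq_continuous_at)
  show ?thesis unfolding T_def[abs_def]
    by (intro continuous_intros c1 continuous_on_compose2[OF c2]) (use pm(3) in auto)
qed

lemma T_adm: "adm w \<Longrightarrow> adm (T w)"
  unfolding adm_def[of "T w"] using T_bounds T_continuous borel_measurable_continuous_onI by blast

text \<open>The base points may move with n: constant ones show that the limit of the iteration is a
  fixed point, and t n = n identifies the limit of the profile at +infinity.\<close>

lemma T_limit:
  assumes w: "\<And>n. adm (w n)" and v: "adm v" and lim: "\<And>y. (\<lambda>n. w n (t n + y)) \<longlonglongrightarrow> v (t' + y)"
  shows "(\<lambda>n. T (w n) (t n)) \<longlonglongrightarrow> T v t'"
proof -
  have gl: "(\<lambda>n. g (w n (t n + y))) \<longlonglongrightarrow> g (v (t' + y))" for y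
    by (rule continuous_on_tendsto_compose[OF continuous_g lim])
       (use w v in \<open>auto simp: adm_def\<close>)
  have "(\<lambda>n. econv m (\<lambda>\<tau>. g (w n \<tau>)) (t n)) \<longlonglongrightarrow> econv m (\<lambda>\<tau>. g (v \<tau>)) t'"
    by (rule econv_limit[where B = "ell * q"]; (intro pm adm_g w v)?)
       (use gl[of "- y" for y] in simp)
  moreover have "(\<lambda>n. econv p (\<lambda>\<tau>. g (w n (- \<tau>))) (- t n)) \<longlonglongrightarrow> econv p (\<lambda>\<tau>. g (v (- \<tau>))) (- t')"
    by (rule econv_limit[where B = "ell * q"]; (intro pm adm_g w v)?)
       (use gl in \<open>simp add: add.commute\<close>)
  ultimately show ?thesis unfolding T_def using pm(3) by (intro tendsto_intros) auto
qed

text \<open>Each half of \<open>T w\<close> satisfies a first-order equation; the combination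
  cancels to the second-order one. The bound on \<open>v1\<close> does not depend on w and is there
  for \<open>half_line_max_principle\<close>.\<close>

lemma T_C2:
  assumes w: "adm w" and c: "continuous_on UNIV w"
  obtains v1 v2 where "\<And>t. (T w has_real_derivative v1 t) (at t)" "\<And>t. (v1 has_real_derivative v2 t) (at t)"
    "\<And>t. v2 t - 2 * \<nu> * v1 t - ell * q * T w t = - g (w t)" "\<And>t. \<bar>v1 t\<bar> \<le> ell * q / \<sigma>" "continuous_on UNIV v2"
proof -
  define A where "A = econv m (\<lambda>\<tau>. g (w \<tau>))"
  define B where "B = (\<lambda>t. econv p (\<lambda>\<tau>. g (w (- \<tau>))) (- t))"
  have cg: "continuous_on UNIV (\<lambda>\<tau>. g (w \<tau>))"
    by (rule continuous_on_compose2[OF continuous_g c]) (use w in \<open>auto simp: adm_def\<close>)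
  then have cg': "continuous_on UNIV (\<lambda>\<tau>. g (w (- \<tau>)))"
    by (rule continuous_on_compose2) (auto intro!: continuous_intros)
  have dA: "(A has_real_derivative g (w t) - m * A t) (at t)" for t
    unfolding A_def by (rule econv_DERIV[OF pm(2) cg]) (rule adm_g[OF w])
  have dB: "(B has_real_derivative p * B t - g (w t)) (at t)" for t
  proof -
    have "((\<lambda>t. - t) has_real_derivative - 1) (at t)" by (auto intro!: derivative_eq_intros)
    from DERIV_chain2[OF econv_DERIV[OF pm(1) cg' adm_g(3)[OF w]] this]
    show ?thesis unfolding B_def by simp
  qed
  define v1 where "v1 = (\<lambda>t. (p * B t - m * A t) / (2 * \<sigma>))"
  define v2 where "v2 = (\<lambda>t. (m * m * A t + p * p * B t) / (2 * \<sigma>) - g (w t))"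
  have TAB: "T w = (\<lambda>t. (A t + B t) / (2 * \<sigma>))" by (simp add: T_def[abs_def] A_def B_def)
  have cA: "continuous_on UNIV A" "continuous_on UNIV B"
    using dA dB DERIV_isCont by (blast intro: continuous_at_imp_continuous_on)+
  show ?thesis
  proof (rule that)
    fix t
    show "(T w has_real_derivative v1 t) (at t)"
      unfolding TAB v1_def
      by (rule DERIV_cong[OF DERIV_cdivide[OF DERIV_add[OF dA dB]]]) simp
    show "(v1 has_real_derivative v2 t) (at t)"
      unfolding v1_def
    proof (rule DERIV_cong[OF DERIV_cdivide[OF DERIV_diff[OF DERIV_cmult[OF dB] DERIV_cmult[OF dA]]]])
      have "p * (p * B t - g (w t)) - m * (g (w t) - m * A t)
         = m * m * A t + p * p * B t - (p + m) * g (w t)" by (simp add: algebra_simps)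
      also have "\<dots> / (2 * \<sigma>) = v2 t" unfolding v2_def pm(6) diff_divide_distrib using pm(3) by simp
      finally show "(p * (p * B t - g (w t)) - m * (g (w t) - m * A t)) / (2 * \<sigma>) = v2 t" .
    qed
    have Z: "(m * m * A t + p * p * B t) - (p - m) * (p * B t - m * A t) - p * m * (A t + B t) = 0"
      by (simp add: algebra_simps)
    have E: "(x / d - h) - e * (y / d) - f * (z / d) = (x - e * y - f * z) / d - h" for x y z d e f h :: real
      by (simp add: diff_divide_distrib)
    show "v2 t - 2 * \<nu> * v1 t - ell * q * T w t = - g (w t)"
      unfolding TAB v1_def v2_def E using Z unfolding pm(4,5) by simp
    have "0 \<le> A t" "A t \<le> ell * q / m" "0 \<le> B t" "B t \<le> ell * q / p"
      unfolding A_def B_def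
      using econv_bounds[OF pm(2) adm_g(1)[OF w], of "ell * q"]
        econv_bounds[OF pm(1) adm_g(2)[OF w], of "ell * q"] adm_g(4,5)[OF w] by auto
    then have "0 \<le> m * A t" "m * A t \<le> ell * q" "0 \<le> p * B t" "p * B t \<le> ell * q"
      using pm(1,2) by (simp_all add: field_simps)
    then have "\<bar>p * B t - m * A t\<bar> \<le> 2 * (ell * q)" using ellpos q by (simp add: abs_le_iff)
    then show "\<bar>v1 t\<bar> \<le> ell * q / \<sigma>" unfolding v1_def using pm(3) by (simp add: abs_divide field_simps)
  next
    show "continuous_on UNIV v2" unfolding v2_def by (intro continuous_intros cA cg) (use pm(3) in auto)
  qed
qed

text \<open>r is the residual in the equation linearized at 0. Residual 0 makes l a supersolution of
  the full equation, and a residual of at least ell l^q makes it a subsolution. The bounds on l and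
  its derivative are those of the maximum principle on a half-line.\<close>

definition barrier :: "(real \<Rightarrow> real) \<Rightarrow> (real \<Rightarrow> real) \<Rightarrow> real \<Rightarrow> bool" where
  "barrier l r b \<longleftrightarrow> continuous_on {..b} l \<and> (\<forall>t<b. 0 < l t \<and> l t \<le> 1) \<and>
     (\<exists>l1 l2 B. \<forall>t<b. (l has_real_derivative l1 t) (at t) \<and> (l1 has_real_derivative l2 t) (at t) \<and>
        \<bar>l1 t\<bar> \<le> B \<and> l2 t - 2 * \<nu> * l1 t + ell * l t = r t)"

text \<open>To the right of 0 the claim is just T <= 1. The maximum principle is applied on t < 0
  only, so the corner at 0 does no harm.\<close>

lemma super_barrier:
  assumes l: "barrier l (\<lambda>_. 0) 0" and l0: "l 0 = 1"
  defines "w \<equiv> \<lambda>t. if t \<le> 0 then l t else 1"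
  shows "continuous_on UNIV w" "adm w" "T w t \<le> w t"
proof -
  obtain l1 l2 B where L: "continuous_on {..0} l" "\<And>t. t < 0 \<Longrightarrow> 0 < l t" "\<And>t. t < 0 \<Longrightarrow> l t \<le> 1"
    "\<And>t. t < 0 \<Longrightarrow> (l has_real_derivative l1 t) (at t)" "\<And>t. t < 0 \<Longrightarrow> (l1 has_real_derivative l2 t) (at t)"
    "\<And>t. t < 0 \<Longrightarrow> \<bar>l1 t\<bar> \<le> B" "\<And>t. t < 0 \<Longrightarrow> l2 t - 2 * \<nu> * l1 t + ell * l t = 0"
    using l unfolding barrier_def by blast
  have cw: "continuous_on ({..0} \<union> {0..}) w"
    unfolding w_def by (rule continuous_on_If) (use L(1) l0 in auto)
  moreover have "{..0} \<union> {0..} = (UNIV :: real set)" by auto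
  ultimately show cw: "continuous_on UNIV w" by simp
  have "0 \<le> w t \<and> w t \<le> 1" for t
  proof (cases "t < 0")
    case True
    then show ?thesis using L(2,3)[of t] by (simp add: w_def less_imp_le)
  next
    case False
    then show ?thesis using l0 by (cases "t = 0") (simp_all add: w_def)
  qed
  then show w: "adm w" unfolding adm_def using borel_measurable_continuous_onI[OF cw] by simp
  obtain v1 v2 where v: "\<And>t. (T w has_real_derivative v1 t) (at t)" "\<And>t. (v1 has_real_derivative v2 t) (at t)"
    "\<And>t. v2 t - 2 * \<nu> * v1 t - ell * q * T w t = - g (w t)" "\<And>t. \<bar>v1 t\<bar> \<le> ell * q / \<sigma>"
    "continuous_on UNIV v2"
    by (rule T_C2[OF w cw]) (rule that)
  show "T w t \<le> w t"
  proof (cases "t \<le> 0")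
    case True
    have "T w t - l t \<le> 0"
    proof (rule half_line_max_principle[OF pm(2,1), where b = 0 and D = "\<lambda>t. T w t - l t"
          and ?D1.0 = "\<lambda>t. v1 t - l1 t" and ?D2.0 = "\<lambda>t. v2 t - l2 t" and B = "1 + ell * q / \<sigma> + \<bar>B\<bar>"])
      fix t :: real assume t: "t < 0"
      show "((\<lambda>t. T w t - l t) has_real_derivative v1 t - l1 t) (at t)"
        "((\<lambda>t. v1 t - l1 t) has_real_derivative v2 t - l2 t) (at t)"
        by (intro DERIV_diff v L(4,5)[OF t])+
      have "v2 t - l2 t - (p - m) * (v1 t - l1 t) - p * m * (T w t - l t) = ell * (l t) powr q"
        using v(3)[of t] L(7)[OF t] t unfolding pm(4,5) w_def g_def by (simp add: algebra_simps)
      then show "0 \<le> v2 t - l2 t - (p - m) * (v1 t - l1 t) - p * m * (T w t - l t)"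
        using ellpos by simp
      have e: "ell * q / \<sigma> \<ge> 0" using ellpos q pm(3) by simp
      then show "\<bar>T w t - l t\<bar> \<le> 1 + ell * q / \<sigma> + \<bar>B\<bar>"
        using T_bounds[OF w, of t] L(2,3)[OF t] by linarith
      show "\<bar>v1 t - l1 t\<bar> \<le> 1 + ell * q / \<sigma> + \<bar>B\<bar>"
        using v(4)[of t] L(6)[OF t] by linarith
    next
      show "continuous_on {..0} (\<lambda>t. T w t - l t)"
        by (intro continuous_intros continuous_on_subset[OF T_continuous[OF w]] L) auto
      show "T w 0 - l 0 \<le> 0" using T_bounds[OF w, of 0] l0 by simp
      show "t \<le> 0" by (rule True)
    qed
    then show ?thesis using True by (simp add: w_def)
  qed (use T_bounds[OF w, of t] in \<open>simp add: w_def\<close>)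
qed

text \<open>Mirror image of the upper barrier: to the right of b the claim is T >= 0, to the left
  the maximum principle applies to y - T w.\<close>

lemma sub_barrier:
  assumes y: "barrier y r b" and r: "\<And>t. t < b \<Longrightarrow> ell * y t powr q \<le> r t" and yb: "y b = 0"
  defines "w \<equiv> \<lambda>t. if t \<le> b then y t else 0"
  shows "adm w" "w t \<le> T w t"
proof -
  obtain y1 y2 B where Y: "continuous_on {..b} y" "\<And>t. t < b \<Longrightarrow> 0 < y t" "\<And>t. t < b \<Longrightarrow> y t \<le> 1"
    "\<And>t. t < b \<Longrightarrow> (y has_real_derivative y1 t) (at t)" "\<And>t. t < b \<Longrightarrow> (y1 has_real_derivative y2 t) (at t)"
    "\<And>t. t < b \<Longrightarrow> \<bar>y1 t\<bar> \<le> B" "\<And>t. t < b \<Longrightarrow> y2 t - 2 * \<nu> * y1 t + ell * y t = r t"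
    using y unfolding barrier_def by blast
  have cw: "continuous_on ({..b} \<union> {b..}) w"
    unfolding w_def by (rule continuous_on_If) (use Y(1) yb in auto)
  moreover have "{..b} \<union> {b..} = (UNIV :: real set)" by auto
  ultimately have cw: "continuous_on UNIV w" by simp
  have "0 \<le> w t \<and> w t \<le> 1" for t
  proof (cases "t < b")
    case True
    then show ?thesis using Y(2,3)[of t] by (simp add: w_def less_imp_le)
  next
    case False
    then show ?thesis using yb by (cases "t = b") (simp_all add: w_def)
  qed
  then show w: "adm w" unfolding adm_def using borel_measurable_continuous_onI[OF cw] by simp
  obtain v1 v2 where v: "\<And>t. (T w has_real_derivative v1 t) (at t)" "\<And>t. (v1 has_real_derivative v2 t) (at t)"
    "\<And>t. v2 t - 2 * \<nu> * v1 t - ell * q * T w t = - g (w t)" "\<And>t. \<bar>v1 t\<bar> \<le> ell * q / \<sigma>"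
    "continuous_on UNIV v2"
    by (rule T_C2[OF w cw]) (rule that)
  show "w t \<le> T w t"
  proof (cases "t \<le> b")
    case True
    have "y t - T w t \<le> 0"
    proof (rule half_line_max_principle[OF pm(2,1), where b = b and D = "\<lambda>t. y t - T w t"
          and ?D1.0 = "\<lambda>t. y1 t - v1 t" and ?D2.0 = "\<lambda>t. y2 t - v2 t" and B = "1 + ell * q / \<sigma> + \<bar>B\<bar>"])
      fix t :: real assume t: "t < b"
      show "((\<lambda>t. y t - T w t) has_real_derivative y1 t - v1 t) (at t)"
        "((\<lambda>t. y1 t - v1 t) has_real_derivative y2 t - v2 t) (at t)"
        by (intro DERIV_diff v Y(4,5)[OF t])+
      have "y2 t - v2 t - (p - m) * (y1 t - v1 t) - p * m * (y t - T w t) = r t - ell * (y t) powr q"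
        using v(3)[of t] Y(7)[OF t] t unfolding pm(4,5) w_def g_def by (simp add: algebra_simps)
      then show "0 \<le> y2 t - v2 t - (p - m) * (y1 t - v1 t) - p * m * (y t - T w t)"
        using r[OF t] by simp
      have e: "ell * q / \<sigma> \<ge> 0" using ellpos q pm(3) by simp
      then show "\<bar>y t - T w t\<bar> \<le> 1 + ell * q / \<sigma> + \<bar>B\<bar>"
        using T_bounds[OF w, of t] Y(2,3)[OF t] by linarith
      show "\<bar>y1 t - v1 t\<bar> \<le> 1 + ell * q / \<sigma> + \<bar>B\<bar>"
        using v(4)[of t] Y(6)[OF t] by linarith
    next
      show "continuous_on {..b} (\<lambda>t. y t - T w t)"
        by (intro continuous_intros continuous_on_subset[OF T_continuous[OF w]] Y) auto
      show "y b - T w b \<le> 0" using T_bounds[OF w, of b] yb by simp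
      show "t \<le> b" by (rule True)
    qed
    then show ?thesis using True by (simp add: w_def)
  qed (use T_bounds[OF w, of t] in \<open>simp add: w_def\<close>)
qed

text \<open>Iterating T from the upper barrier gives a decreasing sequence of nondecreasing
  functions. The lower barrier stays below all of them, which excludes the trivial limit 0, and the
  two barriers together pin the decay at -infinity.\<close>

theorem profile_between_barriers:
  assumes l: "barrier l (\<lambda>_. 0) 0" and l0: "l 0 = 1" and lmono: "mono_on {..0} l"
    and y: "barrier y r b" and r: "\<And>t. t < b \<Longrightarrow> ell * y t powr q \<le> r t" and yb: "y b = 0"
    and b: "b \<le> 0" and yl: "\<And>t. t < b \<Longrightarrow> y t \<le> l t"
  obtains W W1 W2 where "mono W" "\<And>t. 0 < W t" "\<And>t. W t \<le> 1" "(W \<longlongrightarrow> 1) at_top"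
    "\<And>t. t < b \<Longrightarrow> y t \<le> W t" "\<And>t. t < b \<Longrightarrow> W t \<le> l t"
    "\<And>t. (W has_real_derivative W1 t) (at t)" "\<And>t. (W1 has_real_derivative W2 t) (at t)"
    "continuous_on UNIV W2" "\<And>t. W2 t - 2 * \<nu> * W1 t + ell * (W t - W t powr q) = 0"
proof -
  define u where "u = (\<lambda>t. if t \<le> 0 then l t else 1)"
  define z where "z = (\<lambda>t. if t \<le> b then y t else 0)"
  have U: "adm u" "T u t \<le> u t" for t
    unfolding u_def using super_barrier[OF l l0] by blast+
  have Z: "adm z" "z t \<le> T z t" for t
    unfolding z_def using sub_barrier[OF y r yb] by blast+
  have lb: "0 < l t" "l t \<le> 1" if "t < 0" for t using l that unfolding barrier_def by auto
  have monou: "mono u"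
  proof (rule monoI)
    fix s t :: real assume "s \<le> t"
    then show "u s \<le> u t"
      using mono_onD[OF lmono, of s t] lb[of s] l0 by (cases "s = 0") (auto simp: u_def)
  qed
  define w where "w = (\<lambda>n. (T ^^ n) u)"
  have w0: "w 0 = u" and wS: "w (Suc n) = T (w n)" for n by (auto simp: w_def)
  have adm: "adm (w n)" for n by (induction n) (auto simp: w0 wS U T_adm)
  have monow: "mono (w n)" for n by (induction n) (auto simp: w0 wS monou adm intro: T_mono_arg)
  have dec1: "w (Suc n) t \<le> w n t" for n t
  proof (induction n arbitrary: t)
    case 0
    then show ?case by (simp add: w0 wS U)
  next
    case (Suc n)
    then show ?case by (subst (1) wS, subst (2) wS) (intro T_mono adm)
  qed
  then have dec: "decseq (\<lambda>n. w n t)" for t by (intro decseq_SucI)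
  have zle: "z t \<le> w n t" for n t
  proof (induction n arbitrary: t)
    case 0
    show ?case
    proof (cases "t < b")
      case True
      then show ?thesis using yl[of t] b by (simp add: w0 u_def z_def)
    next
      case False
      then have "z t = 0" using yb by (cases "t = b") (simp_all add: z_def)
      then show ?thesis using U(1) by (simp add: w0 adm_def)
    qed
  next
    case (Suc n)
    have "z t \<le> T z t" by (rule Z)
    also have "\<dots> \<le> T (w n) t" by (intro T_mono Z adm Suc)
    finally show ?case by (simp add: wS)
  qed
  define W where "W = (\<lambda>t. lim (\<lambda>n. w n t))"
  have "convergent (\<lambda>n. w n t)" for t
    by (rule decseq_convergent[OF dec[of t], of 0]) (use adm in \<open>auto simp: adm_def intro: convergentI\<close>)
  then have lim: "(\<lambda>n. w n t) \<longlonglongrightarrow> W t" for t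
    unfolding W_def by (simp add: convergent_LIMSEQ_iff)
  have Wu: "W t \<le> u t" for t
    using decseq_ge[OF dec lim, of t 0] by (simp add: w0)
  have Wz: "z t \<le> W t" for t
    by (rule LIMSEQ_le_const[OF lim]) (use zle in auto)
  have monoW: "mono W"
    by (intro monoI LIMSEQ_le[OF lim lim]) (use monow in \<open>auto dest: monoD\<close>)
  have W01: "0 \<le> W t" "W t \<le> 1" for t
    by (rule LIMSEQ_le_const[OF lim], use adm in \<open>auto simp: adm_def\<close>)
       (rule order_trans[OF Wu], use U(1) in \<open>auto simp: adm_def\<close>)
  have Wadm: "adm W" unfolding adm_def using W01 borel_measurable_mono[OF monoW] by auto
  have "(\<lambda>n. T (w n) t) \<longlonglongrightarrow> T W t" for t
    by (rule T_limit[OF adm Wadm]) (rule lim)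
  moreover have "(\<lambda>n. T (w n) t) \<longlonglongrightarrow> W t" for t
    using LIMSEQ_Suc[OF lim[of t]] by (simp add: wS)
  ultimately have TW: "T W = W" using LIMSEQ_unique by blast
  have cW: "continuous_on UNIV W" using T_continuous[OF Wadm] TW by simp
  obtain W1 W2 where W: "\<And>t. (W has_real_derivative W1 t) (at t)" "\<And>t. (W1 has_real_derivative W2 t) (at t)"
    "\<And>t. W2 t - 2 * \<nu> * W1 t - ell * q * W t = - g (W t)" "\<And>t. \<bar>W1 t\<bar> \<le> ell * q / \<sigma>"
    "continuous_on UNIV W2"
    by (rule T_C2[OF Wadm cW, unfolded TW]) (rule that)
  have yW: "y t \<le> W t" if "t < b" for t using Wz[of t] that by (simp add: z_def)
  \<comment> \<open>The lower barrier is positive only to the left of b; monotonicity of W carries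
    positivity to the right.\<close>
  have Wpos: "0 < W t" for t
  proof -
    have "0 < y (min t b - 1)" using y unfolding barrier_def by auto
    also have "\<dots> \<le> W (min t b - 1)" by (intro yW) auto
    also have "\<dots> \<le> W t" by (intro monoD[OF monoW]) auto
    finally show ?thesis .
  qed
  obtain L where L: "(\<lambda>n. W (real n)) \<longlonglongrightarrow> L" "\<And>n. W (real n) \<le> L"
  proof (rule incseq_convergent[of "\<lambda>n. W (real n)" 1])
    show "incseq (\<lambda>n. W (real n))" by (intro incseq_SucI monoD[OF monoW]) auto
  qed (use W01 in auto)
  have Ltop: "(W \<longlongrightarrow> L) at_top"
  proof (rule tendstoI)
    fix e :: real assume "e > 0"
    then obtain n where n: "dist (W (real n)) L < e"
      using L(1) unfolding lim_sequentially by blast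
    have WL: "W t \<le> L" for t
    proof -
      obtain k where "t \<le> real k" using real_arch_simple by blast
      then show ?thesis using monoD[OF monoW] L(2) order_trans by blast
    qed
    show "eventually (\<lambda>t. dist (W t) L < e) at_top"
      using eventually_ge_at_top[of "real n"]
    proof eventually_elim
      case (elim t)
      then have "W (real n) \<le> W t" by (rule monoD[OF monoW])
      then show ?case using n WL[of t] WL[of "real n"] by (simp add: dist_real_def)
    qed
  qed
  have L01: "0 < L" "L \<le> 1"
    using Wpos[of 0] L(2)[of 0] LIMSEQ_le_const2[OF L(1), of 1] W01 by auto
  \<comment> \<open>The shifted profiles W(n + y) converge to the constant L, so that constant is
    itself a fixed point: L = L^q. As 0 < L <= 1, this means L = 1.\<close>
  have "(\<lambda>n. T W (real n)) \<longlonglongrightarrow> T (\<lambda>_. L) 0"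
  proof (rule T_limit[OF Wadm])
    show "adm (\<lambda>_. L)" using L01 by (simp add: adm_def)
    fix y :: real
    have "filterlim (\<lambda>n. y + real n) at_top sequentially"
      by (rule filterlim_tendsto_add_at_top[OF tendsto_const filterlim_real_sequentially])
    from filterlim_compose[OF Ltop this]
    show "(\<lambda>n. W (real n + y)) \<longlonglongrightarrow> L" by (simp add: add.commute)
  qed
  then have "T (\<lambda>_. L) 0 = L" using L(1) unfolding TW by (metis LIMSEQ_unique)
  moreover have "T (\<lambda>_. L) 0 = g L / (p * m)"
  proof -
    have "(z / m + z / p) / (p + m) = z / (p * m)" for z
    proof -
      have "z / m + z / p = z * (p + m) / (p * m)" using pm(1,2) by (simp add: field_simps)
      then show ?thesis using pm(1,2) by simp
    qed
    then show ?thesis unfolding T_def econv_const[OF pm(1)] econv_const[OF pm(2)] pm(6)[symmetric] .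
  qed
  ultimately have "g L = ell * q * L" using pm(1,2) unfolding pm(4) using ellpos q by (simp add: field_simps)
  then have "L powr q = L powr 1" using ellpos L01 unfolding g_def by simp
  then have "L = 1" using L01 q powr_inj[of L q 1] by (cases "L = 1") auto
  show ?thesis
  proof (rule that[of W W1 W2])
    show "(W \<longlongrightarrow> 1) at_top" using Ltop \<open>L = 1\<close> by simp
    show "W t \<le> l t" if "t < b" for t using Wu[of t] that b by (simp add: u_def)
    show "W2 t - 2 * \<nu> * W1 t + ell * (W t - W t powr q) = 0" for t
      using W(3)[of t] unfolding g_def by (simp add: algebra_simps)
  qed (use monoW Wpos W01 yW W in auto)
qed

end

section \<open>Barriers with the exact decay at -infinity\<close>

context emden_ode
begin

text \<open>The decay rate of the profile at \<open>-\<infinity>\<close>; for \<open>\<mu> = 0\<close> the characteristic root \<open>\<nu>\<close> is double.\<close>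

definition decay :: "real \<Rightarrow> real" where
  "decay t = (if \<mu> > 0 then exp ((\<nu> - \<mu>) * t) else - t * exp (\<nu> * t))"

lemma exp_at_bot_0: "a > 0 \<Longrightarrow> ((\<lambda>t::real. exp (a * t)) \<longlongrightarrow> 0) at_bot"
  by (rule filterlim_compose[OF exp_at_bot])
     (simp add: filterlim_tendsto_pos_mult_at_bot[OF tendsto_const _ filterlim_ident])

text \<open>The upper barrier is the exponential of the smaller root \<alpha> = \<nu> - \<mu> of x^2
  - 2\<nu>x + ell. The lower one subtracts a faster exponential with exponent \<beta> strictly
  between the two roots: the polynomial is negative at \<beta>, which produces the positive residual
  that has to absorb y^q.\<close>

lemma heteroclinic_simple_root:
  assumes \<mu>0: "\<mu> > 0"
  obtains W W1 W2 k where "mono W" "\<And>t. 0 < W t" "\<And>t. W t \<le> 1" "(W \<longlongrightarrow> 1) at_top"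
    "((\<lambda>t. W t / decay t) \<longlongrightarrow> k) at_bot" "k > 0"
    "\<And>t. (W has_real_derivative W1 t) (at t)" "\<And>t. (W1 has_real_derivative W2 t) (at t)"
    "continuous_on UNIV W2" "\<And>t. W2 t - 2 * \<nu> * W1 t + ell * (W t - W t powr q) = 0"
proof -
  define \<alpha> where "\<alpha> = \<nu> - \<mu>"
  \<comment> \<open>\<eta> <= \<mu> keeps \<beta> = \<alpha> + \<eta> below the larger root \<alpha>
    + 2\<mu>, and \<eta> <= (q-1)\<alpha> gives \<beta> <= q\<alpha>, so that y^q <= exp(\<beta>t)
    for t <= 0. C is large enough for its residual to dominate ell exp(\<beta>t); being greater than
    1, it also places the zero b of y to the left of 0.\<close>
  define \<eta> where "\<eta> = min \<mu> ((q - 1) * \<alpha>)"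
  define \<beta> where "\<beta> = \<alpha> + \<eta>"
  define C where "C = 1 + ell / (\<eta> * (2 * \<mu> - \<eta>))"
  define b where "b = - ln C / \<eta>"
  define l where "l = (\<lambda>t. exp (\<alpha> * t))"
  define y where "y = (\<lambda>t. exp (\<alpha> * t) - C * exp (\<beta> * t))"
  define r where "r = (\<lambda>t. C * (\<eta> * (2 * \<mu> - \<eta>)) * exp (\<beta> * t))"
  have \<alpha>: "\<alpha> > 0" using \<nu> by (simp add: \<alpha>_def)
  have \<eta>: "\<eta> > 0" "\<eta> \<le> \<mu>" "\<eta> \<le> (q - 1) * \<alpha>" using \<mu>0 \<alpha> q by (auto simp: \<eta>_def)
  have d: "\<eta> * (2 * \<mu> - \<eta>) > 0" using \<eta> \<mu>0 by simp
  have C: "C > 1" "ell \<le> C * (\<eta> * (2 * \<mu> - \<eta>))"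
    using d ellpos by (auto simp: C_def distrib_right)
  have b: "b < 0" using C \<eta> by (simp add: b_def)
  have \<beta>: "\<beta> > 0" "\<beta> \<le> q * \<alpha>" using \<alpha> \<eta> by (auto simp: \<beta>_def algebra_simps)
  have char: "\<alpha> * \<alpha> - 2 * \<nu> * \<alpha> + ell = 0" "\<beta> * \<beta> - 2 * \<nu> * \<beta> + ell = - (\<eta> * (2 * \<mu> - \<eta>))"
    unfolding \<beta>_def \<alpha>_def ell by (simp_all add: power2_eq_square algebra_simps)
  have yfac: "y t = exp (\<alpha> * t) * (1 - C * exp (\<eta> * t))" for t
    by (simp add: y_def \<beta>_def algebra_simps exp_add)
  have Cexp: "C * exp (\<eta> * t) < 1" if "t < b" for t
  proof -
    have "\<eta> * t < - ln C" using that \<eta> by (simp add: b_def field_simps)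
    then have "exp (\<eta> * t) < exp (- ln C)" by simp
    then show ?thesis using C by (simp add: exp_minus field_simps)
  qed
  have e1: "exp (a * t) \<le> 1" if "a \<ge> 0" "t \<le> 0" for a t :: real
    using that by (simp add: mult_nonneg_nonpos)
  have bl: "barrier l (\<lambda>_. 0) 0"
    unfolding barrier_def
  proof (intro conjI allI impI exI)
    show "continuous_on {..0} l" unfolding l_def by (intro continuous_intros)
    fix t :: real assume t: "t < 0"
    show "0 < l t" by (simp add: l_def)
    show "l t \<le> 1" unfolding l_def using e1 \<alpha> t by simp
    show "(l has_real_derivative \<alpha> * exp (\<alpha> * t)) (at t)"
      unfolding l_def by (auto intro!: derivative_eq_intros)
    show "((\<lambda>t. \<alpha> * exp (\<alpha> * t)) has_real_derivative \<alpha> * \<alpha> * exp (\<alpha> * t)) (at t)"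
      by (auto intro!: derivative_eq_intros)
    show "\<bar>\<alpha> * exp (\<alpha> * t)\<bar> \<le> \<alpha>" using e1[of \<alpha> t] \<alpha> t by (simp add: abs_mult)
    have "\<alpha> * \<alpha> * exp (\<alpha> * t) - 2 * \<nu> * (\<alpha> * exp (\<alpha> * t)) + ell * l t
      = (\<alpha> * \<alpha> - 2 * \<nu> * \<alpha> + ell) * exp (\<alpha> * t)" by (simp add: l_def algebra_simps)
    then show "\<alpha> * \<alpha> * exp (\<alpha> * t) - 2 * \<nu> * (\<alpha> * exp (\<alpha> * t)) + ell * l t = 0"
      unfolding char by simp
  qed
  have by': "barrier y r b"
    unfolding barrier_def
  proof (intro conjI allI impI exI)
    show "continuous_on {..b} y" unfolding y_def by (intro continuous_intros)
    fix t :: real assume t: "t < b"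
    then have t0: "t \<le> 0" using b by simp
    show "0 < y t" unfolding yfac using Cexp[OF t] by simp
    have "0 \<le> C * exp (\<beta> * t)" using C by simp
    then show "y t \<le> 1" unfolding y_def using e1[of \<alpha> t] \<alpha> t0 by linarith
    show "(y has_real_derivative \<alpha> * exp (\<alpha> * t) - C * (\<beta> * exp (\<beta> * t))) (at t)"
      unfolding y_def by (auto intro!: derivative_eq_intros)
    show "((\<lambda>t. \<alpha> * exp (\<alpha> * t) - C * (\<beta> * exp (\<beta> * t))) has_real_derivative
        \<alpha> * (\<alpha> * exp (\<alpha> * t)) - C * (\<beta> * (\<beta> * exp (\<beta> * t)))) (at t)"
      by (auto intro!: derivative_eq_intros)
    have "\<bar>\<alpha> * exp (\<alpha> * t)\<bar> \<le> \<alpha>" "\<bar>C * (\<beta> * exp (\<beta> * t))\<bar> \<le> C * \<beta>"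
      using e1[of \<alpha> t] e1[of \<beta> t] \<alpha> \<beta> C t0 by (auto simp: abs_mult)
    then show "\<bar>\<alpha> * exp (\<alpha> * t) - C * (\<beta> * exp (\<beta> * t))\<bar> \<le> \<alpha> + C * \<beta>" by linarith
    have "\<alpha> * (\<alpha> * exp (\<alpha> * t)) - C * (\<beta> * (\<beta> * exp (\<beta> * t)))
        - 2 * \<nu> * (\<alpha> * exp (\<alpha> * t) - C * (\<beta> * exp (\<beta> * t))) + ell * y t
      = (\<alpha> * \<alpha> - 2 * \<nu> * \<alpha> + ell) * exp (\<alpha> * t) - (\<beta> * \<beta> - 2 * \<nu> * \<beta> + ell) * (C * exp (\<beta> * t))"
      by (simp add: y_def algebra_simps)
    then show "\<alpha> * (\<alpha> * exp (\<alpha> * t)) - C * (\<beta> * (\<beta> * exp (\<beta> * t)))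
        - 2 * \<nu> * (\<alpha> * exp (\<alpha> * t) - C * (\<beta> * exp (\<beta> * t))) + ell * y t = r t"
      unfolding char r_def by simp
  qed
  have r: "ell * y t powr q \<le> r t" if t: "t < b" for t
  proof -
    have t0: "t \<le> 0" using t b by simp
    have "0 \<le> C * exp (\<beta> * t)" using C by simp
    moreover have "0 < y t" unfolding yfac using Cexp[OF t] by simp
    ultimately have "y t powr q \<le> exp (\<alpha> * t) powr q" unfolding y_def using q by (intro powr_mono2) auto
    also have "\<dots> = exp (q * \<alpha> * t)" by (simp add: powr_def mult_ac)
    also have "\<dots> \<le> exp (\<beta> * t)" using \<beta> t0 by (simp add: mult_right_mono_neg)
    finally have "ell * y t powr q \<le> ell * exp (\<beta> * t)" using ellpos by simp
    also have "\<dots> \<le> r t" unfolding r_def using C by (intro mult_right_mono) auto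
    finally show ?thesis .
  qed
  have yb: "y b = 0"
    unfolding yfac using C \<eta> by (simp add: b_def exp_minus)
  have yl: "y t \<le> l t" for t using C by (simp add: y_def l_def)
  have lm: "mono_on {..0} l" unfolding l_def using \<alpha> by (auto intro!: mono_onI)
  obtain W W1 W2 where W: "mono W" "\<And>t. 0 < W t" "\<And>t. W t \<le> 1" "(W \<longlongrightarrow> 1) at_top"
    "\<And>t. t < b \<Longrightarrow> y t \<le> W t" "\<And>t. t < b \<Longrightarrow> W t \<le> l t"
    "\<And>t. (W has_real_derivative W1 t) (at t)" "\<And>t. (W1 has_real_derivative W2 t) (at t)"
    "continuous_on UNIV W2" "\<And>t. W2 t - 2 * \<nu> * W1 t + ell * (W t - W t powr q) = 0"
    by (rule profile_between_barriers[OF bl _ lm by' r yb _ yl])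
       (use b in \<open>auto simp: l_def intro: that\<close>)
  have dec: "decay t = l t" for t using \<mu>0 by (simp add: decay_def l_def \<alpha>_def)
  have "((\<lambda>t. W t / decay t) \<longlongrightarrow> 1) at_bot"
  proof (rule tendsto_sandwich[OF _ _ _ tendsto_const])
    have "((\<lambda>t. 1 - C * exp (\<eta> * t)) \<longlongrightarrow> 1 - C * 0) at_bot"
      by (intro tendsto_intros exp_at_bot_0 \<eta>)
    then show "((\<lambda>t. 1 - C * exp (\<eta> * t)) \<longlongrightarrow> 1) at_bot" by simp
    show "\<forall>\<^sub>F t in at_bot. 1 - C * exp (\<eta> * t) \<le> W t / decay t"
      using eventually_gt_at_bot[of b]
    proof eventually_elim
      case (elim t)
      then show ?case using W(5)[of t] unfolding dec yfac l_def by (simp add: field_simps)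
    qed
    show "\<forall>\<^sub>F t in at_bot. W t / decay t \<le> 1"
      using eventually_gt_at_bot[of b]
    proof eventually_elim
      case (elim t)
      then show ?case using W(6)[of t] unfolding dec l_def by simp
    qed
  qed
  then show ?thesis using that[of W 1 W1 W2] W by simp
qed

text \<open>Now exp(\<nu>t) and t exp(\<nu>t) solve the linear equation. The upper barrier is their
  combination with value 1 and slope 0 at t = 0. For y = k exp(\<nu>t) the linear operator reduces
  to k'' exp(\<nu>t), so the lower barrier perturbs the affine factor by a convex
  exponential.\<close>

lemma heteroclinic_double_root:
  assumes \<mu>0: "\<mu> = 0"
  obtains W W1 W2 k where "mono W" "\<And>t. 0 < W t" "\<And>t. W t \<le> 1" "(W \<longlongrightarrow> 1) at_top"
    "((\<lambda>t. W t / decay t) \<longlongrightarrow> k) at_bot" "k > 0"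
    "\<And>t. (W has_real_derivative W1 t) (at t)" "\<And>t. (W1 has_real_derivative W2 t) (at t)"
    "continuous_on UNIV W2" "\<And>t. W2 t - 2 * \<nu> * W1 t + ell * (W t - W t powr q) = 0"
proof -
  have \<nu>0: "\<nu> > 0" using \<nu> \<mu> by simp
  have el: "ell = \<nu> * \<nu>" using ell \<mu>0 by (simp add: power2_eq_square)
  \<comment> \<open>Of the surplus decay exp((q-1)\<nu>t) one half, exp(\<eta>t), goes into the
    residual; the other half pays for the factor (1 - \<nu>t)^q.\<close>
  define \<eta> where "\<eta> = (q - 1) * \<nu> / 2"
  have \<eta>: "\<eta> > 0" "q * \<nu> = \<nu> + \<eta> + \<eta>" using q \<nu>0 by (auto simp: \<eta>_def algebra_simps)
  \<comment> \<open>Chosen so that (1 - \<nu>t)^q costs at most exp(-\<eta>t/2), by 1 - \<nu>t <=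
    exp(-\<delta>\<nu>t)/\<delta>; half of the reserved exp(\<eta>t) is then left over and tends to
    0.\<close>
  define \<delta> where "\<delta> = (q - 1) / (4 * q)"
  have \<delta>: "0 < \<delta>" "\<delta> \<le> 1" "q * (\<delta> * \<nu>) = \<eta> / 2" using q by (auto simp: \<delta>_def \<eta>_def field_simps)
  have xexp: "(1 + x) * exp (- x) \<le> 1" for x :: real
    using exp_ge_add_one_self[of x] by (simp add: exp_minus field_simps)
  have xexp': "x * exp (- x) \<le> 1" for x :: real
    using xexp[of x] by (simp add: distrib_right) (smt (verit) exp_gt_zero)
  have growth: "(1 - \<nu> * t) powr q * exp (\<eta> * t) \<le> (1 / \<delta>) powr q * exp (\<eta> / 2 * t)" if "t \<le> 0" for t
  proof -
    have nt: "0 \<le> - (\<nu> * t)" using that \<nu>0 by (simp add: mult_nonneg_nonpos)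
    have "\<delta> * (1 - \<nu> * t) \<le> 1 + \<delta> * - (\<nu> * t)" using \<delta> by (simp add: algebra_simps)
    also have "\<dots> \<le> exp (\<delta> * - (\<nu> * t))" by (rule exp_ge_add_one_self)
    finally have "1 - \<nu> * t \<le> 1 / \<delta> * exp (\<delta> * - (\<nu> * t))" using \<delta> by (simp add: field_simps)
    then have "(1 - \<nu> * t) powr q \<le> (1 / \<delta> * exp (\<delta> * - (\<nu> * t))) powr q"
      using nt q by (intro powr_mono2) auto
    also have "\<dots> = (1 / \<delta>) powr q * exp (q * (\<delta> * - (\<nu> * t)))"
      by (subst powr_mult) (use \<delta> in \<open>auto simp: powr_def[of "exp _"]\<close>)
    also have "q * (\<delta> * - (\<nu> * t)) = - (\<eta> / 2 * t)"
      unfolding \<delta>(3)[symmetric] by simp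
    finally have "(1 - \<nu> * t) powr q * exp (\<eta> * t) \<le> (1 / \<delta>) powr q * exp (- (\<eta> / 2 * t)) * exp (\<eta> * t)"
      by (rule mult_right_mono) simp
    also have "\<dots> = (1 / \<delta>) powr q * exp (\<eta> / 2 * t)" by (simp add: mult.assoc exp_add[symmetric])
    finally show ?thesis .
  qed
  have "((\<lambda>t. \<nu> * ((1 / \<delta>) powr q * exp (\<eta> / 2 * t))) \<longlongrightarrow> \<nu> * ((1 / \<delta>) powr q * 0)) at_bot"
    by (intro tendsto_intros exp_at_bot_0) (use \<eta> in simp)
  then have "eventually (\<lambda>t. \<nu> * ((1 / \<delta>) powr q * exp (\<eta> / 2 * t)) < \<eta>) at_bot"
    using \<eta> by (intro order_tendstoD(2)) auto
  then obtain b0 where b0: "\<And>t. t \<le> b0 \<Longrightarrow> \<nu> * ((1 / \<delta>) powr q * exp (\<eta> / 2 * t)) < \<eta>"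
    unfolding eventually_at_bot_linorder by blast
  \<comment> \<open>To the left of b0 the nonlinear term is below the residual; the minimum with -1
    makes b negative.\<close>
  define b where "b = min b0 (-1)"
  have b: "b < 0" "b \<le> b0" by (auto simp: b_def)
  \<comment> \<open>With C\<eta> = \<nu> the slope of \<open>kk\<close> is \<nu>(exp(\<eta>t) - 1),
    negative for t < 0. The constant \<open>B\<close> below places the zero of \<open>kk\<close> at
    b.\<close>
  define C where "C = \<nu> / \<eta>"
  have C: "C > 0" "C * \<eta> = \<nu>" using \<nu>0 \<eta> by (auto simp: C_def)
  define B where "B = 1 - \<nu> * b + C * exp (\<eta> * b)"
  define l where "l = (\<lambda>t. (1 - \<nu> * t) * exp (\<nu> * t))"
  define kk where "kk = (\<lambda>t. 1 - \<nu> * t - B + C * exp (\<eta> * t))"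
  define y where "y = (\<lambda>t. kk t * exp (\<nu> * t))"
  define r where "r = (\<lambda>t. \<nu> * \<eta> * exp (\<eta> * t) * exp (\<nu> * t))"
  have e1: "exp (a * t) \<le> 1" if "a \<ge> 0" "t \<le> 0" for a t :: real
    using that by (simp add: mult_nonneg_nonpos)
  have l1b: "\<bar>- (\<nu> * \<nu> * t) * exp (\<nu> * t)\<bar> \<le> \<nu>" if "t \<le> 0" for t
  proof -
    have "0 \<le> \<nu> * ((- (\<nu> * t)) * exp (- (- (\<nu> * t))))"
      using that \<nu>0 by (intro mult_nonneg_nonneg) (auto simp: mult_nonneg_nonpos)
    moreover have "\<nu> * ((- (\<nu> * t)) * exp (- (- (\<nu> * t)))) \<le> \<nu> * 1"
      using xexp'[of "- (\<nu> * t)"] \<nu>0 by (intro mult_left_mono) auto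
    ultimately show ?thesis by (simp add: abs_le_iff)
  qed
  have dl: "(l has_real_derivative - (\<nu> * \<nu> * t) * exp (\<nu> * t)) (at t)" for t
    unfolding l_def by (auto intro!: derivative_eq_intros simp: algebra_simps)
  have dl1: "((\<lambda>t. - (\<nu> * \<nu> * t) * exp (\<nu> * t)) has_real_derivative
      - (\<nu> * \<nu>) * exp (\<nu> * t) - \<nu> * \<nu> * \<nu> * t * exp (\<nu> * t)) (at t)" for t
    by (auto intro!: derivative_eq_intros simp: algebra_simps)
  have l01: "0 < l t" "l t \<le> 1" if "t \<le> 0" for t
    using that \<nu>0 xexp[of "- (\<nu> * t)"] mult_nonneg_nonpos[of \<nu> t] by (auto simp: l_def add_pos_nonneg)
  have bl: "barrier l (\<lambda>_. 0) 0"
    unfolding barrier_def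
  proof (intro conjI allI impI exI)
    show "continuous_on {..0} l" unfolding l_def by (intro continuous_intros)
    fix t :: real assume t: "t < 0"
    show "0 < l t" "l t \<le> 1" using l01 t by auto
    show "(l has_real_derivative - (\<nu> * \<nu> * t) * exp (\<nu> * t)) (at t)" by (rule dl)
    show "((\<lambda>t. - (\<nu> * \<nu> * t) * exp (\<nu> * t)) has_real_derivative
      - (\<nu> * \<nu>) * exp (\<nu> * t) - \<nu> * \<nu> * \<nu> * t * exp (\<nu> * t)) (at t)" by (rule dl1)
    show "\<bar>- (\<nu> * \<nu> * t) * exp (\<nu> * t)\<bar> \<le> \<nu>" using l1b t by simp
    show "- (\<nu> * \<nu>) * exp (\<nu> * t) - \<nu> * \<nu> * \<nu> * t * exp (\<nu> * t)
        - 2 * \<nu> * (- (\<nu> * \<nu> * t) * exp (\<nu> * t)) + ell * l t = 0"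
      unfolding el l_def by (simp add: algebra_simps)
  qed
  have dkk: "(kk has_real_derivative - \<nu> + \<nu> * exp (\<eta> * t)) (at t)" for t
    unfolding kk_def using C(2) by (auto intro!: derivative_eq_intros simp: mult.commute mult.left_commute)
  have dkk1: "((\<lambda>t. - \<nu> + \<nu> * exp (\<eta> * t)) has_real_derivative \<nu> * \<eta> * exp (\<eta> * t)) (at t)" for t
    by (auto intro!: derivative_eq_intros)
  have kb: "kk b = 0" by (simp add: kk_def B_def)
  have kpos: "kk t > 0" if t: "t < b" for t
  proof -
    have "kk b < kk t"
    proof (rule DERIV_neg_imp_decreasing[OF t])
      fix z assume z: "t \<le> z" "z \<le> b"
      then have "\<eta> * z < 0" using b \<eta> by (simp add: mult_pos_neg)
      then have "\<nu> * exp (\<eta> * z) < \<nu> * 1" using \<nu>0 by (intro mult_strict_left_mono) auto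
      then show "\<exists>d. (kk has_real_derivative d) (at z) \<and> d < 0" using dkk[of z] by force
    qed
    then show ?thesis using kb by simp
  qed
  have kle: "kk t \<le> 1 - \<nu> * t" if t: "t \<le> b" for t
  proof -
    have "exp (\<eta> * t) \<le> exp (\<eta> * b)" using t \<eta> by simp
    then have "C * exp (\<eta> * t) \<le> C * exp (\<eta> * b)" using C by simp
    then have "C * exp (\<eta> * t) \<le> B" unfolding B_def using b \<nu>0 mult_nonneg_nonpos[of \<nu> b] by linarith
    then show ?thesis by (simp add: kk_def)
  qed
  have yl: "y t \<le> l t" if t: "t < b" for t
    unfolding y_def l_def using kle[of t] t by (intro mult_right_mono) auto
  have by': "barrier y r b"
    unfolding barrier_def
  proof (intro conjI allI impI exI)
    show "continuous_on {..b} y" unfolding y_def kk_def by (intro continuous_intros)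
    fix t :: real assume t: "t < b"
    then have t0: "t \<le> 0" using b by simp
    show "0 < y t" unfolding y_def using kpos[OF t] by simp
    show "y t \<le> 1" using yl[OF t] l01(2)[OF t0] by linarith
    show "(y has_real_derivative (- \<nu> + \<nu> * exp (\<eta> * t) + kk t * \<nu>) * exp (\<nu> * t)) (at t)"
      unfolding y_def by (auto intro!: derivative_eq_intros dkk simp: algebra_simps)
    show "((\<lambda>t. (- \<nu> + \<nu> * exp (\<eta> * t) + kk t * \<nu>) * exp (\<nu> * t)) has_real_derivative
       (\<nu> * \<eta> * exp (\<eta> * t) + (- \<nu> + \<nu> * exp (\<eta> * t)) * \<nu>) * exp (\<nu> * t)
         + (- \<nu> + \<nu> * exp (\<eta> * t) + kk t * \<nu>) * \<nu> * exp (\<nu> * t)) (at t)"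
      by (auto intro!: derivative_eq_intros dkk simp: algebra_simps)
    have "0 \<le> y t" "y t \<le> 1" using kpos[OF t] yl[OF t] l01(2)[OF t0] by (auto simp: y_def)
    then have "\<bar>\<nu> * y t\<bar> \<le> \<nu>" using \<nu>0 by (simp add: abs_mult)
    moreover have "\<bar>- \<nu> + \<nu> * exp (\<eta> * t)\<bar> * exp (\<nu> * t) \<le> \<nu> * 1"
    proof (intro mult_mono)
      have "\<nu> * exp (\<eta> * t) \<le> \<nu> * 1" "0 \<le> \<nu> * exp (\<eta> * t)"
        using e1[of \<eta> t] \<eta> t0 \<nu>0 by (auto intro: mult_left_mono)
      then show "\<bar>- \<nu> + \<nu> * exp (\<eta> * t)\<bar> \<le> \<nu>" by linarith
    qed (use e1[of \<nu> t] \<nu>0 t0 in auto)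
    then have "\<bar>(- \<nu> + \<nu> * exp (\<eta> * t)) * exp (\<nu> * t)\<bar> \<le> \<nu>" by (simp add: abs_mult)
    moreover have "(- \<nu> + \<nu> * exp (\<eta> * t) + kk t * \<nu>) * exp (\<nu> * t)
       = (- \<nu> + \<nu> * exp (\<eta> * t)) * exp (\<nu> * t) + \<nu> * y t" by (simp add: y_def algebra_simps)
    ultimately show "\<bar>(- \<nu> + \<nu> * exp (\<eta> * t) + kk t * \<nu>) * exp (\<nu> * t)\<bar> \<le> \<nu> + \<nu>" by linarith
    show "(\<nu> * \<eta> * exp (\<eta> * t) + (- \<nu> + \<nu> * exp (\<eta> * t)) * \<nu>) * exp (\<nu> * t)
         + (- \<nu> + \<nu> * exp (\<eta> * t) + kk t * \<nu>) * \<nu> * exp (\<nu> * t)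
        - 2 * \<nu> * ((- \<nu> + \<nu> * exp (\<eta> * t) + kk t * \<nu>) * exp (\<nu> * t)) + ell * y t = r t"
      unfolding el y_def r_def by (simp add: algebra_simps)
  qed
  have r: "ell * y t powr q \<le> r t" if t: "t < b" for t
  proof -
    have t0: "t \<le> 0" using t b by simp
    have nt: "0 \<le> - (\<nu> * t)" using t0 \<nu>0 by (simp add: mult_nonneg_nonpos)
    have "0 < y t" unfolding y_def using kpos[OF t] by simp
    then have "y t powr q \<le> l t powr q" using yl[OF t] q by (intro powr_mono2) auto
    also have "\<dots> = (1 - \<nu> * t) powr q * exp (q * \<nu> * t)"
      unfolding l_def using nt by (simp add: powr_mult powr_def[of "exp _"] mult_ac)
    also have "\<dots> = (1 - \<nu> * t) powr q * exp (\<eta> * t) * (exp (\<eta> * t) * exp (\<nu> * t))"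
      unfolding \<eta>(2) by (simp add: exp_add[symmetric] algebra_simps)
    finally have "\<nu> * \<nu> * y t powr q \<le> \<nu> * \<nu> * ((1 - \<nu> * t) powr q * exp (\<eta> * t) * (exp (\<eta> * t) * exp (\<nu> * t)))"
      using \<nu>0 by simp
    also have "\<dots> = \<nu> * (\<nu> * ((1 - \<nu> * t) powr q * exp (\<eta> * t))) * (exp (\<eta> * t) * exp (\<nu> * t))"
      by (simp add: mult_ac)
    also have "\<dots> \<le> \<nu> * \<eta> * (exp (\<eta> * t) * exp (\<nu> * t))"
    proof (intro mult_right_mono mult_left_mono)
      have "\<nu> * ((1 - \<nu> * t) powr q * exp (\<eta> * t)) \<le> \<nu> * ((1 / \<delta>) powr q * exp (\<eta> / 2 * t))"
        using growth[OF t0] \<nu>0 by (rule mult_left_mono[OF _ less_imp_le])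
      also have "\<dots> \<le> \<eta>" using b0[of t] b t by simp
      finally show "\<nu> * ((1 - \<nu> * t) powr q * exp (\<eta> * t)) \<le> \<eta>" .
    qed (use \<nu>0 in auto)
    finally show ?thesis unfolding el r_def by (simp add: mult_ac)
  qed
  have lm: "mono_on {..0} l"
  proof (rule mono_onI)
    fix s t :: real assume st: "s \<in> {..0}" "t \<in> {..0}" "s \<le> t"
    show "l s \<le> l t"
    proof (rule DERIV_nonneg_imp_nondecreasing[OF st(3)])
      fix z assume "s \<le> z" "z \<le> t"
      then show "\<exists>d. (l has_real_derivative d) (at z) \<and> 0 \<le> d"
      proof (intro exI conjI)
        show "(l has_real_derivative - (\<nu> * \<nu> * z) * exp (\<nu> * z)) (at z)" by (rule dl)
        have "\<nu> * \<nu> * z \<le> 0" using \<open>z \<le> t\<close> st \<nu>0 by (intro mult_nonneg_nonpos) auto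
        then show "0 \<le> - (\<nu> * \<nu> * z) * exp (\<nu> * z)" by (simp add: mult_nonpos_nonneg)
      qed
    qed
  qed
  have yb: "y b = 0" unfolding y_def kb by simp
  obtain W W1 W2 where W: "mono W" "\<And>t. 0 < W t" "\<And>t. W t \<le> 1" "(W \<longlongrightarrow> 1) at_top"
    "\<And>t. t < b \<Longrightarrow> y t \<le> W t" "\<And>t. t < b \<Longrightarrow> W t \<le> l t"
    "\<And>t. (W has_real_derivative W1 t) (at t)" "\<And>t. (W1 has_real_derivative W2 t) (at t)"
    "continuous_on UNIV W2" "\<And>t. W2 t - 2 * \<nu> * W1 t + ell * (W t - W t powr q) = 0"
    by (rule profile_between_barriers[OF bl _ lm by' r yb _ yl])
       (use b in \<open>auto simp: l_def intro: that\<close>)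
  have dec: "decay t = - t * exp (\<nu> * t)" for t
    unfolding decay_def using \<mu>0 by (simp only: less_irrefl if_False)
  have inv0: "((\<lambda>t::real. inverse t) \<longlongrightarrow> 0) at_bot" by (rule tendsto_inverse_0[THEN tendsto_mono[rotated]]) (rule at_bot_le_at_infinity)
  have "((\<lambda>t. W t / decay t) \<longlongrightarrow> \<nu>) at_bot"
  proof (rule tendsto_sandwich)
    have "((\<lambda>t. \<nu> - (1 - B + C * exp (\<eta> * t)) * inverse t) \<longlongrightarrow> \<nu> - (1 - B + C * 0) * 0) at_bot"
      by (intro tendsto_intros exp_at_bot_0 \<eta> inv0)
    then show "((\<lambda>t. \<nu> - (1 - B + C * exp (\<eta> * t)) * inverse t) \<longlongrightarrow> \<nu>) at_bot" by simp
    have "((\<lambda>t. \<nu> - inverse t) \<longlongrightarrow> \<nu> - 0) at_bot" by (intro tendsto_intros inv0)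
    then show "((\<lambda>t. \<nu> - inverse t) \<longlongrightarrow> \<nu>) at_bot" by simp
    show "\<forall>\<^sub>F t in at_bot. \<nu> - (1 - B + C * exp (\<eta> * t)) * inverse t \<le> W t / decay t"
      using eventually_gt_at_bot[of b]
    proof eventually_elim
      case (elim t)
      then have "kk t * exp (\<nu> * t) / (- t * exp (\<nu> * t)) \<le> W t / (- t * exp (\<nu> * t))"
        using W(5)[of t] b unfolding y_def by (intro divide_right_mono) (auto simp: mult_nonpos_nonneg)
      moreover have "kk t * exp (\<nu> * t) / (- t * exp (\<nu> * t)) = \<nu> - (1 - B + C * exp (\<eta> * t)) * inverse t"
        using elim b by (simp add: kk_def field_simps)
      ultimately show ?case unfolding dec by simp
    qed
    show "\<forall>\<^sub>F t in at_bot. W t / decay t \<le> \<nu> - inverse t"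
      using eventually_gt_at_bot[of b]
    proof eventually_elim
      case (elim t)
      then have "W t / (- t * exp (\<nu> * t)) \<le> (1 - \<nu> * t) * exp (\<nu> * t) / (- t * exp (\<nu> * t))"
        using W(6)[of t] b unfolding l_def by (intro divide_right_mono) (auto simp: mult_nonpos_nonneg)
      moreover have "(1 - \<nu> * t) * exp (\<nu> * t) / (- t * exp (\<nu> * t)) = \<nu> - inverse t"
        using elim b by (simp add: field_simps)
      ultimately show ?case unfolding dec by simp
    qed
  qed
  then show ?thesis using that[of W \<nu> W1 W2] W \<nu>0 by simp
qed

lemma heteroclinic:
  obtains W W1 W2 k where "mono W" "\<And>t. 0 < W t" "\<And>t. W t \<le> 1" "(W \<longlongrightarrow> 1) at_top"
    "((\<lambda>t. W t / decay t) \<longlongrightarrow> k) at_bot" "k > 0"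
    "\<And>t. (W has_real_derivative W1 t) (at t)" "\<And>t. (W1 has_real_derivative W2 t) (at t)"
    "continuous_on UNIV W2" "\<And>t. W2 t - 2 * \<nu> * W1 t + ell * (W t - W t powr q) = 0"
proof (cases "\<mu> > 0")
  case True
  show ?thesis by (rule heteroclinic_simple_root[OF True]) (rule that)
next
  case False
  then have "\<mu> = 0" using \<mu> by simp
  show ?thesis by (rule heteroclinic_double_root[OF \<open>\<mu> = 0\<close>]) (rule that)
qed

lemma decay_pos: "t < 0 \<Longrightarrow> decay t > 0"
  unfolding decay_def by (auto intro: mult_neg_pos)

lemma decay_tendsto_0: "(decay \<longlongrightarrow> 0) at_bot"
proof (cases "\<mu> > 0")
  case True
  then show ?thesis using exp_at_bot_0[of "\<nu> - \<mu>"] \<nu> by (simp add: decay_def[abs_def])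
next
  case False
  have \<nu>0: "\<nu> > 0" using \<mu> \<nu> by simp
  show ?thesis
  proof (rule tendsto_sandwich[OF _ _ tendsto_const])
    have "((\<lambda>t. 2 / \<nu> * exp (\<nu> / 2 * t)) \<longlongrightarrow> 2 / \<nu> * 0) at_bot"
      by (intro tendsto_intros exp_at_bot_0) (use \<nu>0 in simp)
    then show "((\<lambda>t. 2 / \<nu> * exp (\<nu> / 2 * t)) \<longlongrightarrow> 0) at_bot" by simp
    show "\<forall>\<^sub>F t in at_bot. 0 \<le> decay t"
      using eventually_gt_at_bot[of 0] by eventually_elim (use decay_pos in \<open>simp add: less_imp_le\<close>)
    show "\<forall>\<^sub>F t in at_bot. decay t \<le> 2 / \<nu> * exp (\<nu> / 2 * t)"
    proof (rule always_eventually, rule allI)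
      fix t
      have "- (\<nu> / 2 * t) \<le> exp (- (\<nu> / 2 * t))"
        using exp_ge_add_one_self[of "- (\<nu> / 2 * t)"] by linarith
      then have "2 / \<nu> * (- (\<nu> / 2 * t)) \<le> 2 / \<nu> * exp (- (\<nu> / 2 * t))"
        using \<nu>0 by (intro mult_left_mono) auto
      then have "- t \<le> 2 / \<nu> * exp (- (\<nu> / 2 * t))" using \<nu>0 by simp
      then have "- t * exp (\<nu> * t) \<le> 2 / \<nu> * exp (- (\<nu> / 2 * t)) * exp (\<nu> * t)"
        by (rule mult_right_mono) simp
      also have "\<dots> = 2 / \<nu> * exp (\<nu> / 2 * t)" by (simp add: mult.assoc exp_add[symmetric])
      finally show "decay t \<le> 2 / \<nu> * exp (\<nu> / 2 * t)" using False by (simp add: decay_def)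
    qed
  qed
qed

text \<open>In the double-root case the extra factor (t + h)/t tends to 1, so the exponential law
  survives asymptotically.\<close>

lemma decay_shift: "((\<lambda>t. decay (t + h) / decay t) \<longlongrightarrow> exp ((\<nu> - \<mu>) * h)) at_bot"
proof (cases "\<mu> > 0")
  case True
  have "decay (t + h) / decay t = exp ((\<nu> - \<mu>) * h)" for t
    using True by (simp add: decay_def exp_diff[symmetric] algebra_simps)
  then show ?thesis by simp
next
  case False
  then have \<mu>0: "\<mu> = 0" using \<mu> by linarith
  have inv0: "((\<lambda>t::real. inverse t) \<longlongrightarrow> 0) at_bot"
    by (rule tendsto_inverse_0[THEN tendsto_mono[rotated]]) (rule at_bot_le_at_infinity)
  have "((\<lambda>t. (1 + h * inverse t) * exp (\<nu> * h)) \<longlongrightarrow> (1 + h * 0) * exp (\<nu> * h)) at_bot"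
    by (intro tendsto_intros inv0)
  moreover have "\<forall>\<^sub>F t in at_bot. (1 + h * inverse t) * exp (\<nu> * h) = decay (t + h) / decay t"
    using eventually_gt_at_bot[of 0]
  proof eventually_elim
    case (elim t)
    have "exp (\<nu> * (t + h)) = exp (\<nu> * t) * exp (\<nu> * h)" by (simp add: exp_add[symmetric] algebra_simps)
    then show ?case using False elim unfolding decay_def by (simp add: field_simps)
  qed
  ultimately have "((\<lambda>t. decay (t + h) / decay t) \<longlongrightarrow> (1 + h * 0) * exp (\<nu> * h)) at_bot"
    by (rule Lim_transform_eventually)
  moreover have "\<nu> - \<mu> = \<nu>" using \<mu>0 by linarith
  ultimately show ?thesis by simp
qed

end

subsection \<open>Classification of the solutions\<close>

sublocale emden \<subseteq> ode: emden_ode q \<mu> \<nu> ell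
  using q \<mu> \<nu> ell by unfold_locales auto

context emden
begin

lemma ratio_bounds:
  assumes "sol u" "x \<noteq> 0"
  shows "0 < ratio u x" "ratio u x \<le> 1"
  using solD(1)[OF assms] sol_le_U[OF assms] U_pos[OF assms(2)] by (simp_all add: ratio_def)

lemma sol_power:
  assumes "sol u" "x \<noteq> 0"
  shows "norm x powr \<theta> * u x powr q = ell / (norm x)\<^sup>2 * U x * ratio u x powr q"
proof -
  have "ratio u x \<ge> 0" using ratio_bounds[OF assms] by simp
  from U_power[OF assms(2) this] show ?thesis using ratio_eq[OF assms(2), of u] by simp
qed

text \<open>Both solutions and differences of ordered solutions satisfy a linear equation with a potential of size
  \<open>1/|x|\<^sup>2\<close>, because all solutions lie below \<open>U\<close>.\<close>

lemma harnack_solutions: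
  obtains H where "H \<ge> 1"
    "\<And>u x y. sol u \<Longrightarrow> x \<noteq> 0 \<Longrightarrow> norm x = norm y \<Longrightarrow> u x \<le> H * u y"
    "\<And>u v x y. sol u \<Longrightarrow> sol v \<Longrightarrow> (\<And>z. z \<noteq> 0 \<Longrightarrow> u z \<le> v z) \<Longrightarrow> x \<noteq> 0 \<Longrightarrow> norm x = norm y \<Longrightarrow>
       v x - u x \<le> H * (v y - u y)"
proof -
  \<comment> \<open>|\<lambda>| bounds the linear term, and ell q is the Lipschitz constant of ell
    w^q on [0,1].\<close>
  define K where "K = \<bar>lam\<bar> + ell * q"
  have K: "K \<ge> 0" unfolding K_def using ellpos q by simp
  obtain H where H: "H > 0" "\<And>(v :: 'a \<Rightarrow> real) \<beta> x y. weak_poisson (- {0}) v \<beta> \<Longrightarrow> (\<And>x. x \<noteq> 0 \<Longrightarrow> 0 \<le> v x) \<Longrightarrow>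
      (\<And>x. x \<noteq> 0 \<Longrightarrow> \<bar>\<beta> x\<bar> \<le> K / (norm x)\<^sup>2 * v x) \<Longrightarrow> x \<noteq> 0 \<Longrightarrow> norm x = norm y \<Longrightarrow> v x \<le> H * v y"
    using harnack_sphere[OF dim K] by metis
  have op: "open (- {0::'a})" by (intro open_Compl closed_singleton)
  have lin: "\<bar>lam / (norm x)\<^sup>2 * z - P\<bar> \<le> K / (norm x)\<^sup>2 * z"
    if "0 \<le> z" "0 \<le> P" "P \<le> ell * q / (norm x)\<^sup>2 * z" for z P and x :: 'a
  proof -
    have "\<bar>lam / (norm x)\<^sup>2 * z\<bar> = \<bar>lam\<bar> / (norm x)\<^sup>2 * z" using that by (simp add: abs_mult)
    moreover have "\<bar>lam\<bar> / (norm x)\<^sup>2 * z + ell * q / (norm x)\<^sup>2 * z = K / (norm x)\<^sup>2 * z"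
      by (simp add: K_def add_divide_distrib distrib_right)
    ultimately show ?thesis using that by linarith
  qed
  have D: "v x - u x \<le> H * (v y - u y)"
    if u: "sol u" and v: "sol v" and le: "\<And>z. z \<noteq> 0 \<Longrightarrow> u z \<le> v z" and x: "x \<noteq> 0" "norm x = norm y" for u v x y
  proof (rule H(2)[OF weak_poisson_diff[OF solD(2)[OF v] solD(2)[OF u] op] _ _ x])
    show "0 \<le> v x - u x" if "x \<noteq> 0" for x using le[OF that] by simp
    fix x :: 'a assume x: "x \<noteq> 0"
    let ?P = "norm x powr \<theta> * v x powr q - norm x powr \<theta> * u x powr q"
    note bu = ratio_bounds[OF u x] and bv = ratio_bounds[OF v x]
    have le': "ratio u x \<le> ratio v x" using le[OF x] U_pos[OF x] by (simp add: ratio_def divide_right_mono)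
    have k: "0 \<le> ell / (norm x)\<^sup>2 * U x" using ellpos U_pos[OF x] by simp
    have P: "?P = ell / (norm x)\<^sup>2 * U x * (ratio v x powr q - ratio u x powr q)"
      unfolding sol_power[OF u x] sol_power[OF v x] by (simp only: right_diff_distrib)
    have "ratio u x powr q \<le> ratio v x powr q" using le' bu q by (intro powr_mono2) auto
    then have P0: "0 \<le> ?P" unfolding P by (intro mult_nonneg_nonneg[OF k]) simp
    have "ratio v x powr q - ratio u x powr q \<le> q * ratio v x powr (q - 1) * (ratio v x - ratio u x)"
      using bu bv le' q by (intro powr_diff_le) auto
    also have "\<dots> \<le> q * 1 * (ratio v x - ratio u x)"
      using bv le' q by (intro mult_right_mono mult_left_mono) (auto simp: powr_le1)
    finally have "?P \<le> ell / (norm x)\<^sup>2 * U x * (q * (ratio v x - ratio u x))"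
      unfolding P using k by (intro mult_left_mono) auto
    also have "\<dots> = ell * q / (norm x)\<^sup>2 * (U x * ratio v x - U x * ratio u x)"
      by (simp add: algebra_simps)
    also have "\<dots> = ell * q / (norm x)\<^sup>2 * (v x - u x)"
      using ratio_eq[OF x, of u] ratio_eq[OF x, of v] by simp
    finally have P1: "?P \<le> ell * q / (norm x)\<^sup>2 * (v x - u x)" .
    have "\<bar>lam / (norm x)\<^sup>2 * (v x - u x) - ?P\<bar> \<le> K / (norm x)\<^sup>2 * (v x - u x)"
      by (rule lin[OF _ P0 P1]) (use le[OF x] in simp)
    moreover have "lam / (norm x)\<^sup>2 * v x - A - (lam / (norm x)\<^sup>2 * u x - B)
        = lam / (norm x)\<^sup>2 * (v x - u x) - (A - B)" for A B :: real
      by (simp add: right_diff_distrib)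
    ultimately show "\<bar>lam / (norm x)\<^sup>2 * v x - norm x powr \<theta> * v x powr q - (lam / (norm x)\<^sup>2 * u x - norm x powr \<theta> * u x powr q)\<bar>
      \<le> K / (norm x)\<^sup>2 * (v x - u x)"
      by (simp only:)
  qed
  have E: "u x \<le> H * u y" if u: "sol u" and x: "x \<noteq> 0" "norm x = norm y" for u x y
  proof (rule H(2)[OF solD(2)[OF u] _ _ x])
    show "0 \<le> u x" if "x \<noteq> 0" for x using solD(1)[OF u that] by simp
    fix x :: 'a assume x: "x \<noteq> 0"
    note b = ratio_bounds[OF u x]
    have "ratio u x powr q \<le> ratio u x" using b q powr_mono'[of 1 q "ratio u x"] by simp
    also have "\<dots> \<le> q * ratio u x" using b q by simp
    finally have "ell / (norm x)\<^sup>2 * U x * ratio u x powr q \<le> ell / (norm x)\<^sup>2 * U x * (q * ratio u x)"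
      using ellpos U_pos[OF x] by (intro mult_left_mono) auto
    also have "\<dots> = ell * q / (norm x)\<^sup>2 * (U x * ratio u x)" by simp
    also have "\<dots> = ell * q / (norm x)\<^sup>2 * u x" using ratio_eq[OF x, of u] by simp
    finally have "norm x powr \<theta> * u x powr q \<le> ell * q / (norm x)\<^sup>2 * u x" unfolding sol_power[OF u x] .
    then show "\<bar>lam / (norm x)\<^sup>2 * u x - norm x powr \<theta> * u x powr q\<bar> \<le> K / (norm x)\<^sup>2 * u x"
      by (intro lin) (use solD(1)[OF u x] in auto)
  qed
  show ?thesis
  proof (rule that[of "max 1 H"])
    have mx: "H * z \<le> max 1 H * z" if "0 \<le> z" for z using that by (intro mult_right_mono) auto
    fix u :: "'a \<Rightarrow> real" and x y :: 'a
    assume u: "sol u" and x: "x \<noteq> 0" "norm x = norm y"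
    have "y \<noteq> 0" using x by auto
    then show "u x \<le> max 1 H * u y" using E[OF u x] mx[OF less_imp_le[OF solD(1)[OF u \<open>y \<noteq> 0\<close>]]] by linarith
    fix v :: "'a \<Rightarrow> real"
    assume v: "sol v" and le: "\<And>z. z \<noteq> 0 \<Longrightarrow> u z \<le> v z"
    show "v x - u x \<le> max 1 H * (v y - u y)"
    proof -
      have "0 \<le> v y - u y" using le[OF \<open>y \<noteq> 0\<close>] by simp
      from mx[OF this] show ?thesis using D[OF u v le x] by linarith
    qed
  qed simp
qed

text \<open>Beyond some t1 the bound c exp(-\<nu>s) is below e. Up to t1 the set where g >= e is
  compact, and it avoids the boundary sphere because g <= 0 there. So the decay hypothesis of the
  comparison lemmas reduces to an inequality on one sphere.\<close>

lemma half_shell_exhaustion: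
  assumes g: "continuous_on (shell {t0..}) g" and g0: "\<And>x. x \<noteq> 0 \<Longrightarrow> s x = t0 \<Longrightarrow> g x \<le> 0"
    and gU: "\<And>x. x \<noteq> 0 \<Longrightarrow> s x \<ge> t0 \<Longrightarrow> g x \<le> norm x powr a * U x" and e: "e > 0"
  shows "\<exists>K. compact K \<and> K \<subseteq> shell {t0<..} \<and> (\<forall>x\<in>shell {t0<..} - K. g x \<le> e)"
proof -
  obtain t1 where t1: "c * exp (- \<nu> * t1) \<le> e"
  proof
    have "- \<nu> * (ln (c / e) / \<nu>) = ln (e / c)" using \<nu>pos cpos e by (simp add: ln_div)
    then show "c * exp (- \<nu> * (ln (c / e) / \<nu>)) \<le> e" using cpos e by simp
  qed
  let ?K = "shell {t0..t1} \<inter> g -` {e..}"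
  have "continuous_on (shell {t0..t1}) g" by (rule continuous_on_subset[OF g]) (auto simp: shell_def)
  then have "closed ?K"
    by (rule continuous_closed_preimage[OF _ compact_imp_closed[OF compact_shell]]) simp
  then have "compact (shell {t0..t1} \<inter> ?K)" using compact_Int_closed[OF compact_shell] by blast
  then have "compact ?K" by (simp add: inf.absorb2)
  moreover have "?K \<subseteq> shell {t0<..}"
  proof
    fix x assume x: "x \<in> ?K"
    then have "s x \<noteq> t0" using g0[of x] e by (auto simp: shell_def)
    then show "x \<in> shell {t0<..}" using x by (auto simp: shell_def)
  qed
  moreover have "g x \<le> e" if x: "x \<in> shell {t0<..} - ?K" for x
  proof (cases "s x \<le> t1")
    case False
    have "x \<noteq> 0" "s x \<ge> t0" using x by (auto simp: shell_def)
    from gU[OF this] have "g x \<le> c * exp (- \<nu> * s x)" by (simp add: norm_powr_U[OF \<open>x \<noteq> 0\<close>])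
    also have "\<dots> \<le> c * exp (- \<nu> * t1)" using False cpos \<nu>pos by simp
    finally show ?thesis using t1 by simp
  qed (use x in \<open>auto simp: shell_def\<close>)
  ultimately show ?thesis by blast
qed

end

section \<open>Translates of the profile and the classification\<close>

locale emden_profile = emden X q lam \<theta> \<epsilon> a \<mu> \<nu> ell
  for X :: "'a::euclidean_space itself" and q lam \<theta> \<epsilon> a \<mu> \<nu> ell +
  fixes W W1 W2 :: "real \<Rightarrow> real" and k :: real
  assumes W_mono: "mono W" and W_pos: "\<And>t. 0 < W t" and W_le: "\<And>t. W t \<le> 1"
    and W_top: "(W \<longlongrightarrow> 1) at_top" and W_decay: "((\<lambda>t. W t / ode.decay t) \<longlongrightarrow> k) at_bot" and k: "k > 0"
    and W_deriv: "\<And>t. (W has_real_derivative W1 t) (at t)" "\<And>t. (W1 has_real_derivative W2 t) (at t)"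
    and W2_cont: "continuous_on UNIV W2"
    and W_ode: "\<And>t. W2 t - 2 * \<nu> * W1 t + ell * (W t - W t powr q) = 0"
begin

text \<open>As W is nondecreasing, V h is nonincreasing in h: the smallest translate above a
  solution corresponds to a supremum of parameters.\<close>

definition V :: "real \<Rightarrow> 'a \<Rightarrow> real" where "V h x = U x * W (s x - h)"

lemma W_continuous: "isCont W t" using W_deriv(1) DERIV_isCont by blast

lemma W_bot: "(W \<longlongrightarrow> 0) at_bot"
proof -
  have "((\<lambda>t. W t / ode.decay t * ode.decay t) \<longlongrightarrow> k * 0) at_bot"
    by (intro tendsto_mult W_decay ode.decay_tendsto_0)
  moreover have "\<forall>\<^sub>F t in at_bot. W t / ode.decay t * ode.decay t = W t"
    using eventually_gt_at_bot[of 0] by eventually_elim (use ode.decay_pos in force)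
  ultimately show ?thesis using Lim_transform_eventually by fastforce
qed

text \<open>The device that turns constant factors into translations near -infinity.\<close>

lemma W_shift: "((\<lambda>t. W (t + h) / W t) \<longlongrightarrow> exp ((\<nu> - \<mu>) * h)) at_bot"
proof -
  have "filterlim (\<lambda>t. t + h) at_bot at_bot"
    unfolding filterlim_at_bot
  proof
    fix Z
    show "\<forall>\<^sub>F t in at_bot. t + h \<le> Z"
      using eventually_le_at_bot[of "Z - h"] by eventually_elim simp
  qed
  from filterlim_compose[OF W_decay this]
  have "((\<lambda>t. W (t + h) / ode.decay (t + h) * (ode.decay (t + h) / ode.decay t) / (W t / ode.decay t))
     \<longlongrightarrow> k * exp ((\<nu> - \<mu>) * h) / k) at_bot"
    using k by (intro tendsto_divide tendsto_mult W_decay ode.decay_shift) auto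
  moreover have "\<forall>\<^sub>F t in at_bot. W (t + h) / ode.decay (t + h) * (ode.decay (t + h) / ode.decay t) / (W t / ode.decay t)
      = W (t + h) / W t"
    using eventually_gt_at_bot[of "min 0 (- h)"]
  proof eventually_elim
    case (elim t)
    then show ?case using ode.decay_pos[of t] ode.decay_pos[of "t + h"] by simp
  qed
  ultimately have "((\<lambda>t. W (t + h) / W t) \<longlongrightarrow> k * exp ((\<nu> - \<mu>) * h) / k) at_bot"
    by (rule Lim_transform_eventually)
  then show ?thesis using k by simp
qed

lemma V_profile:
  assumes "\<kappa> > 0" "open I"
  shows "profile I (\<lambda>t. \<kappa> * W (t - h)) (\<lambda>t. \<kappa> * W1 (t - h)) (\<lambda>t. \<kappa> * W2 (t - h))"
proof -
  have sh: "((\<lambda>t. t - h) has_real_derivative 1) (at t)" for t by (auto intro!: derivative_eq_intros)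
  have "continuous_on I (\<lambda>t. \<kappa> * W2 (t - h))"
    by (intro continuous_intros continuous_on_compose2[OF W2_cont]) auto
  moreover have "((\<lambda>t. \<kappa> * W (t - h)) has_real_derivative \<kappa> * W1 (t - h)) (at t)"
    "((\<lambda>t. \<kappa> * W1 (t - h)) has_real_derivative \<kappa> * W2 (t - h)) (at t)" for t
    using DERIV_cmult[OF DERIV_chain2[OF W_deriv(1) sh], of \<kappa>]
      DERIV_cmult[OF DERIV_chain2[OF W_deriv(2) sh], of \<kappa>] by simp_all
  ultimately show ?thesis unfolding profile_def using assms W_pos by simp
qed

lemma V_sol: "sol (V h)"
  using profile_sol[OF V_profile[of 1 UNIV h]] W_ode unfolding V_def[abs_def] by simp

lemma V_le_U: "x \<noteq> 0 \<Longrightarrow> V h x \<le> U x"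
  unfolding V_def using U_pos[of x] W_le[of "s x - h"] by (simp add: mult_left_le)

lemma V_pos: "x \<noteq> 0 \<Longrightarrow> 0 < V h x"
  unfolding V_def using U_pos[of x] W_pos[of "s x - h"] by simp

lemma continuous_V: "continuous_on (- {0}) (V h)"
  using solD(3)[OF V_sol] .

text \<open>Both functions lie below U, hence nothing has to be assumed as s tends to
  +infinity.\<close>

lemma above_half:
  assumes u: "sol u" and t0: "\<And>x. x \<noteq> 0 \<Longrightarrow> s x = t0 \<Longrightarrow> u x \<le> V h x" and x: "x \<noteq> 0" "s x \<ge> t0"
  shows "u x \<le> V h x"
proof (cases "s x = t0")
  case False
  then have xs: "x \<in> shell {t0<..}" using x by (simp add: shell_def)
  have sub: "shell {t0..} \<subseteq> - {0}" by (auto simp: shell_def)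
  have "u x \<le> U x * (1 * W (s x - h))"
  proof (rule comparison_above[OF u V_profile[of 1 "{t0<..}"] _ _ xs])
    show "1 * W2 (t - h) - 2 * \<nu> * (1 * W1 (t - h)) + ell * (1 * W (t - h) - (1 * W (t - h)) powr q) \<le> 0" for t
      using W_ode[of "t - h"] by simp
    fix e :: real assume e: "e > 0"
    have "\<exists>K. compact K \<and> K \<subseteq> shell {t0<..} \<and> (\<forall>x\<in>shell {t0<..} - K. norm x powr a * (u x - V h x) \<le> e)"
    proof (rule half_shell_exhaustion[OF _ _ _ e])
      show "continuous_on (shell {t0..}) (\<lambda>x. norm x powr a * (u x - V h x))"
        by (intro continuous_intros continuous_on_subset[OF solD(3)[OF u] sub] continuous_on_subset[OF continuous_V sub])
           (auto simp: shell_def)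
      show "norm x powr a * (u x - V h x) \<le> 0" if "x \<noteq> 0" "s x = t0" for x
        using t0[OF that] by (simp add: mult_nonneg_nonpos)
      show "norm x powr a * (u x - V h x) \<le> norm x powr a * U x" if "x \<noteq> 0" for x
        using sol_le_U[OF u that] V_pos[OF that, of h] by (intro mult_left_mono) auto
    qed
    then show "\<exists>K. compact K \<and> K \<subseteq> shell {t0<..} \<and>
        (\<forall>x\<in>shell {t0<..} - K. norm x powr a * (u x - U x * (1 * W (s x - h))) \<le> e)"
      unfolding V_def by simp
  qed simp_all
  then show ?thesis unfolding V_def by simp
qed (use t0 x in blast)

text \<open>For \<kappa> <= 1 one has \<kappa>^q <= \<kappa>, so \<kappa> V h is a subsolution. The
  factor is what allows an approximate touching on a sphere to be propagated.\<close>

lemma below_half: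
  assumes u: "sol u" and \<kappa>: "0 < \<kappa>" "\<kappa> \<le> 1"
    and t0: "\<And>x. x \<noteq> 0 \<Longrightarrow> s x = t0 \<Longrightarrow> \<kappa> * V h x \<le> u x" and x: "x \<noteq> 0" "s x \<ge> t0"
  shows "\<kappa> * V h x \<le> u x"
proof (cases "s x = t0")
  case False
  then have xs: "x \<in> shell {t0<..}" using x by (simp add: shell_def)
  have sub: "shell {t0..} \<subseteq> - {0}" by (auto simp: shell_def)
  have "U x * (\<kappa> * W (s x - h)) \<le> u x"
  proof (rule comparison_below[OF u V_profile[OF \<kappa>(1), of "{t0<..}"] _ _ xs])
    fix t
    have "\<kappa> powr q \<le> \<kappa>" using \<kappa> q powr_mono'[of 1 q \<kappa>] by simp
    then have "0 \<le> ell * (W (t - h) powr q) * (\<kappa> - \<kappa> powr q)" using ellpos by simp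
    also have "\<dots> = \<kappa> * (W2 (t - h) - 2 * \<nu> * W1 (t - h) + ell * (W (t - h) - W (t - h) powr q))
        + ell * (W (t - h) powr q) * (\<kappa> - \<kappa> powr q)" unfolding W_ode by simp
    also have "\<dots> = \<kappa> * W2 (t - h) - 2 * \<nu> * (\<kappa> * W1 (t - h)) + ell * (\<kappa> * W (t - h) - (\<kappa> * W (t - h)) powr q)"
      using \<kappa> W_pos[of "t - h"] by (simp add: powr_mult algebra_simps)
    finally show "0 \<le> \<kappa> * W2 (t - h) - 2 * \<nu> * (\<kappa> * W1 (t - h)) + ell * (\<kappa> * W (t - h) - (\<kappa> * W (t - h)) powr q)" .
  next
    fix e :: real assume e: "e > 0"
    have "\<exists>K. compact K \<and> K \<subseteq> shell {t0<..} \<and> (\<forall>x\<in>shell {t0<..} - K. norm x powr a * (\<kappa> * V h x - u x) \<le> e)"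
    proof (rule half_shell_exhaustion[OF _ _ _ e])
      show "continuous_on (shell {t0..}) (\<lambda>x. norm x powr a * (\<kappa> * V h x - u x))"
        by (intro continuous_intros continuous_on_subset[OF solD(3)[OF u] sub] continuous_on_subset[OF continuous_V sub])
           (auto simp: shell_def)
      show "norm x powr a * (\<kappa> * V h x - u x) \<le> 0" if "x \<noteq> 0" "s x = t0" for x
        using t0[OF that] by (simp add: mult_nonneg_nonpos)
      show "norm x powr a * (\<kappa> * V h x - u x) \<le> norm x powr a * U x" if "x \<noteq> 0" for x
      proof (rule mult_left_mono)
        have "\<kappa> * V h x \<le> 1 * V h x" using \<kappa> V_pos[OF that, of h] by (intro mult_right_mono) auto
        then show "\<kappa> * V h x - u x \<le> U x" using V_le_U[OF that, of h] solD(1)[OF u that] by linarith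
      qed simp
    qed
    then show "\<exists>K. compact K \<and> K \<subseteq> shell {t0<..} \<and>
        (\<forall>x\<in>shell {t0<..} - K. norm x powr a * (U x * (\<kappa> * W (s x - h)) - u x) \<le> e)"
      unfolding V_def by (simp add: mult.left_commute)
  qed simp
  then show ?thesis unfolding V_def by (simp add: mult.left_commute)
qed (use t0 x in blast)

lemma le_V_iff: "x \<noteq> 0 \<Longrightarrow> u x \<le> V h x \<longleftrightarrow> ratio u x \<le> W (s x - h)"
  unfolding V_def ratio_def using U_pos[of x] by (simp add: field_simps)

lemma V_le_iff: "x \<noteq> 0 \<Longrightarrow> V h x \<le> u x \<longleftrightarrow> W (s x - h) \<le> ratio u x"
  unfolding V_def ratio_def using U_pos[of x] by (simp add: field_simps)

lemma W_below: "m > 0 \<Longrightarrow> \<exists>t0. \<forall>t\<le>t0. W t < m"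
  using order_tendstoD(2)[OF W_bot, of m] unfolding eventually_at_bot_linorder .

lemma W_above: "m < 1 \<Longrightarrow> \<exists>t0. \<forall>t\<ge>t0. m < W t"
  using order_tendstoD(1)[OF W_top, of m] unfolding eventually_at_top_linorder .

text \<open>On each sphere s = t0 far to the left, the translate with the value W \<tau> < m lies
  below u, and it stays below for all larger s. As t0 goes to -infinity these translates increase to
  U.\<close>

lemma strong_solution:
  assumes u: "sol u" and m: "m > 0" "\<And>x. x \<noteq> 0 \<Longrightarrow> s x \<le> t1 \<Longrightarrow> m \<le> ratio u x" and x: "x \<noteq> 0"
  shows "u x = U x"
proof -
  obtain \<tau> where \<tau>: "W \<tau> < m" using W_below[OF m(1)] by blast
  have "W (s x - (t0 - \<tau>)) \<le> ratio u x" if t0: "t0 \<le> min t1 (s x)" for t0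
  proof -
    have "1 * V (t0 - \<tau>) x \<le> u x"
    proof (rule below_half[OF u _ _ _ x])
      fix y :: 'a assume y: "y \<noteq> 0" "s y = t0"
      then have "W \<tau> \<le> ratio u y" using m(2)[of y] \<tau> t0 by simp
      then show "1 * V (t0 - \<tau>) y \<le> u y" using V_le_iff[OF y(1), of "t0 - \<tau>" u] y by simp
    qed (use t0 in auto)
    then show ?thesis using V_le_iff[OF x] by simp
  qed
  then have "\<forall>\<^sub>F t0 in at_bot. W (s x - (t0 - \<tau>)) \<le> ratio u x"
    unfolding eventually_at_bot_linorder by blast
  moreover have "filterlim (\<lambda>t0. s x - (t0 - \<tau>)) at_top at_bot"
    unfolding filterlim_at_top
  proof
    fix Z
    show "\<forall>\<^sub>F t in at_bot. Z \<le> s x - (t - \<tau>)"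
      using eventually_le_at_bot[of "s x + \<tau> - Z"] by eventually_elim simp
  qed
  from filterlim_compose[OF W_top this]
  have "((\<lambda>t0. W (s x - (t0 - \<tau>))) \<longlongrightarrow> 1) at_bot" .
  ultimately have "1 \<le> ratio u x" by (intro tendsto_upperbound) auto
  then have "ratio u x = 1" using ratio_bounds[OF u x] by simp
  then show ?thesis using ratio_eq[OF x, of u] by simp
qed

lemma W_attains:
  assumes "0 < m" "m < 1"
  obtains t where "W t = m"
proof -
  obtain t0 where t0: "W t0 < m" using W_below[OF assms(1)] by blast
  obtain t1 where t1: "m < W t1" using W_above[OF assms(2)] by blast
  have "t0 \<le> t1"
  proof (rule ccontr)
    assume "\<not> t0 \<le> t1"
    then have "W t1 \<le> W t0" by (intro monoD[OF W_mono]) simp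
    then show False using t0 t1 by simp
  qed
  then obtain t where "W t = m"
    using IVT[of W t0 m t1] t0 t1 W_continuous by force
  then show ?thesis by (rule that)
qed

text \<open>On a sphere where u/U is small, Harnack's inequality sandwiches u between the translates
  V h and V (h - d), with d independent of the sphere. The lower one, evaluated at a fixed point x1,
  bounds h from below independently of the sphere; the upper ones therefore all lie below one fixed
  translate.\<close>

lemma weak_solution_upper_bound:
  assumes u: "sol u" and small: "\<And>m t1. m > 0 \<Longrightarrow> \<exists>x. x \<noteq> 0 \<and> s x \<le> t1 \<and> ratio u x < m"
  shows "\<exists>h. \<forall>x. x \<noteq> 0 \<longrightarrow> u x \<le> V h x"
proof -
  obtain H where H: "H \<ge> 1" "\<And>u x y. sol u \<Longrightarrow> x \<noteq> 0 \<Longrightarrow> norm x = norm y \<Longrightarrow> u x \<le> H * u y"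
    using harnack_solutions by metis
  \<comment> \<open>Makes the limiting shift factor 2H^2, strictly above the H^2 lost by using
    Harnack's inequality once on either side.\<close>
  define d where "d = ln (2 * H * H) / (\<nu> - \<mu>)"
  have "1 * 1 \<le> H * H" using H(1) by (intro mult_mono) auto
  then have HH: "H * H \<ge> 1" by simp
  have "exp ((\<nu> - \<mu>) * d) = 2 * H * H" using \<nu> HH unfolding d_def by (simp add: mult.assoc)
  then have "exp ((\<nu> - \<mu>) * d) > H * H" using HH by simp
  from order_tendstoD(1)[OF W_shift this]
  obtain t2 where t2: "\<And>t. t \<le> t2 \<Longrightarrow> H * H < W (t + d) / W t"
    unfolding eventually_at_bot_linorder by blast
  obtain x1 where x1: "x1 \<noteq> 0" "ratio u x1 < 1" using small[of 1 0] by auto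
  obtain \<tau>1 where \<tau>1: "ratio u x1 < W \<tau>1" using W_above[OF x1(2)] by blast
  have "u x \<le> V (s x1 - \<tau>1 - d) x" if x: "x \<noteq> 0" for x
  proof -
    \<comment> \<open>The threshold \<open>H * W t2\<close> forces the matching level \<tau> to lie
      to the left of t2, where the shift estimate is valid.\<close>
    obtain y where y: "y \<noteq> 0" "s y \<le> min (s x) (s x1)" "ratio u y < H * W t2"
      using small[of "H * W t2" "min (s x) (s x1)"] H(1) W_pos[of t2] by auto
    have ry: "0 < ratio u y" "ratio u y \<le> 1" using ratio_bounds[OF u y(1)] by auto
    have "ratio u y / H < W t2" using y(3) H(1) by (simp add: field_simps)
    then have "ratio u y / H < 1" using W_le[of t2] by linarith
    moreover have "0 < ratio u y / H" using ry H(1) by simp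
    ultimately obtain \<tau> where \<tau>: "W \<tau> = ratio u y / H"
      using W_attains by blast
    have \<tau>2: "\<tau> \<le> t2"
    proof (rule ccontr)
      assume "\<not> \<tau> \<le> t2"
      then have "W t2 \<le> W \<tau>" by (intro monoD[OF W_mono]) simp
      then show False using \<tau> \<open>ratio u y / H < W t2\<close> by simp
    qed
    define h where "h = s y - \<tau>"
    have same: "ratio u z \<le> H * ratio u y" "ratio u y \<le> H * ratio u z" if z: "z \<noteq> 0" "s z = s y" for z
    proof -
      have n: "norm z = norm y" using norm_s[OF z(1)] norm_s[OF y(1)] z(2) by simp
      then have "U z = U y" by (simp add: U_def)
      moreover have "u z \<le> H * u y" "u y \<le> H * u z"
        using H(2)[OF u z(1) n] H(2)[OF u y(1) n[symmetric]] by auto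
      ultimately show "ratio u z \<le> H * ratio u y" "ratio u y \<le> H * ratio u z"
        unfolding ratio_def using U_pos[OF y(1)] by (simp_all add: divide_right_mono)
    qed
    \<comment> \<open>This limits how far to the left the translate can sit: V h may not exceed u at
      x1.\<close>
    have "1 * V h x1 \<le> u x1"
    proof (rule below_half[OF u, where ?t0.0 = "s y"])
      fix z :: 'a assume z: "z \<noteq> 0" "s z = s y"
      have "ratio u y / H \<le> ratio u z" using same(2)[OF z] H(1) by (simp add: divide_le_eq mult.commute)
      then have "W \<tau> \<le> ratio u z" unfolding \<tau> .
      then show "1 * V h z \<le> u z" using V_le_iff[OF z(1), of h u] z by (simp add: h_def)
    qed (use x1 y in auto)
    then have "W (s x1 - h) < W \<tau>1" using V_le_iff[OF x1(1), of h u] \<tau>1 by simp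
    then have "s x1 - h \<le> \<tau>1"
      using monoD[OF W_mono, of \<tau>1 "s x1 - h"] by linarith
    moreover have "u x \<le> V (h - d) x"
    proof (rule above_half[OF u, where ?t0.0 = "s y"])
      fix z :: 'a assume z: "z \<noteq> 0" "s z = s y"
      have "H * H * W \<tau> < W (\<tau> + d)" using t2[OF \<tau>2] W_pos[of \<tau>] by (simp add: field_simps)
      moreover have "ratio u z \<le> H * H * W \<tau>" using same(1)[OF z] \<tau> H(1) by simp
      ultimately show "u z \<le> V (h - d) z" using le_V_iff[OF z(1), of u "h - d"] z by (simp add: h_def)
    qed (use x y in auto)
    moreover have "V (h - d) x \<le> V (s x1 - \<tau>1 - d) x"
      unfolding V_def using U_pos[OF x] \<open>s x1 - h \<le> \<tau>1\<close> by (intro mult_left_mono monoD[OF W_mono]) auto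
    ultimately show ?thesis by linarith
  qed
  then show ?thesis by blast
qed

theorem classification:
  assumes u: "sol u"
  shows "(\<forall>x. x \<noteq> 0 \<longrightarrow> u x = U x) \<or> (\<exists>h. \<forall>x. x \<noteq> 0 \<longrightarrow> u x = V h x)"
proof (cases "\<exists>m>0. \<exists>t1. \<forall>x. x \<noteq> 0 \<longrightarrow> s x \<le> t1 \<longrightarrow> m \<le> ratio u x")
  case True
  then show ?thesis using strong_solution[OF u] by blast
next
  case False
  define S where "S = {h. \<forall>x. x \<noteq> 0 \<longrightarrow> u x \<le> V h x}"
  have "\<exists>h. \<forall>x. x \<noteq> 0 \<longrightarrow> u x \<le> V h x"
    by (rule weak_solution_upper_bound[OF u]) (use False in \<open>force simp: not_le\<close>)
  then have ne: "S \<noteq> {}" unfolding S_def by blast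
  obtain x1 :: 'a where x1: "x1 \<noteq> 0" using ex_s by blast
  obtain \<tau> where \<tau>: "W \<tau> < ratio u x1" using W_below[OF ratio_bounds(1)[OF u x1]] by blast
  \<comment> \<open>At the fixed point x1 translates with large h are smaller than u, so the
    admissible parameters are bounded above.\<close>
  have "h \<le> s x1 - \<tau>" if "h \<in> S" for h
  proof (rule ccontr)
    assume "\<not> h \<le> s x1 - \<tau>"
    then have "W (s x1 - h) \<le> W \<tau>" by (intro monoD[OF W_mono]) simp
    moreover have "ratio u x1 \<le> W (s x1 - h)" using that x1 le_V_iff[OF x1] unfolding S_def by blast
    ultimately show False using \<tau> by simp
  qed
  then have bdd: "bdd_above S" by (rule bdd_aboveI)
  define h where "h = Sup S"
  have below: "u x \<le> V h' x" if "h' < h" "x \<noteq> 0" for h' x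
  proof -
    obtain h'' where "h'' \<in> S" "h' < h''" using less_cSupD[OF ne, of h'] \<open>h' < h\<close> unfolding h_def by blast
    then have "u x \<le> V h'' x" "W (s x - h'') \<le> W (s x - h')"
      using \<open>x \<noteq> 0\<close> monoD[OF W_mono, of "s x - h''" "s x - h'"] unfolding S_def by auto
    then show ?thesis using le_V_iff[OF \<open>x \<noteq> 0\<close>] by fastforce
  qed
  \<comment> \<open>The supremum is itself admissible, by continuity of W as the parameter increases
    to h.\<close>
  have uV: "u x \<le> V h x" if x: "x \<noteq> 0" for x
  proof -
    have "((\<lambda>h'. W (s x - h')) \<longlongrightarrow> W (s x - h)) (at_left h)"
      by (rule isCont_tendsto_compose[OF W_continuous]) (auto intro!: tendsto_intros)
    moreover have "\<forall>\<^sub>F h' in at_left h. h' < h" by (simp add: eventually_at_filter)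
    then have "\<forall>\<^sub>F h' in at_left h. ratio u x \<le> W (s x - h')"
      by eventually_elim (use below[OF _ x] le_V_iff[OF x] in blast)
    ultimately have "ratio u x \<le> W (s x - h)" by (intro tendsto_lowerbound) auto
    then show ?thesis using le_V_iff[OF x] by simp
  qed
  obtain H where H: "H \<ge> 1"
    "\<And>u v x y. sol u \<Longrightarrow> sol v \<Longrightarrow> (\<And>z. z \<noteq> 0 \<Longrightarrow> u z \<le> v z) \<Longrightarrow> x \<noteq> 0 \<Longrightarrow> norm x = norm y \<Longrightarrow>
       v x - u x \<le> H * (v y - u y)"
    using harnack_solutions by metis
  have Vsame: "V h z = V h y" if "norm z = norm y" for z y
    using that by (simp add: V_def U_def s_def)
  \<comment> \<open>If the relative gap between V h and u stayed at least \<delta> near -infinity,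
    the factor 1 - \<delta> could be spent on a further shift by some d > 0, and h + d would be
    admissible.\<close>
  have touch: "\<exists>x. x \<noteq> 0 \<and> s x \<le> t1 \<and> V h x - u x < \<delta> * V h x" if \<delta>: "\<delta> > 0" for \<delta> t1
  proof (rule ccontr)
    assume no: "\<not> ?thesis"
    define \<delta>' where "\<delta>' = min \<delta> (1/2)"
    have \<delta>': "0 < \<delta>'" "\<delta>' < 1" "\<delta>' \<le> \<delta>" using \<delta> by (auto simp: \<delta>'_def)
    \<comment> \<open>Gives the limiting shift factor 1 - \<delta>'/2, strictly above the required 1
      - \<delta>'.\<close>
    define d where "d = - ln (1 - \<delta>' / 2) / (\<nu> - \<mu>)"
    have d: "d > 0" using \<delta>' \<nu> by (auto simp: d_def intro!: divide_neg_pos)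
    have "exp ((\<nu> - \<mu>) * - d) = 1 - \<delta>' / 2" using \<delta>' \<nu> by (simp add: d_def)
    then have "exp ((\<nu> - \<mu>) * - d) > 1 - \<delta>'" using \<delta>' by simp
    from order_tendstoD(1)[OF W_shift this]
    obtain t2 where t2: "\<And>t. t \<le> t2 \<Longrightarrow> 1 - \<delta>' < W (t + - d) / W t"
      unfolding eventually_at_bot_linorder by blast
    define t0 where "t0 = min t1 (t2 + h)"
    have "u x \<le> V (h + d) x" if x: "x \<noteq> 0" "s x \<le> t0" for x
    proof -
      have "\<delta> * V h x \<le> V h x - u x" using no x by (force simp: t0_def not_less)
      moreover have "\<delta>' * V h x \<le> \<delta> * V h x" using \<delta>' V_pos[OF x(1), of h] by (intro mult_right_mono) auto
      ultimately have "u x \<le> (1 - \<delta>') * V h x" by (simp add: algebra_simps)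
      also have "\<dots> = U x * ((1 - \<delta>') * W (s x - h))" by (simp add: V_def)
      also have "\<dots> \<le> U x * W (s x - (h + d))"
      proof (intro mult_left_mono)
        have "1 - \<delta>' < W (s x - h + - d) / W (s x - h)" by (rule t2) (use x in \<open>simp add: t0_def\<close>)
        then show "(1 - \<delta>') * W (s x - h) \<le> W (s x - (h + d))"
          using W_pos[of "s x - h"] by (simp add: field_simps)
      qed (use U_pos[OF x(1)] in simp)
      finally show ?thesis by (simp add: V_def)
    qed
    then have "u x \<le> V (h + d) x" if "x \<noteq> 0" for x
      using above_half[OF u, of t0 "h + d" x] that by (cases "s x \<le> t0") auto
    then have "h + d \<in> S" unfolding S_def by blast
    then have "h + d \<le> h" unfolding h_def using bdd by (rule cSup_upper)
    then show False using d by simp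
  qed
  \<comment> \<open>A gap of \<delta>/H at one point of a sphere is a gap of at most \<delta> on all
    of it, by Harnack's inequality for V h - u. Then (1 - \<delta>) V h <= u propagates to x, and
    \<delta> tends to 0.\<close>
  have "V h x \<le> u x" if x: "x \<noteq> 0" for x
  proof -
    have "(1 - \<delta>) * V h x \<le> u x" if \<delta>: "0 < \<delta>" "\<delta> < 1" for \<delta>
    proof -
      obtain y where y: "y \<noteq> 0" "s y \<le> s x" "V h y - u y < \<delta> / H * V h y"
        using touch[of "\<delta> / H" "s x"] \<delta> H(1) by auto
      show ?thesis
      proof (rule below_half[OF u, where ?t0.0 = "s y"])
        fix z :: 'a assume z: "z \<noteq> 0" "s z = s y"
        have n: "norm z = norm y" using norm_s[OF z(1)] norm_s[OF y(1)] z(2) by simp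
        have "V h z - u z \<le> H * (V h y - u y)" by (rule H(2)[OF u V_sol uV z(1) n])
        also have "\<dots> \<le> H * (\<delta> / H * V h y)" using y(3) H(1) by (intro mult_left_mono) auto
        also have "\<dots> = \<delta> * V h z" using H(1) Vsame[OF n] by simp
        finally show "(1 - \<delta>) * V h z \<le> u z" by (simp add: algebra_simps)
      qed (use \<delta> x y in auto)
    qed
    then have "\<forall>\<^sub>F \<delta> in at_right 0. (1 - \<delta>) * V h x \<le> u x"
      unfolding eventually_at_right[OF zero_less_one] by (intro exI[of _ 1]) auto
    moreover have "((\<lambda>\<delta>. (1 - \<delta>) * V h x) \<longlongrightarrow> (1 - 0) * V h x) (at_right 0)"
      by (intro tendsto_intros)
    ultimately have "(1 - 0) * V h x \<le> u x" by (intro tendsto_upperbound[where F = "at_right 0"]) auto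
    then show ?thesis by simp
  qed
  then have "u x = V h x" if "x \<noteq> 0" for x using uV that by (simp add: antisym)
  then show ?thesis by blast
qed

end

section \<open>Normalization at the singular end and the solution family\<close>

context emden
begin

lemma sol_cong:
  assumes "sol u" "\<And>x. x \<noteq> 0 \<Longrightarrow> v x = u x"
  shows "sol v"
  unfolding sol_def
proof (intro conjI allI impI)
  show "0 < v x" if "x \<noteq> 0" for x using solD(1)[OF assms(1) that] assms(2)[OF that] by simp
  show "weak_poisson (- {0}) v (\<lambda>x. lam / (norm x)\<^sup>2 * v x - norm x powr \<theta> * v x powr q)"
    by (rule weak_poisson_cong[OF solD(2)[OF assms(1)] open_Compl[OF closed_singleton]])
       (use assms(2) in auto)
qed

text \<open>This is \<open>u/\<Phi>\<^sup>+\<close> in Case \<open>M\<^sub>2\<close> and the quotient prescribed at infinity in Case \<open>M\<^sub>1\<close>.\<close>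

definition normalized :: "('a \<Rightarrow> real) \<Rightarrow> 'a \<Rightarrow> real" where
  "normalized u x = norm x powr a * u x * (if \<mu> > 0 then exp (\<mu> * s x) else - 1 / s x)"

lemma normalized_eq: "x \<noteq> 0 \<Longrightarrow> normalized u x = c * (ratio u x / ode.decay (s x))"
proof -
  assume x: "x \<noteq> 0"
  have "normalized u x = norm x powr a * U x * ratio u x * (if \<mu> > 0 then exp (\<mu> * s x) else - 1 / s x)"
    unfolding normalized_def by (subst ratio_eq[OF x, of u]) simp
  also have "\<dots> = c * (ratio u x * (exp (- \<nu> * s x) * (if \<mu> > 0 then exp (\<mu> * s x) else - 1 / s x)))"
    unfolding norm_powr_U[OF x] by simp
  also have "exp (- \<nu> * s x) * (if \<mu> > 0 then exp (\<mu> * s x) else - 1 / s x) = 1 / ode.decay (s x)"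
    by (simp add: ode.decay_def exp_minus exp_diff left_diff_distrib field_simps)
  finally show ?thesis by simp
qed

end

context emden_profile
begin

text \<open>Inverts h -> c k exp(-(\<nu> - \<mu>) h), the normalized limit of V h, so that the
  parameter becomes the prescribed limit.\<close>

definition family :: "real \<Rightarrow> 'a \<Rightarrow> real" where
  "family \<gamma> = V (- ln (\<gamma> / (c * k)) / (\<nu> - \<mu>))"

lemma ratio_V: "x \<noteq> 0 \<Longrightarrow> ratio (V h) x = W (s x - h)"
  unfolding ratio_def V_def using U_pos[of x] by simp

lemma V_eq_family: "V h = family (c * k * exp (- ((\<nu> - \<mu>) * h)))"
  unfolding family_def using cpos k \<nu> by simp

lemma normalized_V_limit:
  assumes s: "filterlim s at_bot F" and F: "eventually (\<lambda>x. x \<noteq> 0) F"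
  shows "(normalized (V h) \<longlongrightarrow> c * k * exp (- ((\<nu> - \<mu>) * h))) F"
proof -
  have sh: "filterlim (\<lambda>t. t + - h) at_bot at_bot"
    unfolding filterlim_at_bot
  proof
    fix Z
    show "\<forall>\<^sub>F t in at_bot. t + - h \<le> Z"
      using eventually_le_at_bot[of "Z + h"] by eventually_elim simp
  qed
  have "((\<lambda>t. c * (W (t + - h) / ode.decay (t + - h) * (ode.decay (t + - h) / ode.decay t)))
      \<longlongrightarrow> c * (k * exp ((\<nu> - \<mu>) * - h))) at_bot"
    by (intro tendsto_mult tendsto_const filterlim_compose[OF W_decay sh] ode.decay_shift)
  moreover have "\<forall>\<^sub>F t in at_bot. c * (W (t + - h) / ode.decay (t + - h) * (ode.decay (t + - h) / ode.decay t))
      = c * (W (t - h) / ode.decay t)"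
    using eventually_gt_at_bot[of "min 0 h"]
  proof eventually_elim
    case (elim t)
    then show ?case using ode.decay_pos[of "t + - h"] by simp
  qed
  ultimately have "((\<lambda>t. c * (W (t - h) / ode.decay t)) \<longlongrightarrow> c * (k * exp ((\<nu> - \<mu>) * - h))) at_bot"
    by (rule Lim_transform_eventually)
  from filterlim_compose[OF this s]
  have "((\<lambda>x. c * (W (s x - h) / ode.decay (s x))) \<longlongrightarrow> c * k * exp (- ((\<nu> - \<mu>) * h))) F"
    by (simp add: mult.assoc)
  then show ?thesis
    by (rule Lim_transform_eventually) (use F in eventually_elim, simp add: normalized_eq ratio_V)
qed

lemma normalized_family_limit:
  assumes "filterlim s at_bot F" "eventually (\<lambda>x. x \<noteq> 0) F" "\<gamma> > 0"
  shows "(normalized (family \<gamma>) \<longlongrightarrow> \<gamma>) F"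
  using normalized_V_limit[OF assms(1,2), of "- ln (\<gamma> / (c * k)) / (\<nu> - \<mu>)"] assms(3) cpos k \<nu>
  unfolding family_def by simp

text \<open>The normalized quotient of U is c divided by a function that tends to 0, so it has no
  finite limit. This excludes U when uniqueness is read off from the classification.\<close>

lemma normalized_U_no_limit:
  assumes s: "filterlim s at_bot F" and F: "eventually (\<lambda>x. x \<noteq> 0) F" "F \<noteq> bot"
    and u: "\<And>x. x \<noteq> 0 \<Longrightarrow> u x = U x"
  shows "\<not> (normalized u \<longlongrightarrow> \<gamma>) F"
proof
  assume "(normalized u \<longlongrightarrow> \<gamma>) F"
  then have "((\<lambda>x. normalized u x * ode.decay (s x)) \<longlongrightarrow> \<gamma> * 0) F"
    by (intro tendsto_mult filterlim_compose[OF ode.decay_tendsto_0 s])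
  moreover have "\<forall>\<^sub>F x in F. s x < 0"
    using s eventually_gt_at_bot[of 0] unfolding filterlim_iff by blast
  with F(1) have "\<forall>\<^sub>F x in F. normalized u x * ode.decay (s x) = c"
  proof eventually_elim
    case (elim x)
    then show ?case
      using u[of x] U_pos[of x] ode.decay_pos[of "s x"] by (simp add: normalized_eq ratio_def)
  qed
  ultimately have "((\<lambda>x. c) \<longlongrightarrow> \<gamma> * 0) F" by (rule Lim_transform_eventually)
  then have "c = 0" using F(2) by (simp add: tendsto_const_iff)
  then show False using cpos by simp
qed

lemma solutions:
  "sol u \<longleftrightarrow> agree u U \<or> (\<exists>\<gamma>>0. agree u (family \<gamma>))"
proof
  assume "sol u"
  then show "agree u U \<or> (\<exists>\<gamma>>0. agree u (family \<gamma>))"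
    using classification[of u] V_eq_family cpos k unfolding agree_def by (metis exp_gt_zero mult_pos_pos)
next
  have "sol (family \<gamma>)" for \<gamma> unfolding family_def by (rule V_sol)
  moreover assume "agree u U \<or> (\<exists>\<gamma>>0. agree u (family \<gamma>))"
  ultimately show "sol u" using sol_cong U_sol unfolding agree_def by metis
qed

lemma family_unique:
  assumes s: "filterlim s at_bot F" and F: "eventually (\<lambda>x. x \<noteq> 0) F" "F \<noteq> bot"
    and u: "sol u" "(normalized u \<longlongrightarrow> \<gamma>) F"
  shows "agree u (family \<gamma>)"
proof -
  have "\<not> agree u U" using normalized_U_no_limit[OF s F] u(2) unfolding agree_def by blast
  then obtain \<gamma>' where \<gamma>': "\<gamma>' > 0" "agree u (family \<gamma>')" using u(1) solutions by blast
  have "\<forall>\<^sub>F x in F. normalized (family \<gamma>') x = normalized u x"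
    using F(1) by eventually_elim (use \<gamma>'(2) in \<open>simp add: normalized_def agree_def\<close>)
  from Lim_transform_eventually[OF normalized_family_limit[OF s F(1) \<gamma>'(1)] this]
  have "\<gamma>' = \<gamma>" using tendsto_unique[OF F(2) _ u(2)] by blast
  then show ?thesis using \<gamma>' by simp
qed

lemma solution_ratio_limit:
  assumes s: "filterlim s at_top G" and G: "eventually (\<lambda>x. x \<noteq> 0) G" and u: "sol u"
  shows "((\<lambda>x. u x / U x) \<longlongrightarrow> 1) G"
proof (cases "agree u U")
  case True
  have "\<forall>\<^sub>F x in G. 1 = u x / U x"
    using G by eventually_elim (use True U_pos in \<open>force simp: agree_def\<close>)
  then show ?thesis by (rule Lim_transform_eventually[OF tendsto_const])
next
  case False
  then obtain h where h: "\<And>x. x \<noteq> 0 \<Longrightarrow> u x = V h x"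
    using classification[OF u] unfolding agree_def by blast
  have "filterlim (\<lambda>x. - h + s x) at_top G" by (rule filterlim_tendsto_add_at_top[OF tendsto_const s])
  from filterlim_compose[OF W_top this] have "((\<lambda>x. W (- h + s x)) \<longlongrightarrow> 1) G" .
  moreover have "\<forall>\<^sub>F x in G. W (- h + s x) = u x / U x"
    using G by eventually_elim (use h U_pos in \<open>force simp: V_def\<close>)
  ultimately show ?thesis by (rule Lim_transform_eventually)
qed

lemma solution_radial: "sol u \<Longrightarrow> radially_symmetric u"
proof -
  assume "sol u"
  then have "(\<forall>x. x \<noteq> 0 \<longrightarrow> u x = U x) \<or> (\<exists>h. \<forall>x. x \<noteq> 0 \<longrightarrow> u x = V h x)" by (rule classification)
  then show ?thesis unfolding radially_symmetric_def by (auto simp: V_def U_def s_def)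
qed

lemma family_mono:
  assumes "0 < \<gamma>" "\<gamma> < \<gamma>'" "x \<noteq> 0"
  shows "family \<gamma> x \<le> family \<gamma>' x" "family \<gamma>' x \<le> U x"
proof -
  have "ln (\<gamma> / (c * k)) \<le> ln (\<gamma>' / (c * k))" using assms cpos k by (simp add: divide_right_mono)
  then have "- ln (\<gamma>' / (c * k)) / (\<nu> - \<mu>) \<le> - ln (\<gamma> / (c * k)) / (\<nu> - \<mu>)"
    using \<nu> by (intro divide_right_mono) auto
  then show "family \<gamma> x \<le> family \<gamma>' x"
    unfolding family_def V_def using U_pos[OF assms(3)]
    by (intro mult_left_mono monoD[OF W_mono]) auto
  show "family \<gamma>' x \<le> U x" unfolding family_def by (rule V_le_U[OF assms(3)])
qed

lemma family_limit:
  assumes "x \<noteq> 0"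
  shows "((\<lambda>\<gamma>. family \<gamma> x) \<longlongrightarrow> U x) at_top"
proof -
  have "filterlim (\<lambda>\<gamma>. (1 / (c * k)) * \<gamma>) at_top at_top"
    by (rule filterlim_tendsto_pos_mult_at_top[OF tendsto_const _ filterlim_ident]) (use cpos k in simp)
  from filterlim_compose[OF ln_at_top this]
  have "filterlim (\<lambda>\<gamma>. 1 / (\<nu> - \<mu>) * ln (1 / (c * k) * \<gamma>)) at_top at_top"
    by (rule filterlim_tendsto_pos_mult_at_top[OF tendsto_const, rotated]) (use \<nu> in simp)
  from filterlim_tendsto_add_at_top[OF tendsto_const this]
  have "filterlim (\<lambda>\<gamma>. s x + 1 / (\<nu> - \<mu>) * ln (1 / (c * k) * \<gamma>)) at_top at_top" .
  from filterlim_compose[OF W_top this]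
  have "((\<lambda>\<gamma>. U x * W (s x + 1 / (\<nu> - \<mu>) * ln (1 / (c * k) * \<gamma>))) \<longlongrightarrow> U x * 1) at_top"
    by (intro tendsto_intros)
  then show ?thesis by (simp add: family_def V_def)
qed

end

context emden
begin

text \<open>F and G stand for the ends s -> -infinity and s -> +infinity. They are
  \<open>at 0\<close> and \<open>at_infinity\<close> for \<epsilon> = 1 and change places for
  \<epsilon> = -1, so one statement serves both cases.\<close>

lemma solution_structure:
  assumes F: "filterlim s at_bot F" "eventually (\<lambda>x. x \<noteq> 0) F" "F \<noteq> bot"
    and G: "filterlim s at_top G" "eventually (\<lambda>x. x \<noteq> 0) G"
  shows "\<exists>u :: real \<Rightarrow> 'a \<Rightarrow> real.
    (\<forall>\<gamma>>0. sol (u \<gamma>) \<and> (normalized (u \<gamma>) \<longlongrightarrow> \<gamma>) F \<and>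
       (\<forall>v. sol v \<and> (normalized v \<longlongrightarrow> \<gamma>) F \<longrightarrow> agree v (u \<gamma>))) \<and>
    (\<forall>v. sol v \<longrightarrow> ((\<lambda>x. v x / U x) \<longlongrightarrow> 1) G \<and> radially_symmetric v) \<and>
    (\<forall>v. sol v \<longleftrightarrow> agree v U \<or> (\<exists>\<gamma>>0. agree v (u \<gamma>))) \<and>
    (\<forall>\<gamma> \<gamma>'. 0 < \<gamma> \<and> \<gamma> < \<gamma>' \<longrightarrow> (\<forall>x. x \<noteq> 0 \<longrightarrow> u \<gamma> x \<le> u \<gamma>' x \<and> u \<gamma>' x \<le> U x)) \<and>
    (\<forall>x. x \<noteq> 0 \<longrightarrow> ((\<lambda>\<gamma>. u \<gamma> x) \<longlongrightarrow> U x) at_top)"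
proof -
  obtain W W1 W2 k where W: "mono W" "\<And>t. 0 < W t" "\<And>t. W t \<le> 1" "(W \<longlongrightarrow> 1) at_top"
    "((\<lambda>t. W t / ode.decay t) \<longlongrightarrow> k) at_bot" "k > 0"
    "\<And>t. (W has_real_derivative W1 t) (at t)" "\<And>t. (W1 has_real_derivative W2 t) (at t)"
    "continuous_on UNIV W2" "\<And>t. W2 t - 2 * \<nu> * W1 t + ell * (W t - W t powr q) = 0"
    by (rule ode.heteroclinic) (rule that)
  interpret emden_profile X q lam \<theta> \<epsilon> a \<mu> \<nu> ell W W1 W2 k
    by unfold_locales (fact W)+
  have "sol (family \<gamma>)" for \<gamma> unfolding family_def by (rule V_sol)
  then show ?thesis
    using normalized_family_limit[OF F(1,2)] family_unique[OF F] solution_ratio_limit[OF G]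
      solution_radial solutions family_mono family_limit
    by (intro exI[of _ family] conjI allI impI) (simp_all, blast+)
qed

text \<open>\<open>is_solution\<close> is defined on \<open>real ^ 'n\<close> only, whereas the
  locale has a general Euclidean space; hence the predicate is abstracted to \<open>P\<close> with
  its defining property. The content is that the two lower-order integrals may be merged.\<close>

lemma is_solution_iff_sol:
  assumes sol_iff: "\<And>v::'a \<Rightarrow> real. P v \<longleftrightarrow> (\<forall>x. x \<noteq> 0 \<longrightarrow> v x > 0) \<and> C1_on (- {0}) v \<and>
     (\<forall>\<phi>. C1c_on (- {0}) \<phi> \<longrightarrow>
        (LINT x|lborel. gradient v x \<bullet> gradient \<phi> x)
        - (LINT x|lborel. lam / (norm x)\<^sup>2 * v x * \<phi> x)
        + (LINT x|lborel. norm x powr \<theta> * v x powr q * \<phi> x) = 0)"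
  shows "P u \<longleftrightarrow> sol u"
proof -
  have op: "open (- {0::'a})" by (intro open_Compl closed_singleton)
  have split: "(LINT x|lborel. (lam / (norm x)\<^sup>2 * u x - norm x powr \<theta> * u x powr q) * \<phi> x)
     = (LINT x|lborel. lam / (norm x)\<^sup>2 * u x * \<phi> x) - (LINT x|lborel. norm x powr \<theta> * u x powr q * \<phi> x)"
    and cont: "continuous_on (- {0}) (\<lambda>x. lam / (norm x)\<^sup>2 * u x - norm x powr \<theta> * u x powr q)"
    if u: "\<forall>x. x \<noteq> 0 \<longrightarrow> u x > 0" "C1_on (- {0}) u" and \<phi>: "C1c_on (- {0}) \<phi>" for \<phi>
  proof -
    have cu: "continuous_on (- {0}) u" using u(2) by (rule C1_on_continuous)
    have c1: "continuous_on (- {0}) (\<lambda>x. lam / (norm x)\<^sup>2 * u x)"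
      by (intro continuous_intros cu) auto
    have c2: "continuous_on (- {0}) (\<lambda>x. norm x powr \<theta> * u x powr q)"
      using u(1) by (intro continuous_intros cu) force+
    show "continuous_on (- {0}) (\<lambda>x. lam / (norm x)\<^sup>2 * u x - norm x powr \<theta> * u x powr q)"
      by (intro continuous_on_diff c1 c2)
    show "(LINT x|lborel. (lam / (norm x)\<^sup>2 * u x - norm x powr \<theta> * u x powr q) * \<phi> x)
     = (LINT x|lborel. lam / (norm x)\<^sup>2 * u x * \<phi> x) - (LINT x|lborel. norm x powr \<theta> * u x powr q * \<phi> x)"
      unfolding left_diff_distrib
      by (rule Bochner_Integration.integral_diff[OF weak_poisson_integrable(2)[OF u(2) c1 \<phi> op]
            weak_poisson_integrable(2)[OF u(2) c2 \<phi> op]])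
  qed
  \<comment> \<open>\<open>cont\<close> was obtained in the presence of a test function; the zero
    function supplies one.\<close>
  have zero: "C1c_on (- {0}) (\<lambda>_::'a. 0)"
    by (rule C1c_onI[where K = "{}"]) (auto intro!: C1_onI[where g = "\<lambda>_. 0"] GDERIV_const)
  show ?thesis
  proof
    assume "P u"
    then have u: "\<forall>x. x \<noteq> 0 \<longrightarrow> u x > 0" "C1_on (- {0}) u"
      and w: "\<And>\<phi>. C1c_on (- {0}) \<phi> \<Longrightarrow>
        (LINT x|lborel. gradient u x \<bullet> gradient \<phi> x)
        - (LINT x|lborel. lam / (norm x)\<^sup>2 * u x * \<phi> x)
        + (LINT x|lborel. norm x powr \<theta> * u x powr q * \<phi> x) = 0"
      unfolding sol_iff by blast+
    show "sol u"
      unfolding sol_def weak_poisson_def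
    proof (intro conjI allI impI)
      fix \<phi> :: "'a \<Rightarrow> real" assume \<phi>: "C1c_on (- {0}) \<phi>"
      show "(LINT x|lborel. gradient u x \<bullet> gradient \<phi> x)
        = (LINT x|lborel. (lam / (norm x)\<^sup>2 * u x - norm x powr \<theta> * u x powr q) * \<phi> x)"
        unfolding split[OF u \<phi>] using w[OF \<phi>] by linarith
    qed (use u cont[OF u zero] in auto)
  next
    assume u: "sol u"
    note D = weak_poissonD[OF solD(2)[OF u]]
    have pos: "\<forall>x. x \<noteq> 0 \<longrightarrow> u x > 0" using solD(1)[OF u] by blast
    show "P u"
      unfolding sol_iff
    proof (intro conjI allI impI)
      fix \<phi> :: "'a \<Rightarrow> real" assume \<phi>: "C1c_on (- {0}) \<phi>"
      show "(LINT x|lborel. gradient u x \<bullet> gradient \<phi> x)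
        - (LINT x|lborel. lam / (norm x)\<^sup>2 * u x * \<phi> x)
        + (LINT x|lborel. norm x powr \<theta> * u x powr q * \<phi> x) = 0"
        using D(3)[OF \<phi>] unfolding split[OF pos D(1) \<phi>] by linarith
    qed (use solD(1)[OF u] D(1) in auto)
  qed
qed

end

section \<open>Return to the original parameters\<close>

lemma emden_parameters:
  fixes q lam \<theta> \<epsilon> \<nu> :: real
  assumes n: "CARD('n::finite) \<ge> 3" and q: "q > 1" and \<epsilon>: "\<epsilon> = 1 \<or> \<epsilon> = -1" and lam: "lam \<le> lambda_H CARD('n)"
    and \<nu>: "sqrt (lambda_H CARD('n) - lam) < \<nu>" "\<epsilon> * \<nu> = Theta_exp q \<theta> - (real CARD('n) - 2) / 2"
  shows "emden TYPE(real ^ 'n) q lam \<theta> \<epsilon> ((real CARD('n) - 2) / 2) (sqrt (lambda_H CARD('n) - lam))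
    \<nu> (ell CARD('n) q lam \<theta>)"
proof
  let ?a = "(real CARD('n) - 2) / 2" and ?T = "Theta_exp q \<theta>"
  have lH: "lambda_H CARD('n) = ?a\<^sup>2" by (simp add: lambda_H_def power_divide)
  show "DIM(real ^ 'n) \<ge> 2" using n by simp
  show "?a = (real DIM(real ^ 'n) - 2) / 2" by simp
  show "0 \<le> sqrt (lambda_H CARD('n) - lam)" using lam by simp
  show sq: "(sqrt (lambda_H CARD('n) - lam))\<^sup>2 = ?a\<^sup>2 - lam" using lam lH by simp
  show "\<theta> + 2 = (q - 1) * (?a + \<epsilon> * \<nu>)" unfolding \<nu>(2) using q by (simp add: Theta_exp_def)
  \<comment> \<open>Completing the square: \<Theta>^2 - (N-2)\<Theta> + \<lambda> = (\<Theta> - a)^2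
    - (a^2 - \<lambda>).\<close>
  have "\<nu>\<^sup>2 = (\<epsilon> * \<nu>)\<^sup>2" using \<epsilon> by auto
  then show "ell CARD('n) q lam \<theta> = \<nu>\<^sup>2 - (sqrt (lambda_H CARD('n) - lam))\<^sup>2"
    unfolding sq \<nu>(2) by (simp add: ell_def power2_eq_square field_simps)
qed (use q \<epsilon> \<nu> in auto)

theorem theorem1p4:
  fixes q lam \<theta> :: real
  assumes "CARD('n::finite) \<ge> 3" and "q > 1"
  shows
    "(lam \<le> lambda_H CARD('n) \<and> \<theta> > theta_plus CARD('n) q lam \<longrightarrow>
       (\<exists>u :: real \<Rightarrow> real ^ 'n \<Rightarrow> real.
          (\<forall>\<gamma>>0. is_solution q lam \<theta> (u \<gamma>) \<and> limit_at_zero lam (u \<gamma>) \<gamma> \<and>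
             (\<forall>v :: real ^ 'n \<Rightarrow> real. is_solution q lam \<theta> v \<and> limit_at_zero lam v \<gamma> \<longrightarrow> agree v (u \<gamma>))) \<and>
          (\<forall>v :: real ^ 'n \<Rightarrow> real. is_solution q lam \<theta> v \<longrightarrow>
             ((\<lambda>x. v x / U0 q lam \<theta> x) \<longlongrightarrow> 1) at_infinity \<and> radially_symmetric v) \<and>
          (\<forall>v :: real ^ 'n \<Rightarrow> real. is_solution q lam \<theta> v \<longleftrightarrow>
             agree v (U0 q lam \<theta>) \<or> (\<exists>\<gamma>>0. agree v (u \<gamma>))) \<and>
          (\<forall>\<gamma> \<gamma>'. 0 < \<gamma> \<and> \<gamma> < \<gamma>' \<longrightarrow>
             (\<forall>x. x \<noteq> 0 \<longrightarrow> u \<gamma> x \<le> u \<gamma>' x \<and> u \<gamma>' x \<le> U0 q lam \<theta> x)) \<and>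
          (\<forall>x. x \<noteq> 0 \<longrightarrow> ((\<lambda>\<gamma>. u \<gamma> x) \<longlongrightarrow> U0 q lam \<theta> x) at_top)))
     \<and>
     (lam \<le> lambda_H CARD('n) \<and> \<theta> < theta_minus CARD('n) q lam \<longrightarrow>
       (\<exists>U :: real \<Rightarrow> real ^ 'n \<Rightarrow> real.
          (\<forall>\<gamma>>0. is_solution q lam \<theta> (U \<gamma>) \<and> limit_at_infinity lam (U \<gamma>) \<gamma> \<and>
             (\<forall>v :: real ^ 'n \<Rightarrow> real. is_solution q lam \<theta> v \<and> limit_at_infinity lam v \<gamma> \<longrightarrow> agree v (U \<gamma>))) \<and>
          (\<forall>v :: real ^ 'n \<Rightarrow> real. is_solution q lam \<theta> v \<longrightarrow>
             ((\<lambda>x. v x / U0 q lam \<theta> x) \<longlongrightarrow> 1) (at 0) \<and> radially_symmetric v) \<and>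
          (\<forall>v :: real ^ 'n \<Rightarrow> real. is_solution q lam \<theta> v \<longleftrightarrow>
             agree v (U0 q lam \<theta>) \<or> (\<exists>\<gamma>>0. agree v (U \<gamma>)))))"
proof -
  let ?N = "CARD('n)" and ?T = "Theta_exp q \<theta>"
  let ?a = "(real CARD('n) - 2) / 2" and ?\<mu> = "sqrt (lambda_H CARD('n) - lam)"
  have ln0: "filterlim (\<lambda>x::real^'n. ln (norm x)) at_bot (at 0)"
  proof (rule filterlim_compose[OF ln_at_0])
    show "filterlim (\<lambda>x::real^'n. norm x) (at_right 0) (at 0)"
      unfolding filterlim_at by (auto intro!: tendsto_norm_zero tendsto_ident_at simp: eventually_at_filter)
  qed
  have lninf: "filterlim (\<lambda>x::real^'n. ln (norm x)) at_top at_infinity"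
    by (rule filterlim_compose[OF ln_at_top filterlim_norm_at_top])
  have ev0: "\<forall>\<^sub>F x in at (0::real^'n). x \<noteq> 0" by (simp add: eventually_at_filter)
  have evinf: "\<forall>\<^sub>F x in at_infinity. x \<noteq> (0::real^'n)"
    unfolding eventually_at_infinity by (rule exI[of _ 1]) auto
  \<comment> \<open>The quotients that arise, in this order: limit at 0 with \<lambda> <
    \<lambda>_H, limit at 0 with \<lambda> = \<lambda>_H, then the same two for the limit at
    infinity.\<close>
  have alg: "v / inverse (A * M) = A * v * M" "v / (inverse A * - L) = A * v * (- 1 / L)"
    "A > 0 \<Longrightarrow> A * A * v / (A * M) = A * v * inverse M" "A > 0 \<Longrightarrow> A * A * v / (A * L) = A * v * (- 1 / - L)"
    for v A M L :: real
    by (simp_all add: divide_inverse)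
  have pw: "r powr - (b + d) = inverse (r powr b * r powr d)" for r b d :: real
    unfolding powr_minus powr_add ..
  have pi: "(1 / r) powr - b = r powr b" if "r > 0" for r b :: real
    by (subst powr_divide) (use that in \<open>auto simp: powr_minus divide_inverse\<close>)
  have \<Theta>: "\<theta> + 2 = ?T * (q - 1)" using assms(2) by (simp add: Theta_exp_def)
  show ?thesis
  proof (intro conjI impI, goal_cases)
    case H: 1
    \<comment> \<open>\<theta> > \<theta>_+ says \<Theta> > p_+, that is \<nu> > \<mu> for \<nu> =
      \<Theta> - a.\<close>
    then have "p_plus ?N lam * (q - 1) < ?T * (q - 1)" using \<Theta> by (simp add: theta_plus_def)
    then have "p_plus ?N lam < ?T" using assms(2) by simp
    then have \<mu>: "?\<mu> < ?T - ?a" by (simp add: p_plus_def)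
    define \<nu> where "\<nu> = ?T - ?a"
    have nu: "?\<mu> < \<nu>" "1 * \<nu> = ?T - ?a" "?a + \<nu> = ?T" using \<mu> by (auto simp: \<nu>_def)
    interpret emden "TYPE(real ^ 'n)" q lam \<theta> 1 ?a ?\<mu> \<nu> "ell ?N q lam \<theta>"
      by (rule emden_parameters[OF assms _ _ nu(1,2)]) (use H in auto)
    have sol: "is_solution q lam \<theta> v \<longleftrightarrow> sol v" for v by (rule is_solution_iff_sol) (rule is_solution_def)
    have U: "U0 q lam \<theta> = U"
      by (simp add: fun_eq_iff U0_def U_def c_def nu(3))
    have s: "s = (\<lambda>x. ln (norm x))" by (simp add: fun_eq_iff s_def)
    have norm: "v x / Phi_plus ?N lam (norm x) = normalized v x" if x: "x \<noteq> 0" for v x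
    proof (cases "lam < lambda_H ?N")
      case True
      then have \<mu>0: "?\<mu> > 0" by simp
      have "exp (?\<mu> * ln (norm x)) = norm x powr ?\<mu>" using x by (simp add: powr_def)
      then have "normalized v x = norm x powr ?a * v x * norm x powr ?\<mu>"
        using \<mu>0 unfolding normalized_def s by (simp only: if_True)
      moreover have "Phi_plus ?N lam (norm x) = inverse (norm x powr ?a * norm x powr ?\<mu>)"
        unfolding Phi_plus_def p_plus_def pw[symmetric] using True by (simp only: if_True)
      ultimately show ?thesis by (simp only: alg)
    next
      case False
      then have \<mu>0: "\<not> ?\<mu> > 0" by simp
      have "Phi_plus ?N lam (norm x) = inverse (norm x powr ?a) * - ln (norm x)"
        unfolding Phi_plus_def powr_minus[symmetric] using False x by (simp only: if_False) (simp add: ln_div)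
      moreover have "normalized v x = norm x powr ?a * v x * (- 1 / ln (norm x))"
        using \<mu>0 unfolding normalized_def s by (simp only: if_False)
      ultimately show ?thesis by (simp only: alg)
    qed
    have lim: "limit_at_zero lam v \<gamma> \<longleftrightarrow> (normalized v \<longlongrightarrow> \<gamma>) (at 0)" for v \<gamma>
      unfolding limit_at_zero_def
      by (rule tendsto_cong) (use ev0 in eventually_elim, simp add: norm)
    show ?case
      unfolding sol lim U
      by (rule solution_structure) (simp_all add: s ln0 lninf ev0 evinf)
  next
    case H: 2
    \<comment> \<open>\<theta> < \<theta>_- says \<Theta> < p_-; now \<nu> = a - \<Theta> exceeds
      \<mu>, and the reversed sign is carried by \<epsilon> = -1.\<close>
    then have "?T * (q - 1) < p_minus ?N lam * (q - 1)" using \<Theta> by (simp add: theta_minus_def)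
    then have "?T < p_minus ?N lam" using assms(2) by simp
    then have \<mu>: "?\<mu> < ?a - ?T" by (simp add: p_minus_def)
    define \<nu> where "\<nu> = ?a - ?T"
    have nu: "?\<mu> < \<nu>" "-1 * \<nu> = ?T - ?a" "?a - \<nu> = ?T" using \<mu> by (auto simp: \<nu>_def)
    interpret emden "TYPE(real ^ 'n)" q lam \<theta> "-1" ?a ?\<mu> \<nu> "ell ?N q lam \<theta>"
      by (rule emden_parameters[OF assms _ _ nu(1,2)]) (use H in auto)
    have sol: "is_solution q lam \<theta> v \<longleftrightarrow> sol v" for v by (rule is_solution_iff_sol) (rule is_solution_def)
    have U: "U0 q lam \<theta> = U"
      by (simp add: fun_eq_iff U0_def U_def c_def nu(3))
    have s: "s = (\<lambda>x. - ln (norm x))" by (simp add: fun_eq_iff s_def)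
    have norm: "norm x powr (real ?N - 2) * v x / Phi_plus ?N lam (1 / norm x) = normalized v x"
      if x: "x \<noteq> 0" for v x
    proof -
      have N: "norm x powr (real ?N - 2) = norm x powr ?a * norm x powr ?a"
        unfolding powr_add[symmetric] by (rule arg_cong) simp
      have n: "norm x > 0" "norm x powr ?a > 0" using x by auto
      show ?thesis
      proof (cases "lam < lambda_H ?N")
        case True
        then have \<mu>0: "?\<mu> > 0" by simp
        have "exp (?\<mu> * - ln (norm x)) = inverse (norm x powr ?\<mu>)" using x by (simp add: powr_def exp_minus)
        then have "normalized v x = norm x powr ?a * v x * inverse (norm x powr ?\<mu>)"
          using \<mu>0 unfolding normalized_def s by (simp only: if_True)
        moreover have "Phi_plus ?N lam (1 / norm x) = norm x powr ?a * norm x powr ?\<mu>"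
          unfolding Phi_plus_def p_plus_def pi[OF n(1)] powr_add[symmetric] using True by (simp only: if_True)
        ultimately show ?thesis unfolding N by (simp only: alg(3)[OF n(2)])
      next
        case False
        then have \<mu>0: "\<not> ?\<mu> > 0" by simp
        have "Phi_plus ?N lam (1 / norm x) = norm x powr ?a * ln (norm x)"
          unfolding Phi_plus_def pi[OF n(1)] using False by (simp only: if_False) simp
        moreover have "normalized v x = norm x powr ?a * v x * (- 1 / - ln (norm x))"
          using \<mu>0 unfolding normalized_def s by (simp only: if_False)
        ultimately show ?thesis unfolding N by (simp only: alg(4)[OF n(2)])
      qed
    qed
    have lim: "limit_at_infinity lam v \<gamma> \<longleftrightarrow> (normalized v \<longlongrightarrow> \<gamma>) at_infinity" for v \<gamma>
      unfolding limit_at_infinity_def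
      by (rule tendsto_cong) (use evinf in eventually_elim, simp add: norm)
    have bot: "filterlim s at_bot at_infinity" unfolding s filterlim_uminus_at_bot by (simp add: lninf)
    have top: "filterlim s at_top (at 0)" unfolding s filterlim_uminus_at_top by (simp add: ln0)
    show ?case
      using solution_structure[OF bot evinf trivial_limit_at_infinity top ev0] unfolding sol lim U
      by (elim ex_forward conjE, intro conjI)
  qed
qed

end
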